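(* For all $\phi$ and $\psi$ in $(C^\mu(S^1))^*$, we have $\delta(\phi, \psi) = \pi(\phi, \psi)$.
   Context: $C^\mu(S^1)$ is the algebra of complex-valued functions on the unit circle $S^1$ that have a meromorphic extension to a neighborhood of the closed unit disk; the extension is denoted by the same symbol. $(C^\mu(S^1))^*$ is the multiplicative group of those functions in $C^\mu(S^1)$ whose meromorphic extension has no poles or zeros on $S^1$. $\mathbb{D}$ is the open unit disk. Tame symbol and $\pi$: for $\phi\in (C^\mu(S^1))^*$ and $z\in\mathbb{D}$, let $v(\phi,z)=m$ if $\phi$ has a zero of order $m$ at $z$, $-m$ if $\phi$ has a pole of order $m$ at $z$, and $0$ otherwise. Set \[ (\phi,\psi)_z=\lim_{w\to z}(-1)^{v(\phi,z)v(\psi,z)}\frac{\psi(w)^{v(\phi,z)}}{\phi(w)^{v(\psi,z)}},\qquad \pi(\phi,\psi)=\prod_{z\in\mathbb{D}}(\phi,\psi)_z^{-1} \] (all but finitely many factors are $1$). Operators and $\delta$: $H^2(S^1)$ is the Hardy space, $T_\phi$ the Toeplitz operator $T_\phi f=P(\phi f)$ on it, where $P:L^2(S^1)\to H^2(S^1)$ is the orthogonal projection, and $\mathcal{L}^1$ the ideal of trace class operators on $H^2(S^1)$. $\mathcal{T}^\mu=\{T_\phi+L:\phi\in C^\mu(S^1),\,L\in\mathcal{L}^1\}$ is a $\mathbb{C}$-algebra, and the symbol map $\sigma:\mathcal{T}^\mu\to C^\mu(S^1)$, $\sigma(T_\phi+L)=\phi$, is an algebra homomorphism with kernel $\mathcal{L}^1$;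 $\sigma$ is extended entrywise to $3\times 3$ matrices. $\mathrm{GL}(3,\mathcal{T}^\mu)$ is the group of invertible $3\times3$ matrices over $\mathcal{T}^\mu$. For $\phi,\psi\in (C^\mu(S^1))^*$ put $\Phi^{1,2}=\mathrm{diag}(\phi,\phi^{-1},1)$ and $\Psi^{1,3}=\mathrm{diag}(\psi,1,\psi^{-1})$. Then \[ \delta(\phi,\psi)=\det(RSR^{-1}S^{-1}), \] where $R,S$ are any elements of $\mathrm{GL}(3,\mathcal{T}^\mu)$ with $\sigma(R)=\Phi^{1,2}$ and $\sigma(S)=\Psi^{1,3}$; such $R,S$ exist, $RSR^{-1}S^{-1}$ is the identity plus a trace class operator on $H^2(S^1)^{\oplus 3}$, $\det$ is the Fredholm determinant, and the value does not depend on the choice of $R$ and $S$. *)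

theory Defs
  imports "HOL-Complex_Analysis.Complex_Analysis"
begin

text \<open>The inner product is linear in the second argument. Its real part is the library's
  real inner product, which induces the norm and the topology.\<close>

class complex_inner = real_inner +
  fixes scaleC :: "complex \<Rightarrow> 'a \<Rightarrow> 'a"  (infixr \<open>*\<^sub>C\<close> 75)
    and cinner :: "'a \<Rightarrow> 'a \<Rightarrow> complex"
  assumes scaleC_add_right: "c *\<^sub>C (x + y) = c *\<^sub>C x + c *\<^sub>C y"
    and scaleC_add_left: "(c + d) *\<^sub>C x = c *\<^sub>C x + d *\<^sub>C x"
    and scaleC_scaleC: "c *\<^sub>C d *\<^sub>C x = (c * d) *\<^sub>C x"
    and scaleC_of_real: "complex_of_real r *\<^sub>C x = scaleR r x"
    and cinner_commute: "cinner x y = cnj (cinner y x)"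
    and cinner_add_right: "cinner x (y + z) = cinner x y + cinner x z"
    and cinner_scaleC_right: "cinner x (c *\<^sub>C y) = c * cinner x y"
    and Re_cinner: "Re (cinner x y) = inner x y"

definition bounded_clinear :: "('a::complex_inner \<Rightarrow> 'b::complex_inner) \<Rightarrow> bool" where
  "bounded_clinear A \<longleftrightarrow> bounded_linear A \<and> (\<forall>c x. A (c *\<^sub>C x) = c *\<^sub>C A x)"

definition orthonormal_basis :: "'a::complex_inner set \<Rightarrow> bool" where
  "orthonormal_basis E \<longleftrightarrow>
     (\<forall>e\<in>E. \<forall>f\<in>E. cinner e f = (if e = f then 1 else 0)) \<and>
     (\<forall>x. (\<forall>e\<in>E. cinner e x = 0) \<longrightarrow> x = 0)"

text \<open>Trace class operators on a Hilbert space are defined as the nuclear ones: absolutely convergent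
  sums of rank one operators. Completeness is not part of the class \<open>complex_inner\<close>; it holds for
  the instances used below.\<close>

definition trace_class :: "('a::complex_inner \<Rightarrow> 'a) \<Rightarrow> bool" where
  "trace_class A \<longleftrightarrow> (\<exists>x y :: nat \<Rightarrow> 'a.
     summable (\<lambda>n. norm (x n) * norm (y n)) \<and>
     (\<forall>v. (\<lambda>n. cinner (y n) v *\<^sub>C x n) sums A v))"

definition section_det :: "('a::complex_inner \<Rightarrow> 'a) \<Rightarrow> 'a set \<Rightarrow> complex" where
  "section_det T F =
     (\<Sum>p | p permutes F. of_int (sign p) * (\<Prod>e\<in>F. cinner e (T (p e))))"

text \<open>Fredholm determinant of an operator \<open>T = 1 + A\<close> with \<open>A\<close> of trace class.
  For a finite subset \<open>F\<close> of an orthonormal basis \<open>E\<close>, with orthogonal projection \<open>Q\<close> onto the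
  span of \<open>F\<close>, \<^term>\<open>section_det T F\<close> is the determinant of \<open>1 + Q A Q\<close>. As \<open>F\<close> grows to \<open>E\<close> the
  finite rank operators \<open>Q A Q\<close> tend to \<open>A\<close> in trace norm, and the Fredholm determinant is
  the trace norm continuous extension of the determinant of \<open>1 +\<close> finite rank. The limit is required
  to be the same for every orthonormal basis.\<close>

definition fredholm_det :: "('a::complex_inner \<Rightarrow> 'a) \<Rightarrow> complex" where
  "fredholm_det T = (THE d. \<forall>E. orthonormal_basis E \<longrightarrow>
     (section_det T \<longlongrightarrow> d) (finite_subsets_at_top E))"

instantiation vec :: (complex_inner, finite) complex_inner
begin

definition "c *\<^sub>C x = (\<chi> i. c *\<^sub>C (x $ i))"

definition "cinner x y = (\<Sum>i\<in>UNIV. cinner (x $ i) (y $ i))"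

instance
proof
  fix c d :: complex and r :: real and x y z :: "'a ^ 'b"
  show "c *\<^sub>C (x + y) = c *\<^sub>C x + c *\<^sub>C y"
    by (simp add: scaleC_vec_def vec_eq_iff scaleC_add_right)
  show "(c + d) *\<^sub>C x = c *\<^sub>C x + d *\<^sub>C x"
    by (simp add: scaleC_vec_def vec_eq_iff scaleC_add_left)
  show "c *\<^sub>C d *\<^sub>C x = (c * d) *\<^sub>C x"
    by (simp add: scaleC_vec_def vec_eq_iff scaleC_scaleC)
  show "complex_of_real r *\<^sub>C x = scaleR r x"
    by (simp add: scaleC_vec_def vec_eq_iff scaleC_of_real)
  show "cinner x y = cnj (cinner y x)"
    by (simp add: cinner_vec_def cinner_commute[symmetric])
  show "cinner x (y + z) = cinner x y + cinner x z"
    by (simp add: cinner_vec_def cinner_add_right sum.distrib)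
  show "cinner x (c *\<^sub>C y) = c * cinner x y"
    by (simp add: cinner_vec_def scaleC_vec_def cinner_scaleC_right sum_distrib_left)
  show "Re (cinner x y) = inner x y"
    by (simp add: cinner_vec_def inner_vec_def Re_cinner)
qed

end

text \<open>Functions on the circle are functions on \<^typ>\<open>complex\<close> of which only the values on the unit
  circle matter; the underlying space of the measure below is the unit circle itself.\<close>

abbreviation circle :: "complex set" where
  "circle \<equiv> sphere 0 1"

definition circle_measure :: "complex measure" where
  "circle_measure =
     distr (uniform_measure lborel {0..2 * pi}) (restrict_space borel circle) cis"

definition square_integrable :: "(complex \<Rightarrow> complex) \<Rightarrow> bool" where
  "square_integrable f \<longleftrightarrow>
     f \<in> borel_measurable circle_measure \<and> integrable circle_measure (\<lambda>z. (cmod (f z))\<^sup>2)"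

lemma space_circle_measure [simp]: "space circle_measure = circle"
  by (simp add: circle_measure_def)

lemma sets_circle_measure [measurable_cong]:
  "sets circle_measure = sets (restrict_space borel circle)"
  by (simp add: circle_measure_def)

lemma cis_measurable_circle [measurable]: "cis \<in> measurable borel (restrict_space borel circle)"
  by (intro measurable_restrict_space2 borel_measurable_continuous_onI continuous_intros) auto

lemma emeasure_circle_measure: "emeasure circle_measure circle = 1"
proof -
  have cis: "cis \<in> measurable (uniform_measure lborel {0..2 * pi}) (restrict_space borel circle)"
    using cis_measurable_circle by simp
  have "circle \<in> sets (restrict_space borel circle)"
    using sets.top[of "restrict_space borel circle"] by simp
  with cis have "emeasure circle_measure circle =
      emeasure (uniform_measure lborel {0..2 * pi}) (cis -` circle \<inter> UNIV)"
    by (simp add: circle_measure_def emeasure_distr)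
  also have "cis -` circle \<inter> UNIV = (UNIV :: real set)"
    by auto
  also have "emeasure (uniform_measure lborel {0..2 * pi}) UNIV = 1"
    by (simp add: emeasure_uniform_measure ennreal_divide_self)
  finally show ?thesis .
qed

lemma finite_measure_circle: "finite_measure circle_measure"
  by (rule finite_measureI) (simp add: emeasure_circle_measure)

lemma square_integrable_product:
  assumes "square_integrable f" "square_integrable g"
  shows "integrable circle_measure (\<lambda>z. cnj (f z) * g z)"
proof (rule Bochner_Integration.integrable_bound)
  show "integrable circle_measure (\<lambda>z. (cmod (f z))\<^sup>2 + (cmod (g z))\<^sup>2)"
    using assms by (simp add: square_integrable_def)
  have [measurable]: "f \<in> borel_measurable circle_measure" "g \<in> borel_measurable circle_measure"
    using assms by (auto simp: square_integrable_def)
  have [measurable]: "cnj \<in> borel_measurable borel"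
    by (intro borel_measurable_continuous_onI continuous_intros)
  show "(\<lambda>z. cnj (f z) * g z) \<in> borel_measurable circle_measure"
    by measurable
  have "norm (cnj a * b) \<le> norm ((cmod a)\<^sup>2 + (cmod b)\<^sup>2)" for a b :: complex
  proof -
    have "2 * (cmod a * cmod b) \<le> (cmod a)\<^sup>2 + (cmod b)\<^sup>2"
      using sum_squares_bound[of "cmod a" "cmod b"] by simp
    moreover have "0 \<le> cmod a * cmod b" by simp
    ultimately have "cmod a * cmod b \<le> (cmod a)\<^sup>2 + (cmod b)\<^sup>2" by linarith
    then show ?thesis by (simp add: norm_mult)
  qed
  then show "AE z in circle_measure. norm (cnj (f z) * g z)
      \<le> norm ((cmod (f z))\<^sup>2 + (cmod (g z))\<^sup>2)"
    by simp
qed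

lemma square_integrable_add:
  assumes "square_integrable f" "square_integrable g"
  shows "square_integrable (\<lambda>z. f z + g z)"
proof -
  have [measurable]: "f \<in> borel_measurable circle_measure" "g \<in> borel_measurable circle_measure"
    using assms by (auto simp: square_integrable_def)
  have "integrable circle_measure (\<lambda>z. (cmod (f z + g z))\<^sup>2)"
  proof (rule Bochner_Integration.integrable_bound)
    show "integrable circle_measure (\<lambda>z. 2 * (cmod (f z))\<^sup>2 + 2 * (cmod (g z))\<^sup>2)"
      using assms by (simp add: square_integrable_def)
    show "(\<lambda>z. (cmod (f z + g z))\<^sup>2) \<in> borel_measurable circle_measure"
      by measurable
    have "(cmod (a + b))\<^sup>2 \<le> 2 * (cmod a)\<^sup>2 + 2 * (cmod b)\<^sup>2" for a b
    proof -
      have "(cmod (a + b))\<^sup>2 \<le> (cmod a + cmod b)\<^sup>2"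
        by (intro power_mono norm_triangle_ineq) auto
      also have "\<dots> \<le> 2 * (cmod a)\<^sup>2 + 2 * (cmod b)\<^sup>2"
        using sum_squares_bound[of "cmod a" "cmod b"] by (simp add: power2_sum)
      finally show ?thesis .
    qed
    then show "AE z in circle_measure. norm ((cmod (f z + g z))\<^sup>2)
        \<le> norm (2 * (cmod (f z))\<^sup>2 + 2 * (cmod (g z))\<^sup>2)"
      by simp
  qed
  then show ?thesis by (simp add: square_integrable_def)
qed

lemma square_integrable_scale:
  assumes "square_integrable f" shows "square_integrable (\<lambda>z. c * f z)"
  using assms by (auto simp: square_integrable_def norm_mult power_mult_distrib)

lemma square_integrable_const: "square_integrable (\<lambda>z. c)"
proof -
  interpret finite_measure circle_measure by (rule finite_measure_circle)
  show ?thesis by (simp add: square_integrable_def)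
qed

definition L2_rel :: "(complex \<Rightarrow> complex) \<Rightarrow> (complex \<Rightarrow> complex) \<Rightarrow> bool" where
  "L2_rel f g \<longleftrightarrow> square_integrable f \<and> square_integrable g \<and>
     (AE z in circle_measure. f z = g z)"

quotient_type circle_L2 = "complex \<Rightarrow> complex" / partial: L2_rel
proof (rule part_equivpI)
  show "\<exists>f. L2_rel f f"
    using square_integrable_const[of 0] by (auto simp: L2_rel_def)
  show "symp L2_rel"
    by (auto simp: symp_def L2_rel_def elim: AE_mp)
  show "transp L2_rel"
    by (auto simp: transp_def L2_rel_def elim: AE_mp)
qed

lemma L2_rel_integral:
  assumes "L2_rel f f'" "L2_rel g g'"
  shows "(LINT z|circle_measure. cnj (f z) * g z) = (LINT z|circle_measure. cnj (f' z) * g' z)"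
proof (rule integral_cong_AE)
  show "(\<lambda>z. cnj (f z) * g z) \<in> borel_measurable circle_measure"
    "(\<lambda>z. cnj (f' z) * g' z) \<in> borel_measurable circle_measure"
    using assms by (auto simp: L2_rel_def intro!: borel_measurable_integrable square_integrable_product)
  show "AE z in circle_measure. cnj (f z) * g z = cnj (f' z) * g' z"
    using assms unfolding L2_rel_def by (auto elim: AE_mp)
qed

instantiation circle_L2 :: complex_inner
begin

lift_definition zero_circle_L2 :: circle_L2 is "\<lambda>z. 0"
  by (simp add: L2_rel_def square_integrable_const)

lift_definition plus_circle_L2 :: "circle_L2 \<Rightarrow> circle_L2 \<Rightarrow> circle_L2" is "\<lambda>f g z. f z + g z"
  by (auto simp: L2_rel_def square_integrable_add elim: AE_mp)

lift_definition scaleC_circle_L2 :: "complex \<Rightarrow> circle_L2 \<Rightarrow> circle_L2" is "\<lambda>c f z. c * f z"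
  by (auto simp: L2_rel_def square_integrable_scale elim: AE_mp)

lift_definition cinner_circle_L2 :: "circle_L2 \<Rightarrow> circle_L2 \<Rightarrow> complex"
  is "\<lambda>f g. LINT z|circle_measure. cnj (f z) * g z"
  by (rule L2_rel_integral)

definition "scaleR r (f::circle_L2) = complex_of_real r *\<^sub>C f"
definition "- (f::circle_L2) = (-1) *\<^sub>C f"
definition "f - (g::circle_L2) = f + - g"
definition "inner f (g::circle_L2) = Re (cinner f g)"
definition "norm (f::circle_L2) = sqrt (inner f f)"
definition "sgn (f::circle_L2) = scaleR (inverse (norm f)) f"
definition "dist f (g::circle_L2) = norm (f - g)"
definition [code del]:
  "(uniformity :: (circle_L2 \<times> circle_L2) filter) = (INF e\<in>{0 <..}. principal {(x, y). dist x y < e})"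
definition [code del]:
  "open (U :: circle_L2 set) \<longleftrightarrow> (\<forall>x\<in>U. eventually (\<lambda>(x', y). x' = x \<longrightarrow> y \<in> U) uniformity)"

instance
proof
  fix c d :: complex and r s :: real and x y z :: circle_L2 and U :: "circle_L2 set"
  show assoc: "x + y + z = x + (y + z)"
    by transfer (auto simp: L2_rel_def algebra_simps intro!: square_integrable_add)
  show "x + y = y + x"
    by transfer (auto simp: L2_rel_def algebra_simps intro!: square_integrable_add)
  show "0 + x = x"
    by transfer (auto simp: L2_rel_def)
  show "- x + x = 0"
    unfolding uminus_circle_L2_def
    by transfer (auto simp: L2_rel_def square_integrable_const
        intro!: square_integrable_add square_integrable_scale dest: square_integrable_scale[where c="-1"])
  show "x - y = x + - y"
    by (simp add: minus_circle_L2_def)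
  show cr: "c *\<^sub>C (x + y) = c *\<^sub>C x + c *\<^sub>C y" for c :: complex and x y :: circle_L2
    by transfer (auto simp: L2_rel_def algebra_simps
        intro!: square_integrable_add square_integrable_scale)
  show cl: "(c + d) *\<^sub>C x = c *\<^sub>C x + d *\<^sub>C x" for c d :: complex and x :: circle_L2
  proof (transfer, unfold L2_rel_def, safe)
    fix c d and x assume "square_integrable x"
    show "square_integrable (\<lambda>z. (c + d) * x z)"
      by (rule square_integrable_scale) fact
    show "square_integrable (\<lambda>z. c * x z + d * x z)"
      by (intro square_integrable_add square_integrable_scale) fact+
  qed (auto simp: algebra_simps)
  show cc: "c *\<^sub>C d *\<^sub>C x = (c * d) *\<^sub>C x" for c d :: complex and x :: circle_L2
    by transfer (auto simp: L2_rel_def algebra_simps intro!: square_integrable_scale)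
  show "complex_of_real r *\<^sub>C x = scaleR r x"
    by (simp add: scaleR_circle_L2_def)
  show "scaleR r (x + y) = scaleR r x + scaleR r y"
    by (simp add: scaleR_circle_L2_def cr)
  show "scaleR (r + s) x = scaleR r x + scaleR s x"
    by (simp add: scaleR_circle_L2_def cl)
  show "scaleR r (scaleR s x) = scaleR (r * s) x"
    by (simp add: scaleR_circle_L2_def cc)
  show "scaleR 1 x = x"
    unfolding scaleR_circle_L2_def by transfer (auto simp: L2_rel_def)
  show comm: "cinner x y = cnj (cinner y x)" for x y :: circle_L2
    by transfer (simp flip: Bochner_Integration.integral_cnj add: mult.commute)
  show cadd: "cinner x (y + z) = cinner x y + cinner x z" for x y z :: circle_L2
    by transfer (simp add: L2_rel_def ring_distribs square_integrable_product)
  show csc: "cinner x (c *\<^sub>C y) = c * cinner x y" for c and x y :: circle_L2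
  proof transfer
    fix x c y assume "L2_rel x x" "L2_rel y y"
    have "(LINT z|circle_measure. cnj (x z) * (c * y z)) =
        (LINT z|circle_measure. c * (cnj (x z) * y z))"
      by (simp add: mult_ac)
    then show "(LINT z|circle_measure. cnj (x z) * (c * y z)) =
        c * (LINT z|circle_measure. cnj (x z) * y z)"
      by simp
  qed
  show "Re (cinner x y) = inner x y"
    by (simp add: inner_circle_L2_def)
  show ic: "inner x y = inner y x" for x y :: circle_L2
    unfolding inner_circle_L2_def by (subst comm) simp
  show "inner (x + y) z = inner x z + inner y z"
    unfolding ic[of _ z] by (simp add: inner_circle_L2_def cadd)
  show "inner (scaleR r x) y = r * inner x y"
    unfolding ic[of _ y] by (simp add: inner_circle_L2_def scaleR_circle_L2_def csc)
  have nn: "inner x x \<ge> 0 \<and> (inner x x = 0 \<longleftrightarrow> x = 0)"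
    unfolding inner_circle_L2_def
  proof transfer
    fix f assume "L2_rel f f"
    then have f: "square_integrable f" by (simp add: L2_rel_def)
    have "(LINT z|circle_measure. cnj (f z) * f z) =
        (LINT z|circle_measure. complex_of_real ((cmod (f z))\<^sup>2))"
      by (intro Bochner_Integration.integral_cong) (simp_all only: complex_norm_square mult.commute)
    then have eq: "Re (LINT z|circle_measure. cnj (f z) * f z) =
        (LINT z|circle_measure. (cmod (f z))\<^sup>2)"
      by (simp del: of_real_power)
    have "(LINT z|circle_measure. (cmod (f z))\<^sup>2) = 0 \<longleftrightarrow>
        (AE z in circle_measure. (cmod (f z))\<^sup>2 = 0)"
      using f by (intro integral_nonneg_eq_0_iff_AE) (auto simp: square_integrable_def)
    also have "\<dots> \<longleftrightarrow> L2_rel f (\<lambda>z. 0)"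
      using f by (simp add: L2_rel_def square_integrable_const)
    finally show "0 \<le> Re (LINT z|circle_measure. cnj (f z) * f z) \<and>
        (Re (LINT z|circle_measure. cnj (f z) * f z) = 0 \<longleftrightarrow> L2_rel f (\<lambda>z. 0))"
      by (simp add: eq)
  qed
  then show "0 \<le> inner x x" "inner x x = 0 \<longleftrightarrow> x = 0" by auto
  show "norm x = sqrt (inner x x)" by (simp add: norm_circle_L2_def)
  show "sgn x = scaleR (inverse (norm x)) x" by (simp add: sgn_circle_L2_def)
  show "dist x y = norm (x - y)" by (simp add: dist_circle_L2_def)
  show "(uniformity :: (circle_L2 \<times> circle_L2) filter) =
      (INF e\<in>{0 <..}. principal {(x, y). dist x y < e})"
    by (simp add: uniformity_circle_L2_def)
  show "open U \<longleftrightarrow> (\<forall>x\<in>U. eventually (\<lambda>(x', y). x' = x \<longrightarrow> y \<in> U) uniformity)"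
    by (simp add: open_circle_L2_def)
qed

end

lift_definition L2_monom :: "int \<Rightarrow> circle_L2" is "\<lambda>k z. z powi k"
proof -
  fix k :: int
  interpret finite_measure circle_measure by (rule finite_measure_circle)
  have "continuous_on circle (\<lambda>z::complex. z powi k)"
    by (intro continuous_intros) auto
  then have meas: "(\<lambda>z. z powi k) \<in> borel_measurable circle_measure"
    by (subst measurable_cong_sets[OF sets_circle_measure refl])
      (rule borel_measurable_continuous_on_restrict)
  have "integrable circle_measure (\<lambda>z. (cmod (z powi k))\<^sup>2)"
  proof (rule integrable_const_bound[where B = 1])
    show "AE z in circle_measure. norm ((cmod (z powi k))\<^sup>2) \<le> 1"
      by (rule AE_I2) (simp add: norm_power_int)
  qed (use meas in measurable)
  with meas show "L2_rel (\<lambda>z. z powi k) (\<lambda>z. z powi k)"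
    by (simp add: L2_rel_def square_integrable_def)
qed

definition fourier_coeff :: "circle_L2 \<Rightarrow> int \<Rightarrow> complex" where
  "fourier_coeff f k = cinner (L2_monom k) f"

lemma cinner_zero_right [simp]: "cinner x 0 = 0"
  using cinner_add_right[of x 0 0] by simp

lemma cinner_scaleR_right: "cinner x (scaleR r y) = of_real r * cinner x y"
  by (simp add: scaleC_of_real[symmetric] cinner_scaleC_right)

lemma cinner_minus_right: "cinner x (- y) = - cinner x y"
  using cinner_add_right[of x y "- y"] by (simp add: add_eq_0_iff)

lemma cinner_diff_right: "cinner x (y - z) = cinner x y - cinner x z"
  using cinner_add_right[of x y "- z"] by (simp add: cinner_minus_right)

typedef hardy = "{f :: circle_L2. \<forall>k<0. fourier_coeff f k = 0}"
  by (rule exI[of _ 0]) (simp add: fourier_coeff_def)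

setup_lifting type_definition_hardy

instantiation hardy :: complex_inner
begin

lift_definition zero_hardy :: hardy is 0
  by (simp add: fourier_coeff_def)
lift_definition plus_hardy :: "hardy \<Rightarrow> hardy \<Rightarrow> hardy" is "(+)"
  by (simp add: fourier_coeff_def cinner_add_right)
lift_definition minus_hardy :: "hardy \<Rightarrow> hardy \<Rightarrow> hardy" is "(-)"
  by (simp add: fourier_coeff_def cinner_diff_right)
lift_definition uminus_hardy :: "hardy \<Rightarrow> hardy" is uminus
  by (simp add: fourier_coeff_def cinner_minus_right)
lift_definition scaleR_hardy :: "real \<Rightarrow> hardy \<Rightarrow> hardy" is scaleR
  by (simp add: fourier_coeff_def cinner_scaleR_right)
lift_definition scaleC_hardy :: "complex \<Rightarrow> hardy \<Rightarrow> hardy" is scaleC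
  by (simp add: fourier_coeff_def cinner_scaleC_right)
lift_definition inner_hardy :: "hardy \<Rightarrow> hardy \<Rightarrow> real" is inner .
lift_definition cinner_hardy :: "hardy \<Rightarrow> hardy \<Rightarrow> complex" is cinner .
lift_definition norm_hardy :: "hardy \<Rightarrow> real" is norm .

definition "sgn (f::hardy) = scaleR (inverse (norm f)) f"
definition "dist f (g::hardy) = norm (f - g)"
definition [code del]:
  "(uniformity :: (hardy \<times> hardy) filter) = (INF e\<in>{0 <..}. principal {(x, y). dist x y < e})"
definition [code del]:
  "open (U :: hardy set) \<longleftrightarrow> (\<forall>x\<in>U. eventually (\<lambda>(x', y). x' = x \<longrightarrow> y \<in> U) uniformity)"

instance
proof
  fix c d :: complex and r s :: real and x y z :: hardy and U :: "hardy set"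
  show "x + y + z = x + (y + z)" "x + y = y + x" "0 + x = x" "- x + x = 0" "x - y = x + - y"
    by (transfer; simp add: algebra_simps)+
  show "scaleR r (x + y) = scaleR r x + scaleR r y" "scaleR (r + s) x = scaleR r x + scaleR s x"
    "scaleR r (scaleR s x) = scaleR (r * s) x" "scaleR 1 x = x"
    by (transfer; simp add: algebra_simps)+
  show "c *\<^sub>C (x + y) = c *\<^sub>C x + c *\<^sub>C y" "(c + d) *\<^sub>C x = c *\<^sub>C x + d *\<^sub>C x"
    "c *\<^sub>C d *\<^sub>C x = (c * d) *\<^sub>C x" "complex_of_real r *\<^sub>C x = scaleR r x"
    by (transfer; simp add: scaleC_add_right scaleC_add_left scaleC_scaleC scaleC_of_real)+
  show "cinner x y = cnj (cinner y x)"
    by transfer (rule cinner_commute)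
  show "cinner x (y + z) = cinner x y + cinner x z" "cinner x (c *\<^sub>C y) = c * cinner x y"
    "Re (cinner x y) = inner x y"
    by (transfer; simp add: cinner_add_right cinner_scaleC_right Re_cinner)+
  show "inner x y = inner y x"
    by transfer (rule inner_commute)
  show "inner (x + y) z = inner x z + inner y z" "inner (scaleR r x) y = r * inner x y"
    "0 \<le> inner x x" "inner x x = 0 \<longleftrightarrow> x = 0" "norm x = sqrt (inner x x)"
    by (transfer; simp add: inner_add_left norm_eq_sqrt_inner)+
  show "sgn x = scaleR (inverse (norm x)) x" by (simp add: sgn_hardy_def)
  show "dist x y = norm (x - y)" by (simp add: dist_hardy_def)
  show "(uniformity :: (hardy \<times> hardy) filter) =
      (INF e\<in>{0 <..}. principal {(x, y). dist x y < e})"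
    by (simp add: uniformity_hardy_def)
  show "open U \<longleftrightarrow> (\<forall>x\<in>U. eventually (\<lambda>(x', y). x' = x \<longrightarrow> y \<in> U) uniformity)"
    by (simp add: open_hardy_def)
qed

end

lemma integral_powi_circle:
  assumes "k \<noteq> 0" shows "(LINT z|circle_measure. z powi k) = 0"
proof -
  have um: "uniform_measure lborel {0..2 * pi} =
      density lborel (\<lambda>t. ennreal (indicator {0..2 * pi} t / (2 * pi)))"
    unfolding uniform_measure_def
  proof (rule density_cong)
    show "AE t in lborel. indicator {0..2 * pi} t / emeasure lborel {0..2 * pi} =
        ennreal (indicator {0..2 * pi} t / (2 * pi))"
    proof (rule AE_I2)
      fix t :: real
      have "(1::ennreal) / ennreal (2 * pi) = ennreal (1 / (2 * pi))"
        by (metis divide_ennreal ennreal_1 pi_gt_zero zero_le_one mult_pos_pos zero_less_numeral)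
      then show "indicator {0..2 * pi} t / emeasure lborel {0..2 * pi} =
          ennreal (indicator {0..2 * pi} t / (2 * pi))"
        by (cases "t \<in> {0..2 * pi}") simp_all
    qed
  qed simp_all
  have cont: "continuous_on circle (\<lambda>z::complex. z powi k)"
    by (intro continuous_intros) auto
  have "(\<lambda>t. cis (of_int k * t)) \<in> borel_measurable borel"
    by (intro borel_measurable_continuous_onI continuous_intros)
  then have m: "(\<lambda>t. cis (of_int k * t)) \<in> borel_measurable lborel"
    by simp
  have "(LINT z|circle_measure. z powi k) =
      (LINT t|uniform_measure lborel {0..2 * pi}. cis t powi k)"
    unfolding circle_measure_def
  proof (rule integral_distr)
    show "cis \<in> measurable (uniform_measure lborel {0..2 * pi}) (restrict_space borel circle)"
      using cis_measurable_circle by simp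
  qed (rule borel_measurable_continuous_on_restrict[OF cont])
  also have "\<dots> = (LINT t|uniform_measure lborel {0..2 * pi}. cis (of_int k * t))"
    by (simp only: cis_power_int)
  also have "\<dots> = (LINT t|lborel. (indicator {0..2 * pi} t / (2 * pi)) *\<^sub>R cis (of_int k * t))"
    unfolding um by (rule integral_density[OF m]) simp_all
  also have "\<dots> = (LINT t|lborel. indicator {0..2 * pi} t *\<^sub>R (cis (of_int k * t) /\<^sub>R (2 * pi)))"
    by (simp only: divide_inverse scaleR_scaleR)
  also have "\<dots> = cis (of_int k * (2 * pi)) / (\<i> * of_int k * (2 * pi)) -
      cis (of_int k * 0) / (\<i> * of_int k * (2 * pi))"
  proof (rule integral_FTC_Icc)
    fix t :: real
    define c where "c = \<i> * (of_int k :: complex)"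
    have c: "c \<noteq> 0" using assms by (simp add: c_def)
    have "((\<lambda>t. exp (c * t) / (c * (2 * pi))) has_field_derivative
        exp (c * t) * c / (c * (2 * pi))) (at (of_real t))"
      by (auto intro!: derivative_eq_intros)
    then have "((\<lambda>t. exp (c * of_real t) / (c * (2 * pi))) has_vector_derivative
        exp (c * t) * c / (c * (2 * pi))) (at t within {0..2 * pi})"
      by (rule has_vector_derivative_real_field)
    moreover have "exp (c * t) * c / (c * (2 * pi)) = exp (c * t) /\<^sub>R (2 * pi)"
    proof -
      have "exp (c * t) * c / (c * (2 * pi)) = exp (c * t) / of_real (2 * pi)"
        using c by simp
      then show ?thesis
        by (simp only: scaleR_conv_of_real of_real_inverse divide_inverse mult.commute)
    qed
    moreover have "exp (c * complex_of_real s) = cis (of_int k * s)" for s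
      by (simp only: c_def cis_conv_exp of_real_mult of_real_of_int_eq mult.assoc)
    ultimately show "((\<lambda>t. cis (of_int k * t) / (\<i> * of_int k * (2 * pi))) has_vector_derivative
        cis (of_int k * t) /\<^sub>R (2 * pi)) (at t within {0..2 * pi})"
      by (simp only: c_def)
  next
    show "continuous_on {0..2 * pi} (\<lambda>t. cis (of_int k * t) /\<^sub>R (2 * pi))"
      by (rule continuous_on_scaleR continuous_on_const continuous_on_cis continuous_on_mult
          continuous_on_id)+
  qed simp
  also have "\<dots> = 0"
    using cis_multiple_2pi[of "of_int k"] by (simp add: mult_ac)
  finally show ?thesis .
qed

lemma fourier_coeff_L2_monom_0: "fourier_coeff (L2_monom 0) k = (if k = 0 then 1 else 0)"
proof -
  have "fourier_coeff (L2_monom 0) k = (LINT z|circle_measure. cnj (z powi k))"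
    unfolding fourier_coeff_def by transfer simp
  also have "\<dots> = cnj (LINT z|circle_measure. z powi k)"
    by (rule Bochner_Integration.integral_cnj)
  also have "\<dots> = (if k = 0 then 1 else 0)"
    using integral_powi_circle[of k] emeasure_circle_measure
    by (simp add: measure_def)
  finally show ?thesis .
qed

lemma hardy_nontrivial: "\<exists>f :: hardy. f \<noteq> 0"
proof
  have "L2_monom 0 \<noteq> 0"
    using fourier_coeff_L2_monom_0[of 0] by (auto simp: fourier_coeff_def)
  then show "Abs_hardy (L2_monom 0) \<noteq> 0"
    by (simp add: zero_hardy_def Abs_hardy_inject fourier_coeff_L2_monom_0 fourier_coeff_def[of 0])
qed

text \<open>Bounded operators on the Hardy space form a ring with composition as multiplication, so the
  library's matrix product \<open>**\<close> and \<^const>\<open>matrix_inv\<close> apply to matrices of operators.\<close>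

typedef hardy_op = "{A :: hardy \<Rightarrow> hardy. bounded_clinear A}"
  morphisms op_apply Hardy_op
  by (rule exI[of _ "\<lambda>x. x"]) (simp add: bounded_clinear_def bounded_linear_ident)

setup_lifting type_definition_hardy_op

lemma scaleC_zero_right: "c *\<^sub>C (0::'a::complex_inner) = 0"
  using scaleC_add_right[of c 0 0] by simp

lemma scaleC_minus_right: "c *\<^sub>C (- x :: 'a::complex_inner) = - (c *\<^sub>C x)"
  using scaleC_add_right[of c x "- x"] by (simp add: scaleC_zero_right add_eq_0_iff)

lemma scaleC_diff_right: "c *\<^sub>C (x - y :: 'a::complex_inner) = c *\<^sub>C x - c *\<^sub>C y"
  using scaleC_add_right[of c x "- y"] by (simp add: scaleC_minus_right)

instantiation hardy_op :: ring_1
begin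

lift_definition zero_hardy_op :: hardy_op is "\<lambda>x. 0"
  by (simp add: bounded_clinear_def scaleC_zero_right)
lift_definition one_hardy_op :: hardy_op is "\<lambda>x. x"
  by (simp add: bounded_clinear_def bounded_linear_ident)
lift_definition plus_hardy_op :: "hardy_op \<Rightarrow> hardy_op \<Rightarrow> hardy_op" is "\<lambda>A B x. A x + B x"
  by (simp add: bounded_clinear_def bounded_linear_add scaleC_add_right)
lift_definition minus_hardy_op :: "hardy_op \<Rightarrow> hardy_op \<Rightarrow> hardy_op" is "\<lambda>A B x. A x - B x"
  by (simp add: bounded_clinear_def bounded_linear_sub scaleC_diff_right)
lift_definition uminus_hardy_op :: "hardy_op \<Rightarrow> hardy_op" is "\<lambda>A x. - A x"
  by (simp add: bounded_clinear_def bounded_linear_minus scaleC_minus_right)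
lift_definition times_hardy_op :: "hardy_op \<Rightarrow> hardy_op \<Rightarrow> hardy_op" is "\<lambda>A B x. A (B x)"
  by (simp add: bounded_clinear_def bounded_linear_compose)

instance
proof
  fix A B C :: hardy_op
  have add: "op_apply A (x + y) = op_apply A x + op_apply A y" for x y
    using op_apply[of A] by (simp add: bounded_clinear_def linear_simps(1))
  show "A + B + C = A + (B + C)" "A + B = B + A" "0 + A = A" "- A + A = 0" "A - B = A + - B"
    "A * B * C = A * (B * C)" "1 * A = A" "A * 1 = A" "(A + B) * C = A * C + B * C"
    by (transfer; simp add: fun_eq_iff algebra_simps)+
  show "A * (B + C) = A * B + A * C"
    by (rule op_apply_inject[THEN iffD1])
      (simp add: times_hardy_op.rep_eq plus_hardy_op.rep_eq add)
  show "(0::hardy_op) \<noteq> 1"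
    using hardy_nontrivial by transfer (auto simp: fun_eq_iff)
qed

end

definition matrix_apply :: "hardy_op ^ 'n ^ 'n \<Rightarrow> hardy ^ 'n \<Rightarrow> hardy ^ 'n" where
  "matrix_apply R x = (\<chi> i. \<Sum>j\<in>UNIV. op_apply (R $ i $ j) (x $ j))"

definition L2_mult :: "(complex \<Rightarrow> complex) \<Rightarrow> circle_L2 \<Rightarrow> circle_L2" where
  "L2_mult \<phi> f = abs_circle_L2 (\<lambda>z. \<phi> z * rep_circle_L2 f z)"

definition hardy_proj :: "circle_L2 \<Rightarrow> hardy" where
  "hardy_proj f = (THE g. \<forall>h. cinner (Rep_hardy h) (f - Rep_hardy g) = 0)"

text \<open>Meaningful for \<open>\<phi>\<close> measurable and bounded on the circle.\<close>

definition toeplitz :: "(complex \<Rightarrow> complex) \<Rightarrow> hardy_op" where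
  "toeplitz \<phi> = Hardy_op (\<lambda>f. hardy_proj (L2_mult \<phi> (Rep_hardy f)))"

text \<open>The functions are finite valued on the circle, so the extension has no poles there;
  \<^const>\<open>analytic_on\<close> also rules out removable singularities at which \<open>F\<close> has a wrong value.\<close>

definition is_merom_ext :: "(complex \<Rightarrow> complex) \<Rightarrow> (complex \<Rightarrow> complex) \<Rightarrow> bool" where
  "is_merom_ext \<phi> F \<longleftrightarrow>
     (\<exists>U. open U \<and> cball 0 1 \<subseteq> U \<and> F meromorphic_on U) \<and>
     F analytic_on circle \<and> (\<forall>z\<in>circle. F z = \<phi> z)"

definition Cmu :: "(complex \<Rightarrow> complex) set" where
  "Cmu = {\<phi>. \<exists>F. is_merom_ext \<phi> F}"

text \<open>Any two extensions agree on the closed disk outside a finite set of points, so that the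
  notions below, which depend only on punctured germs and on the values on the circle, do not depend
  on the choice.\<close>

definition merom_ext :: "(complex \<Rightarrow> complex) \<Rightarrow> complex \<Rightarrow> complex" where
  "merom_ext \<phi> = (SOME F. is_merom_ext \<phi> F)"

definition Cmu_units :: "(complex \<Rightarrow> complex) set" where
  "Cmu_units = {\<phi> \<in> Cmu. \<forall>z\<in>circle. \<not> is_pole (merom_ext \<phi>) z \<and> merom_ext \<phi> z \<noteq> 0}"

definition tame_symbol :: "(complex \<Rightarrow> complex) \<Rightarrow> (complex \<Rightarrow> complex) \<Rightarrow> complex \<Rightarrow> complex" where
  "tame_symbol \<phi> \<psi> z =
     (let m = zorder (merom_ext \<phi>) z; n = zorder (merom_ext \<psi>) z
      in Lim (at z) (\<lambda>w. (-1) powi (m * n) * (merom_ext \<psi> w powi m / merom_ext \<phi> w powi n)))"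

text \<open>A product over the infinite set \<^term>\<open>ball 0 1\<close> would be 1 by convention; all but finitely
  many factors are 1.\<close>

definition tame_pi :: "(complex \<Rightarrow> complex) \<Rightarrow> (complex \<Rightarrow> complex) \<Rightarrow> complex" where
  "tame_pi \<phi> \<psi> =
     (\<Prod>z\<in>{z \<in> ball 0 1. tame_symbol \<phi> \<psi> z \<noteq> 1}. inverse (tame_symbol \<phi> \<psi> z))"

definition Tmu :: "hardy_op set" where
  "Tmu = {toeplitz \<phi> + L | \<phi> L. \<phi> \<in> Cmu \<and> trace_class (op_apply L)}"

text \<open>The symbol map as a relation, \<open>\<sigma>(A) = \<phi>\<close>; functions agreeing on the circle are
  identified.\<close>

definition has_symbol :: "hardy_op \<Rightarrow> (complex \<Rightarrow> complex) \<Rightarrow> bool" where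
  "has_symbol A \<phi> \<longleftrightarrow>
     \<phi> \<in> Cmu \<and> (\<exists>L. trace_class (op_apply L) \<and> A = toeplitz \<phi> + L)"

definition has_symbol_matrix :: "hardy_op ^ 3 ^ 3 \<Rightarrow> (complex \<Rightarrow> complex) ^ 3 ^ 3 \<Rightarrow> bool" where
  "has_symbol_matrix R \<Phi> \<longleftrightarrow> (\<forall>i j. has_symbol (R $ i $ j) (\<Phi> $ i $ j))"

definition GL3_Tmu :: "(hardy_op ^ 3 ^ 3) set" where
  "GL3_Tmu = {R. (\<forall>i j. R $ i $ j \<in> Tmu) \<and>
     (\<exists>R'. (\<forall>i j. R' $ i $ j \<in> Tmu) \<and> R ** R' = mat 1 \<and> R' ** R = mat 1)}"

definition diag3 :: "(complex \<Rightarrow> complex) \<Rightarrow> (complex \<Rightarrow> complex) \<Rightarrow> (complex \<Rightarrow> complex) \<Rightarrow>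
    (complex \<Rightarrow> complex) ^ 3 ^ 3" where
  "diag3 a b c =
     (\<chi> i j. if i \<noteq> j then (\<lambda>z. 0) else if i = 1 then a else if i = 2 then b else c)"

text \<open>The definite description expresses that lifts \<open>R\<close>, \<open>S\<close> exist and that the determinant does
  not depend on them.\<close>

definition delta :: "(complex \<Rightarrow> complex) \<Rightarrow> (complex \<Rightarrow> complex) \<Rightarrow> complex" where
  "delta \<phi> \<psi> = (THE d. \<exists>R\<in>GL3_Tmu. \<exists>S\<in>GL3_Tmu.
     has_symbol_matrix R (diag3 \<phi> (\<lambda>z. inverse (\<phi> z)) (\<lambda>z. 1)) \<and>
     has_symbol_matrix S (diag3 \<psi> (\<lambda>z. 1) (\<lambda>z. inverse (\<psi> z))) \<and>
     d = fredholm_det (matrix_apply (R ** S ** matrix_inv R ** matrix_inv S)))"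

end

theory Submission
  imports Defs "Jordan_Normal_Form.Determinant"
begin

text \<open>Both sides are multiplicative in each of the two functions, so it suffices to compare
  them when each function is a linear factor \<open>z - a\<close> with \<open>|a| < 1\<close> or
  is analytic and zero-free on the closed disk. These generate all units: multiplying a unit by
  linear factors removes its poles and leaves an analytic \<open>g\<close>, doing the same to
  \<open>1/g\<close> leaves an analytic \<open>k\<close>, and then \<open>g * k\<close> is a
  product of linear factors, which can be distributed between \<open>g\<close> and
  \<open>k\<close> one root at a time (\<open>Cmu_unit_factorable\<close>).

  Multiplicativity of the product of tame symbols is local: the symbol at a point depends only on
  the two orders and the two leading coefficients there (\<open>tame_at_eq\<close>).
  Multiplicativity of the determinant rests on the identity \<open>[R Q, S] = R [Q, S] R\<inverse>
  [R, S]\<close> for the group commutator, since the Fredholm determinant is multiplicative and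
  invariant under conjugation (\<open>mdet_commutator_mult\<close>). The choice of lifts does not
  matter: two lifts of the same symbols differ by a factor \<open>K\<close> in identity plus trace
  class, and \<open>det [K, S] = det K * det (S K\<inverse> S\<inverse>) = 1\<close>
  (\<open>mdet_commutator_perturb_left\<close>). All these commutators are identity plus trace
  class because Toeplitz operators multiply up to trace class
  (\<open>toeplitz_mult_trace_class\<close>).

  For a generator \<open>F\<close> put \<open>A = T\<^bsub>F\<^esub>\<close> and \<open>B =
  T\<^bsub>1/F\<^esub>\<close>. Then \<open>B A = 1\<close>, and \<open>p = 1 - A B\<close>
  vanishes if \<open>F\<close> is zero-free, while for \<open>F = z - a\<close> it sends
  \<open>f\<close> to the constant function \<open>f(a)\<close> (\<open>eval_proj_kernel\<close>).
  The block matrix with rows \<open>(A, p)\<close> and \<open>(0, B)\<close> is invertible with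
  inverse \<open>(B, 0)\<close>, \<open>(p, A)\<close>, so it lifts \<open>diag(F, 1/F)\<close>.
  The commutator of the lifts built from \<open>(A, B, p)\<close> and \<open>(A', B', p')\<close>
  is the identity except for the corner \<open>1 + (A - 1) p' + (1 - A') p B'\<close>, a
  perturbation of rank at most two (\<open>commutator_elem_lift\<close>); its determinant is a two
  by two determinant with the values \<open>1\<close>, \<open>h(b)\<close>, \<open>1/h(a)\<close>
  and \<open>-1\<close> in the four cases, and these are also the values of the product of tame
  symbols.

  The Fredholm determinant is a limit of finite sections, and its properties come from one formula.
  If \<open>T - 1 = \<Sum>\<^sub>n x\<^sub>n \<langle>y\<^sub>n, -\<rangle>\<close> with square
  summable norms, Sylvester's identity turns the section of \<open>T\<close> over a finite set
  \<open>F\<close> into the limit over \<open>N\<close> of the \<open>N\<close> by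
  \<open>N\<close> determinants of \<open>\<delta>\<^sub>i\<^sub>j + \<langle>y\<^sub>i, Q
  x\<^sub>j\<rangle>\<close>, where \<open>Q\<close> is the projection onto the span of
  \<open>F\<close>. Hadamard's inequality bounds the increments in \<open>N\<close> uniformly in
  \<open>F\<close>, so the two limits commute and the determinant of \<open>T\<close> is the limit
  of the determinants of \<open>\<delta>\<^sub>i\<^sub>j + \<langle>y\<^sub>i,
  x\<^sub>j\<rangle>\<close>, for every orthonormal basis (\<open>section_det_limit\<close>,
  \<open>fredholm_det_gram\<close>). Conjugation does not change these numbers. Multiplicativity
  holds because the product of the sections of \<open>T\<close> and \<open>U\<close> is the
  section of \<open>T Q U\<close>, to which the same argument applies with vectors
  \<open>x\<^sub>n\<close> that depend on \<open>F\<close>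
  (\<open>fredholm_det_mult\<close>).\<close>

(* The symbol $ is needed for vectors indexed by a finite type. *)
no_notation vec_index (infixl "$" 100)

section \<open>Determinants of finite matrices\<close>

text \<open>Matrices are functions on index pairs, so that the dimension can vary inside a limit
  and entries can be changed without leaving the type.\<close>

definition fdet :: "nat \<Rightarrow> (nat \<Rightarrow> nat \<Rightarrow> complex) \<Rightarrow> complex" where
  "fdet n f = Determinant.det (mat n n (\<lambda>(i, j). f i j))"

lemma fdet_cong:
  assumes "\<And>i j. i < n \<Longrightarrow> j < n \<Longrightarrow> f i j = g i j"
  shows "fdet n f = fdet n g"
  unfolding fdet_def by (rule arg_cong[where f = Determinant.det]) (auto intro!: cong_mat assms)

lemma fdet_leibniz:
  "fdet n f = (\<Sum>p | p permutes {0..<n}. of_int (sign p) * (\<Prod>i = 0..<n. f i (p i)))"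
proof -
  have "fdet n f = (\<Sum>p | p permutes {0..<n}. of_int (sign p) * (\<Prod>i = 0..<n. (mat n n (\<lambda>(i, j). f i j)) $$ (i, p i)))"
    unfolding fdet_def by (subst det_def'[where n = n]) auto
  also have "\<dots> = (\<Sum>p | p permutes {0..<n}. of_int (sign p) * (\<Prod>i = 0..<n. f i (p i)))"
    by (intro sum.cong refl arg_cong2[where f = "(*)"] prod.cong) (auto simp: permutes_in_image)
  finally show ?thesis .
qed

lemma fdet_mult: "fdet n (\<lambda>i j. \<Sum>l<n. f i l * g l j) = fdet n f * fdet n g"
proof -
  have "mat n n (\<lambda>(i, j). \<Sum>l<n. f i l * g l j) = mat n n (\<lambda>(i, j). f i j) * mat n n (\<lambda>(i, j). g i j)"
    by (rule eq_matI) (auto simp: scalar_prod_def atLeast0LessThan)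
  then show ?thesis
    unfolding fdet_def by (simp add: det_mult[where n = n])
qed

lemma fdet_transpose: "fdet n (\<lambda>i j. f j i) = fdet n f"
proof -
  have "mat n n (\<lambda>(i, j). f j i) = transpose_mat (mat n n (\<lambda>(i, j). f i j))"
    by (rule eq_matI) auto
  then show ?thesis
    unfolding fdet_def by (simp add: det_transpose[where n = n])
qed

lemma fdet_cnj: "fdet n (\<lambda>i j. cnj (f i j)) = cnj (fdet n f)"
  unfolding fdet_leibniz by (simp add: cnj_sum cnj_prod)

lemma fdet_upper_triangular:
  assumes "\<And>i j. j < i \<Longrightarrow> i < n \<Longrightarrow> f i j = 0"
  shows "fdet n f = (\<Prod>i<n. f i i)"
proof -
  have "fdet n f = prod_list (diag_mat (mat n n (\<lambda>(i, j). f i j)))"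
    unfolding fdet_def
    by (rule det_upper_triangular[where n = n]) (auto simp: upper_triangular_def assms)
  also have "\<dots> = (\<Prod>i<n. f i i)"
    by (simp add: diag_mat_def prod.list_conv_set_nth atLeast0LessThan)
  finally show ?thesis .
qed

lemma fdet_diag: "fdet n (\<lambda>i j. if i = j then d i else 0) = (\<Prod>i<n. d i)"
  by (subst fdet_upper_triangular) auto

lemma fdet_scale_cols: "fdet n (\<lambda>i j. f i j * d j) = fdet n f * (\<Prod>j<n. d j)"
proof -
  have "fdet n (\<lambda>i j. f i j * d j) = fdet n (\<lambda>i j. \<Sum>l<n. f i l * (if l = j then d l else 0))"
    by (rule fdet_cong) (simp add: if_distrib[of "\<lambda>x. _ * x"] cong: if_cong)
  then show ?thesis
    by (simp add: fdet_mult fdet_diag)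
qed

lemma fdet_scale_rows: "fdet n (\<lambda>i j. d i * f i j) = (\<Prod>j<n. d j) * fdet n f"
proof -
  have "fdet n (\<lambda>i j. d i * f i j) = fdet n (\<lambda>i j. f j i * d j)"
    using fdet_transpose[of n "\<lambda>i j. f j i * d j"] by (simp only: mult.commute)
  also have "\<dots> = fdet n (\<lambda>i j. f j i) * (\<Prod>j<n. d j)"
    by (rule fdet_scale_cols)
  also have "fdet n (\<lambda>i j. f j i) = fdet n f"
    by (rule fdet_transpose)
  finally show ?thesis by (simp only: mult.commute)
qed

text \<open>Both sides are the determinant of the block matrix with rows \<open>(1, -X)\<close>
  and \<open>(Y, 1)\<close>, from which multiplication by the unitriangular matrix with rows
  \<open>(1, X)\<close> and \<open>(0, 1)\<close>, on the right or on the left, clears one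
  off-diagonal block.\<close>

lemma fdet_sylvester:
  "fdet n (\<lambda>i j. (if i = j then 1 else 0) + (\<Sum>l<m. f i l * g l j)) =
   fdet m (\<lambda>i j. (if i = j then 1 else 0) + (\<Sum>l<n. g i l * f l j))"
proof -
  define X where "X = mat n m (\<lambda>(i, j). f i j)"
  define Y where "Y = mat m n (\<lambda>(i, j). g i j)"
  have XY: "X \<in> carrier_mat n m" "Y \<in> carrier_mat m n" by (auto simp: X_def Y_def)
  let ?M = "four_block_mat (1\<^sub>m n) (- X) Y (1\<^sub>m m)"
  let ?U = "four_block_mat (1\<^sub>m n) X (0\<^sub>m m n) (1\<^sub>m m)"
  have M: "?M \<in> carrier_mat (n + m) (n + m)" and U: "?U \<in> carrier_mat (n + m) (n + m)"
    using XY by auto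
  have dU: "Determinant.det ?U = 1"
    by (subst det_four_block_mat_lower_left_zero[where n = n and m = m]) (use XY in auto)
  have Y1: "Y * X + 1\<^sub>m m = 1\<^sub>m m + Y * X" "- X + X = 0\<^sub>m n m" "X + - X = 0\<^sub>m n m"
    by (rule eq_matI, use XY in auto)+
  have "?M * ?U = four_block_mat (1\<^sub>m n) (0\<^sub>m n m) Y (1\<^sub>m m + Y * X)"
    by (subst mult_four_block_mat[of _ n n _ m _ m _ _ n _ m])
      (use XY in \<open>auto simp: Y1\<close>)
  moreover have "Determinant.det (four_block_mat (1\<^sub>m n) (0\<^sub>m n m) Y (1\<^sub>m m + Y * X)) = Determinant.det (1\<^sub>m m + Y * X)"
    by (subst det_four_block_mat_upper_right_zero[where n = n and m = m]) (use XY in auto)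
  ultimately have 1: "Determinant.det ?M = Determinant.det (1\<^sub>m m + Y * X)"
    using det_mult[OF M U] dU by simp
  have "?U * ?M = four_block_mat (1\<^sub>m n + X * Y) (0\<^sub>m n m) Y (1\<^sub>m m)"
    by (subst mult_four_block_mat[of _ n n _ m _ m _ _ n _ m])
      (use XY in \<open>auto simp: Y1\<close>)
  moreover have "Determinant.det (four_block_mat (1\<^sub>m n + X * Y) (0\<^sub>m n m) Y (1\<^sub>m m)) = Determinant.det (1\<^sub>m n + X * Y)"
    by (subst det_four_block_mat_upper_right_zero[where n = n and m = m]) (use XY in auto)
  ultimately have 2: "Determinant.det ?M = Determinant.det (1\<^sub>m n + X * Y)"
    using det_mult[OF U M] dU by simp
  have "mat n n (\<lambda>(i, j). (if i = j then 1 else 0) + (\<Sum>l<m. f i l * g l j)) = 1\<^sub>m n + X * Y"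
    by (rule eq_matI) (auto simp: X_def Y_def scalar_prod_def atLeast0LessThan)
  moreover have "mat m m (\<lambda>(i, j). (if i = j then 1 else 0) + (\<Sum>l<n. g i l * f l j)) = 1\<^sub>m m + Y * X"
    by (rule eq_matI) (auto simp: X_def Y_def scalar_prod_def atLeast0LessThan)
  ultimately show ?thesis
    using 1 2 by (simp add: fdet_def)
qed

text \<open>Together with the next lemma this expresses the difference of two successive
  truncations of an infinite matrix \<open>1 + M\<close> as the single determinant in which the
  last row has lost its diagonal \<open>1\<close>.\<close>

lemma fdet_last_row_add:
  assumes "\<And>j. j < Suc n \<Longrightarrow> f n j = g j + h j"
  shows "fdet (Suc n) f = fdet (Suc n) (f(n := g)) + fdet (Suc n) (f(n := h))"
proof -
  have *: "(\<Prod>i = 0..<Suc n. (f(n := u)) i (p i)) = (\<Prod>i = 0..<n. f i (p i)) * u (p n)" for u p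
    unfolding prod.atLeast0_lessThan_Suc by (intro arg_cong2[where f = "(*)"] prod.cong) auto
  have "(\<Prod>i = 0..<Suc n. f i (p i)) = (\<Prod>i = 0..<n. f i (p i)) * (g (p n) + h (p n))"
    if "p permutes {0..<Suc n}" for p
    using assms[of "p n"] permutes_in_image[OF that, of n] by simp
  then have "(\<Prod>i = 0..<Suc n. f i (p i)) = (\<Prod>i = 0..<Suc n. (f(n := g)) i (p i)) + (\<Prod>i = 0..<Suc n. (f(n := h)) i (p i))"
    if "p permutes {0..<Suc n}" for p
    unfolding * using that by (simp add: algebra_simps)
  then show ?thesis
    unfolding fdet_leibniz sum.distrib[symmetric] distrib_left[symmetric]
    by (intro sum.cong refl arg_cong2[where f = "(*)"]) blast
qed

lemma fdet_last_unit_row: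
  assumes "\<And>j. j < n \<Longrightarrow> f n j = 0" "f n n = 1"
  shows "fdet (Suc n) f = fdet n f"
proof -
  let ?A = "mat n n (\<lambda>(i, j). f i j)" and ?B = "mat n 1 (\<lambda>(i, j). f i n)"
  have "mat (Suc n) (Suc n) (\<lambda>(i, j). f i j) = four_block_mat ?A ?B (0\<^sub>m 1 n) (1\<^sub>m 1)"
    by (rule eq_matI) (auto simp: assms less_Suc_eq)
  then show ?thesis
    unfolding fdet_def
    by (simp only:) (subst det_four_block_mat_lower_left_zero[where n = n and m = 1]; simp)
qed

text \<open>Sections of an operator are indexed by a set of basis vectors. Any enumeration gives
  the same determinant, because transporting permutations along a bijection preserves their
  signs.\<close>

lemma section_det_eq_fdet:
  assumes h: "bij_betw h {0..<n} F"
  shows "section_det T F = fdet n (\<lambda>i j. cinner (h i) (T (h j)))"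
proof -
  let ?m = "map_permutation {0..<n} h"
  have inj: "inj_on h {0..<n}" using h by (auto simp: bij_betw_def)
  have im: "h ` {0..<n} = F" using h by (auto simp: bij_betw_def)
  have "(\<Sum>p | p permutes F. of_int (sign p) * (\<Prod>e\<in>F. cinner e (T (p e)))) =
    (\<Sum>p | p permutes {0..<n}. of_int (sign (?m p)) * (\<Prod>e\<in>F. cinner e (T (?m p e))))"
  proof (rule sum.reindex_bij_betw[symmetric])
    have "bij_betw (\<lambda>\<pi> x. if x \<in> F then h (\<pi> (inv_into {0..<n} h x)) else x)
        {\<pi>. \<pi> permutes {0..<n}} {\<pi>. \<pi> permutes F}"
      by (rule bij_betw_permutations[OF h])
    also have "(\<lambda>\<pi> x. if x \<in> F then h (\<pi> (inv_into {0..<n} h x)) else x) = ?m"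
      by (simp add: fun_eq_iff map_permutation_def im restrict_id_def)
    finally show "bij_betw ?m {p. p permutes {0..<n}} {p. p permutes F}" .
  qed
  also have "\<dots> = (\<Sum>p | p permutes {0..<n}. of_int (sign p) * (\<Prod>i = 0..<n. cinner (h i) (T (h (p i)))))"
  proof (intro sum.cong refl arg_cong2[where f = "(*)"])
    fix p assume p: "p \<in> {p. p permutes {0..<n}}"
    show "(of_int (sign (?m p)) :: complex) = of_int (sign p)"
      using p inj by (simp add: sign_map_permutation)
    have "(\<Prod>e\<in>F. cinner e (T (?m p e))) = (\<Prod>i = 0..<n. cinner (h i) (T (?m p (h i))))"
      by (rule prod.reindex_bij_betw[OF h, symmetric])
    also have "\<dots> = (\<Prod>i = 0..<n. cinner (h i) (T (h (p i))))"
      by (intro prod.cong refl) (simp add: map_permutation_apply[OF inj])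
    finally show "(\<Prod>e\<in>F. cinner e (T (?m p e))) = (\<Prod>i = 0..<n. cinner (h i) (T (h (p i))))" .
  qed
  finally show ?thesis
    by (simp add: section_det_def fdet_leibniz)
qed

section \<open>Hadamard's inequality\<close>

text \<open>Vectors are arbitrary functions on a finite index set \<open>J\<close>, without a
  normed space around them, because the bound is needed for all finite subsets of a basis and with
  additional coordinates adjoined.\<close>

context
  fixes J :: "'e set"
begin

definition ip :: "('e \<Rightarrow> complex) \<Rightarrow> ('e \<Rightarrow> complex) \<Rightarrow> complex" where
  "ip u v = (\<Sum>e\<in>J. cnj (u e) * v e)"

text \<open>The vectors are orthogonalized but not normalized, so the change of basis is
  unitriangular and preserves determinants. Where an earlier vector of the result is zero,
  division by zero gives coefficient zero, as it should.\<close>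

fun gram_schmidt :: "(nat \<Rightarrow> 'e \<Rightarrow> complex) \<Rightarrow> nat \<Rightarrow> 'e \<Rightarrow> complex" where
  "gram_schmidt X j = (\<lambda>e. X j e - (\<Sum>k<j. ip (gram_schmidt X k) (X j) /
     ip (gram_schmidt X k) (gram_schmidt X k) * gram_schmidt X k e))"

declare gram_schmidt.simps [simp del]

lemma ip_cnj: "cnj (ip u v) = ip v u"
  by (simp add: ip_def mult.commute)

lemma ip_sum_right: "ip u (\<lambda>e. \<Sum>k\<in>K. c k * v k e) = (\<Sum>k\<in>K. c k * ip u (v k))"
  unfolding ip_def sum_distrib_left by (subst sum.swap) (simp add: mult_ac)

lemma ip_sum_left: "ip (\<lambda>e. \<Sum>k\<in>K. c k * v k e) u = (\<Sum>k\<in>K. cnj (c k) * ip (v k) u)"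
  unfolding ip_def cnj_sum sum_distrib_left sum_distrib_right by (subst sum.swap) (simp add: mult_ac)

lemma ip_add_right: "ip u (\<lambda>e. v e + w e) = ip u v + ip u w"
  by (simp add: ip_def algebra_simps sum.distrib)

lemma ip_diff_right: "ip u (\<lambda>e. v e - w e) = ip u v - ip u w"
  by (simp add: ip_def algebra_simps sum_subtractf)

lemma ip_diff_left: "ip (\<lambda>e. v e - w e) u = ip v u - ip w u"
  by (simp add: ip_def algebra_simps sum_subtractf)

lemma ip_self: "ip u u = of_real (\<Sum>e\<in>J. (cmod (u e))\<^sup>2)"
  unfolding ip_def of_real_sum by (intro sum.cong refl) (simp only: complex_norm_square mult.commute)

lemma Re_ip_nonneg: "0 \<le> Re (ip u u)"
  by (simp add: ip_self sum_nonneg)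

lemma ip_self_Re: "ip u u = of_real (Re (ip u u))"
  by (simp add: ip_self)

lemma gram_schmidt_orthogonal:
  assumes fin: "finite J"
  shows "k < j \<Longrightarrow> ip (gram_schmidt X k) (gram_schmidt X j) = 0"
proof (induction j arbitrary: k rule: less_induct)
  case (less j)
  let ?Z = "gram_schmidt X"
  have "ip (?Z k) (?Z j) = ip (?Z k) (X j) -
      (\<Sum>l<j. ip (?Z l) (X j) / ip (?Z l) (?Z l) * ip (?Z k) (?Z l))"
    by (subst gram_schmidt.simps[of X j]) (simp only: ip_diff_right ip_sum_right)
  also have "(\<Sum>l<j. ip (?Z l) (X j) / ip (?Z l) (?Z l) * ip (?Z k) (?Z l)) =
      (\<Sum>l<j. if l = k then ip (?Z k) (X j) / ip (?Z k) (?Z k) * ip (?Z k) (?Z k) else 0)"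
  proof (intro sum.cong refl)
    fix l assume l: "l \<in> {..<j}"
    have "ip (?Z k) (?Z l) = 0" if "l \<noteq> k"
    proof (cases "k < l")
      case True with less.IH[of l k] l show ?thesis by simp
    next
      case False
      with that less.IH[of k l] less.prems have "ip (?Z l) (?Z k) = 0" by simp
      then show ?thesis using ip_cnj[of "?Z l" "?Z k"] by simp
    qed
    then show "ip (?Z l) (X j) / ip (?Z l) (?Z l) * ip (?Z k) (?Z l) =
        (if l = k then ip (?Z k) (X j) / ip (?Z k) (?Z k) * ip (?Z k) (?Z k) else 0)"
      by auto
  qed
  also have "\<dots> = ip (?Z k) (X j) / ip (?Z k) (?Z k) * ip (?Z k) (?Z k)"
    using less.prems by (simp add: sum.delta)
  also have "\<dots> = ip (?Z k) (X j)"
  proof (cases "ip (?Z k) (?Z k) = 0")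
    case True
    then have "(\<Sum>e\<in>J. (cmod (?Z k e))\<^sup>2) = 0"
      unfolding ip_self of_real_eq_0_iff .
    then have "\<forall>e\<in>J. ?Z k e = 0"
      using fin by (simp add: sum_nonneg_eq_0_iff)
    then show ?thesis by (simp add: ip_def)
  qed simp
  finally show ?case by simp
qed

lemma gram_schmidt_orthogonal':
  assumes fin: "finite J" and "k \<noteq> j"
  shows "ip (gram_schmidt X k) (gram_schmidt X j) = 0"
proof (cases "k < j")
  case False
  then have "ip (gram_schmidt X j) (gram_schmidt X k) = 0"
    using gram_schmidt_orthogonal[OF fin, of j k X] \<open>k \<noteq> j\<close> by simp
  then show ?thesis using ip_cnj[of "gram_schmidt X j" "gram_schmidt X k"] by simp
qed (simp add: gram_schmidt_orthogonal fin)

text \<open>Each vector is the orthogonal sum of its Gram-Schmidt image and a combination of the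
  earlier ones.\<close>

lemma gram_schmidt_norm_le:
  assumes fin: "finite J"
  shows "Re (ip (gram_schmidt X j) (gram_schmidt X j)) \<le> Re (ip (X j) (X j))"
proof -
  let ?Z = "gram_schmidt X"
  define c where "c = (\<lambda>k. ip (?Z k) (X j) / ip (?Z k) (?Z k))"
  define W where "W = (\<lambda>e. \<Sum>k<j. c k * ?Z k e)"
  have Z: "?Z j = (\<lambda>e. X j e - W e)"
    by (subst gram_schmidt.simps) (simp add: W_def c_def)
  have zw: "ip (?Z j) W = 0"
    unfolding W_def ip_sum_right by (rule sum.neutral) (simp add: gram_schmidt_orthogonal' fin)
  have wz: "ip W (?Z j) = 0" using zw ip_cnj[of "?Z j" W] by simp
  have X: "X j = (\<lambda>e. ?Z j e + W e)" using Z by (simp add: fun_eq_iff)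
  have "ip (X j) (X j) = ip (X j) (?Z j) + ip (X j) W"
    by (subst (2) X) (simp add: ip_add_right)
  also have "ip (X j) (?Z j) = cnj (ip (?Z j) (X j))" by (simp add: ip_cnj)
  also have "ip (?Z j) (X j) = ip (?Z j) (?Z j)"
    by (subst X) (simp add: ip_add_right zw)
  also have "ip (X j) W = cnj (ip W (X j))" by (simp add: ip_cnj)
  also have "ip W (X j) = ip W W"
    by (subst X) (simp add: ip_add_right wz)
  finally show ?thesis using Re_ip_nonneg[of W] by (simp add: ip_cnj)
qed

lemma fdet_gram_schmidt:
  assumes fin: "finite J"
  shows "fdet n (\<lambda>i j. ip (Y i) (X j)) = fdet n (\<lambda>i j. ip (Y i) (gram_schmidt X j))"
proof -
  let ?Z = "gram_schmidt X"
  define c where "c = (\<lambda>k j. if k < j then ip (?Z k) (X j) / ip (?Z k) (?Z k) else if k = j then 1 else 0)"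
  have "ip (Y i) (X j) = (\<Sum>k<n. ip (Y i) (?Z k) * c k j)" if "j < n" for i j
  proof -
    have "X j = (\<lambda>e. ?Z j e + (\<Sum>k<j. c k j * ?Z k e))"
      by (subst gram_schmidt.simps) (simp add: c_def)
    also have "\<dots> = (\<lambda>e. \<Sum>k<Suc j. c k j * ?Z k e)"
      by (simp add: c_def add.commute)
    finally have "ip (Y i) (X j) = (\<Sum>k<Suc j. c k j * ip (Y i) (?Z k))"
      by (simp only: ip_sum_right)
    also have "\<dots> = (\<Sum>k<n. ip (Y i) (?Z k) * c k j)"
      using that by (intro sum.mono_neutral_cong_left) (auto simp: c_def)
    finally show ?thesis .
  qed
  then have "fdet n (\<lambda>i j. ip (Y i) (X j)) = fdet n (\<lambda>i j. \<Sum>k<n. ip (Y i) (?Z k) * c k j)"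
    by (intro fdet_cong) auto
  also have "\<dots> = fdet n (\<lambda>i j. ip (Y i) (?Z j)) * fdet n c"
    by (rule fdet_mult)
  also have "fdet n c = 1"
    by (subst fdet_upper_triangular) (auto simp: c_def)
  finally show ?thesis by simp
qed

lemma fdet_ip_swap: "fdet n (\<lambda>i j. ip (X i) (Y j)) = cnj (fdet n (\<lambda>i j. ip (Y i) (X j)))"
proof -
  have "cnj (fdet n (\<lambda>i j. ip (Y i) (X j))) = fdet n (\<lambda>i j. ip (X j) (Y i))"
    by (simp add: fdet_cnj[symmetric] ip_cnj)
  then show ?thesis by (subst (asm) fdet_transpose) simp
qed

lemma fdet_gram_orthogonal:
  assumes fin: "finite J"
  shows "fdet n (\<lambda>i j. ip (gram_schmidt X i) (gram_schmidt X j)) =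
    of_real (\<Prod>i<n. Re (ip (gram_schmidt X i) (gram_schmidt X i)))"
proof -
  have "fdet n (\<lambda>i j. ip (gram_schmidt X i) (gram_schmidt X j)) =
    fdet n (\<lambda>i j. if i = j then ip (gram_schmidt X i) (gram_schmidt X i) else 0)"
    by (rule fdet_cong) (auto simp: gram_schmidt_orthogonal' fin)
  then show ?thesis
    by (simp add: fdet_diag ip_self_Re[symmetric])
qed

text \<open>Gram-Schmidt makes the Gram matrix diagonal and does not increase any of the
  norms.\<close>

lemma hadamard_gram:
  assumes fin: "finite J"
  shows "cmod (fdet n (\<lambda>i j. ip (X i) (X j))) \<le> (\<Prod>i<n. Re (ip (X i) (X i)))"
proof -
  let ?Z = "gram_schmidt X"
  have "fdet n (\<lambda>i j. ip (X i) (X j)) = fdet n (\<lambda>i j. ip (?Z i) (?Z j))"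
    by (subst fdet_gram_schmidt[OF fin], subst fdet_ip_swap, subst fdet_gram_schmidt[OF fin],
        simp add: fdet_ip_swap[of n ?Z, symmetric])
  also have "cmod \<dots> = (\<Prod>i<n. Re (ip (?Z i) (?Z i)))"
    unfolding fdet_gram_orthogonal[OF fin] norm_of_real by (simp add: prod_nonneg Re_ip_nonneg)
  also have "\<dots> \<le> (\<Prod>i<n. Re (ip (X i) (X i)))"
    by (intro prod_mono conjI Re_ip_nonneg gram_schmidt_norm_le fin)
  finally show ?thesis .
qed

text \<open>After orthogonalizing the \<open>X j\<close> to \<open>Z j\<close>, only the
  projections \<open>P i\<close> of the \<open>Y i\<close> onto the span of the \<open>Z j\<close>
  enter. In coordinates with respect to the \<open>Z j\<close>, the squared modulus of the
  determinant is the product of the squared norms of the \<open>Z j\<close> and the Gram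
  determinant of the \<open>P i\<close>; the bound for Gram determinants does the rest.\<close>

lemma hadamard:
  assumes fin: "finite J"
  shows "(cmod (fdet n (\<lambda>i j. ip (Y i) (X j))))\<^sup>2 \<le>
    (\<Prod>i<n. Re (ip (Y i) (Y i))) * (\<Prod>i<n. Re (ip (X i) (X i)))"
proof -
  let ?Z = "gram_schmidt X"
  define N where "N = (\<lambda>k. ip (?Z k) (?Z k))"
  have rhs: "0 \<le> (\<Prod>i<n. Re (ip (Y i) (Y i))) * (\<Prod>i<n. Re (ip (X i) (X i)))"
    by (intro mult_nonneg_nonneg prod_nonneg ballI Re_ip_nonneg)
  define D where "D = fdet n (\<lambda>i j. ip (Y i) (?Z j))"
  have D: "fdet n (\<lambda>i j. ip (Y i) (X j)) = D"
    unfolding D_def by (rule fdet_gram_schmidt[OF fin])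
  show ?thesis
  proof (cases "\<exists>k<n. N k = 0")
    case True
    then obtain k where k: "k < n" "N k = 0" by blast
    have "(\<Sum>e\<in>J. (cmod (?Z k e))\<^sup>2) = 0"
      using k(2) unfolding N_def ip_self of_real_eq_0_iff .
    then have "\<forall>e\<in>J. ?Z k e = 0"
      using fin by (simp add: sum_nonneg_eq_0_iff)
    then have z: "ip (Y i) (?Z k) = 0" for i by (simp add: ip_def)
    have "D = fdet n (\<lambda>i j. ip (Y i) (?Z j) * (if j = k then 0 else 1))"
      unfolding D_def by (rule fdet_cong) (auto simp: z)
    also have "\<dots> = 0"
      using k by (auto simp: fdet_scale_cols)
    finally show ?thesis using D rhs by simp
  next
    case False
    then have N0: "N k \<noteq> 0" if "k < n" for k using that by auto
    \<comment> \<open>\<open>P i\<close> is the orthogonal projection of \<open>Y i\<close> onto the span of the \<open>Z k\<close>.\<close>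
    define P where "P = (\<lambda>i e. \<Sum>k<n. ip (?Z k) (Y i) / N k * ?Z k e)"
    have zp: "ip (?Z k) (P i) = ip (?Z k) (Y i)" if "k < n" for k i
    proof -
      have "ip (?Z k) (P i) = (\<Sum>l<n. ip (?Z l) (Y i) / N l * ip (?Z k) (?Z l))"
        unfolding P_def by (rule ip_sum_right)
      also have "\<dots> = (\<Sum>l<n. if l = k then ip (?Z k) (Y i) / N k * N k else 0)"
        by (intro sum.cong refl) (auto simp: gram_schmidt_orthogonal' fin N_def)
      also have "\<dots> = ip (?Z k) (Y i)" using that N0 by (simp add: sum.delta)
      finally show ?thesis .
    qed
    have cN: "cnj (N k) = N k" for k by (simp add: N_def ip_cnj)
    have PP: "ip (P i) (P j) = (\<Sum>k<n. ip (Y i) (?Z k) * (ip (?Z k) (Y j) / N k))" for i j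
    proof -
      have "ip (P i) (P j) = (\<Sum>k<n. cnj (ip (?Z k) (Y i) / N k) * ip (?Z k) (P j))"
        by (subst (1) P_def) (rule ip_sum_left)
      also have "\<dots> = (\<Sum>k<n. ip (Y i) (?Z k) * (ip (?Z k) (Y j) / N k))"
        by (intro sum.cong refl) (simp add: zp cN ip_cnj)
      finally show ?thesis .
    qed
    have YP: "ip (P i) (Y i) = ip (P i) (P i)" for i
    proof -
      have "ip (P i) (Y i) = (\<Sum>k<n. cnj (ip (?Z k) (Y i) / N k) * ip (?Z k) (Y i))"
        unfolding P_def by (rule ip_sum_left)
      also have "\<dots> = ip (P i) (P i)"
        unfolding PP by (intro sum.cong refl) (simp add: cN ip_cnj)
      finally show ?thesis .
    qed
    have bessel: "Re (ip (P i) (P i)) \<le> Re (ip (Y i) (Y i))" for i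
    proof -
      have "ip (Y i) (P i) = cnj (ip (P i) (P i))" using YP[of i] ip_cnj[of "P i" "Y i"] by simp
      then have yp: "ip (Y i) (P i) = ip (P i) (P i)" by (simp add: ip_cnj)
      have "0 \<le> Re (ip (\<lambda>e. Y i e - P i e) (\<lambda>e. Y i e - P i e))" by (rule Re_ip_nonneg)
      also have "\<dots> = Re (ip (Y i) (Y i)) - Re (ip (P i) (P i))"
        by (simp add: ip_diff_right ip_diff_left YP yp)
      finally show ?thesis by simp
    qed
    have prodN: "(\<Prod>k<n. N k) = of_real (\<Prod>k<n. Re (ip (?Z k) (?Z k)))"
      by (simp add: N_def ip_self_Re[symmetric])
    have N1: "(\<Prod>k<n. N k) \<noteq> 0" using N0 by simp
    have cD: "cnj D = fdet n (\<lambda>i j. ip (?Z i) (Y j))"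
      by (simp add: D_def fdet_ip_swap[of n ?Z Y])
    have "fdet n (\<lambda>i j. ip (?Z i) (Y j)) = fdet n (\<lambda>i j. N i * (ip (?Z i) (Y j) / N i))"
      by (rule fdet_cong) (simp add: N0)
    also have "\<dots> = (\<Prod>k<n. N k) * fdet n (\<lambda>i j. ip (?Z i) (Y j) / N i)"
      by (rule fdet_scale_rows)
    finally have "D * cnj D = (\<Prod>k<n. N k) * (D * fdet n (\<lambda>i j. ip (?Z i) (Y j) / N i))"
      using cD by simp
    also have "D * fdet n (\<lambda>i j. ip (?Z i) (Y j) / N i) = fdet n (\<lambda>i j. ip (P i) (P j))"
      unfolding PP D_def fdet_mult ..
    finally have "of_real ((cmod D)\<^sup>2) = (\<Prod>k<n. N k) * fdet n (\<lambda>i j. ip (P i) (P j))"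
      by (simp only: complex_norm_square)
    then have "(cmod D)\<^sup>2 = cmod ((\<Prod>k<n. N k) * fdet n (\<lambda>i j. ip (P i) (P j)))"
      by (metis abs_of_nonneg norm_of_real zero_le_power2)
    also have "\<dots> = (\<Prod>k<n. Re (ip (?Z k) (?Z k))) * cmod (fdet n (\<lambda>i j. ip (P i) (P j)))"
      unfolding norm_mult prodN norm_of_real by (simp add: prod_nonneg Re_ip_nonneg)
    also have "\<dots> \<le> (\<Prod>k<n. Re (ip (X k) (X k))) * (\<Prod>i<n. Re (ip (Y i) (Y i)))"
    proof (intro mult_mono)
      show "(\<Prod>k<n. Re (ip (?Z k) (?Z k))) \<le> (\<Prod>k<n. Re (ip (X k) (X k)))"
        by (intro prod_mono conjI Re_ip_nonneg gram_schmidt_norm_le fin)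
      have "cmod (fdet n (\<lambda>i j. ip (P i) (P j))) \<le> (\<Prod>i<n. Re (ip (P i) (P i)))"
        by (rule hadamard_gram[OF fin])
      also have "\<dots> \<le> (\<Prod>i<n. Re (ip (Y i) (Y i)))"
        by (intro prod_mono conjI Re_ip_nonneg bessel)
      finally show "cmod (fdet n (\<lambda>i j. ip (P i) (P j))) \<le> (\<Prod>i<n. Re (ip (Y i) (Y i)))" .
    qed (auto intro!: prod_nonneg Re_ip_nonneg)
    finally show ?thesis using D by (simp add: mult.commute)
  qed
qed

end

text \<open>A nonnegative diagonal is itself a Gram matrix, of vectors supported on additional
  coordinates, so the sum of the two matrices is again a matrix of inner products.\<close>

lemma fdet_perturbation_bound:
  fixes x y :: "nat \<Rightarrow> 'e \<Rightarrow> complex"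
  assumes fin: "finite F" and t: "\<And>i. i < n \<Longrightarrow> 0 \<le> t i"
    and x: "\<And>i. i < n \<Longrightarrow> (\<Sum>e\<in>F. (cmod (x i e))\<^sup>2) \<le> c i"
    and y: "\<And>i. i < n \<Longrightarrow> (\<Sum>e\<in>F. (cmod (y i e))\<^sup>2) \<le> c i"
  shows "cmod (fdet n (\<lambda>i j. (if i = j then of_real (t i) else 0) + (\<Sum>e\<in>F. cnj (y i e) * x j e)))
    \<le> (\<Prod>i<n. t i + c i)"
proof -
  \<comment> \<open>The coordinate \<open>Inl i\<close> is adjoined for the vectors with index \<open>i\<close> only, with entry \<open>sqrt (t i)\<close>.\<close>
  define J where "J = ({..<n} <+> F)"
  have finJ: "finite J" using fin by (simp add: J_def)
  define u where "u = (\<lambda>(v :: nat \<Rightarrow> 'e \<Rightarrow> complex) i (e :: nat + 'e). case e of Inl k \<Rightarrow>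
    (if k = i then complex_of_real (sqrt (t i)) else 0) | Inr f \<Rightarrow> v i f)"
  have sumJ: "(\<Sum>e\<in>J. g e) = (\<Sum>k<n. g (Inl k)) + (\<Sum>f\<in>F. g (Inr f))" for g :: "nat + 'e \<Rightarrow> 'b::comm_monoid_add"
    unfolding J_def using fin by (subst sum.Plus) auto
  have ip: "ip J (u y i) (u x j) = (if i = j then of_real (t i) else 0) + (\<Sum>e\<in>F. cnj (y i e) * x j e)"
    if "i < n" "j < n" for i j
  proof -
    have "(\<Sum>k<n. cnj (u y i (Inl k)) * u x j (Inl k)) =
      (\<Sum>k<n. if k = i then (if i = j then complex_of_real (sqrt (t i) * sqrt (t i)) else 0) else 0)"
      by (intro sum.cong refl) (auto simp: u_def simp flip: of_real_mult)
    also have "\<dots> = (if i = j then of_real (t i) else 0)"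
      using that t[OF that(1)] by (auto simp: sum.delta)
    finally show ?thesis
      unfolding ip_def sumJ by (simp add: u_def)
  qed
  have nrm: "Re (ip J (u v i) (u v i)) = t i + (\<Sum>e\<in>F. (cmod (v i e))\<^sup>2)" if "i < n" for v i
  proof -
    have "(\<Sum>k<n. (cmod (u v i (Inl k)))\<^sup>2) = (\<Sum>k<n. if k = i then t i else 0)"
      using t[OF that] by (intro sum.cong refl) (auto simp: u_def)
    also have "\<dots> = t i" using that by (simp add: sum.delta)
    finally show ?thesis unfolding ip_self sumJ by (simp add: u_def)
  qed
  have le: "(\<Prod>i<n. Re (ip J (u v i) (u v i))) \<le> (\<Prod>i<n. t i + c i)"
    if "\<And>i. i < n \<Longrightarrow> (\<Sum>e\<in>F. (cmod (v i e))\<^sup>2) \<le> c i" for v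
    using that by (intro prod_mono conjI Re_ip_nonneg) (auto simp: nrm)
  have nn: "0 \<le> c i" if "i < n" for i
    using x[OF that] sum_nonneg[of F "\<lambda>e. (cmod (x i e))\<^sup>2"] by simp
  have "(cmod (fdet n (\<lambda>i j. ip J (u y i) (u x j))))\<^sup>2 \<le>
      (\<Prod>i<n. Re (ip J (u y i) (u y i))) * (\<Prod>i<n. Re (ip J (u x i) (u x i)))"
    by (rule hadamard[OF finJ])
  also have "\<dots> \<le> (\<Prod>i<n. t i + c i) * (\<Prod>i<n. t i + c i)"
    using t nn by (intro mult_mono le x y prod_nonneg Re_ip_nonneg) (auto intro: add_nonneg_nonneg)
  finally have "(cmod (fdet n (\<lambda>i j. ip J (u y i) (u x j))))\<^sup>2 \<le> (\<Prod>i<n. t i + c i)\<^sup>2"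
    by (simp add: power2_eq_square)
  then have "cmod (fdet n (\<lambda>i j. ip J (u y i) (u x j))) \<le> (\<Prod>i<n. t i + c i)"
    by (rule power2_le_imp_le) (use t nn in \<open>auto intro!: prod_nonneg add_nonneg_nonneg\<close>)
  also have "fdet n (\<lambda>i j. ip J (u y i) (u x j)) =
      fdet n (\<lambda>i j. (if i = j then of_real (t i) else 0) + (\<Sum>e\<in>F. cnj (y i e) * x j e))"
    by (rule fdet_cong) (simp add: ip)
  finally show ?thesis .
qed

text \<open>The increment is the determinant with diagonal part \<open>1, ..., 1, 0\<close>. The
  bound involves only the numbers \<open>c i\<close>, which is what makes the convergence below
  uniform in the section \<open>F\<close>.\<close>

lemma fdet_Suc_diff_bound:
  fixes x y :: "nat \<Rightarrow> 'e \<Rightarrow> complex"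
  assumes fin: "finite F"
    and x: "\<And>i. (\<Sum>e\<in>F. (cmod (x i e))\<^sup>2) \<le> c i"
    and y: "\<And>i. (\<Sum>e\<in>F. (cmod (y i e))\<^sup>2) \<le> c i"
  defines "d \<equiv> \<lambda>n. fdet n (\<lambda>i j. (if i = j then 1 else 0) + (\<Sum>e\<in>F. cnj (y i e) * x j e))"
  shows "cmod (d (Suc n) - d n) \<le> c n * (\<Prod>i<n. 1 + c i)"
proof -
  define f where "f = (\<lambda>i j. (if i = j then 1 else 0) + (\<Sum>e\<in>F. cnj (y i e) * x j e))"
  define t :: "nat \<Rightarrow> real" where "t = (\<lambda>i. if i = n then 0 else 1)"
  define g where "g = (\<lambda>i j. (if i = j then complex_of_real (t i) else 0) + (\<Sum>e\<in>F. cnj (y i e) * x j e))"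
  have "fdet (Suc n) f = fdet (Suc n) (f(n := \<lambda>j. if j = n then 1 else 0)) +
      fdet (Suc n) (f(n := \<lambda>j. \<Sum>e\<in>F. cnj (y n e) * x j e))"
    by (rule fdet_last_row_add) (auto simp: f_def)
  also have "fdet (Suc n) (f(n := \<lambda>j. if j = n then 1 else 0)) = fdet n (f(n := \<lambda>j. if j = n then 1 else 0))"
    by (rule fdet_last_unit_row) auto
  also have "\<dots> = fdet n f" by (rule fdet_cong) auto
  also have "fdet (Suc n) (f(n := \<lambda>j. \<Sum>e\<in>F. cnj (y n e) * x j e)) = fdet (Suc n) g"
    by (rule fdet_cong) (auto simp: f_def g_def t_def)
  finally have "d (Suc n) - d n = fdet (Suc n) g"
    by (simp add: d_def f_def)
  also have "cmod \<dots> \<le> (\<Prod>i<Suc n. t i + c i)"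
    unfolding g_def by (rule fdet_perturbation_bound) (auto simp: fin x y t_def)
  also have "\<dots> = c n * (\<Prod>i<n. 1 + c i)"
    by (simp add: t_def)
  finally show ?thesis .
qed

section \<open>Complex inner product spaces\<close>

lemma cinner_add_left: "cinner (x + y) z = cinner x z + cinner y z"
  by (metis cinner_add_right cinner_commute complex_cnj_add)

lemma cinner_scaleC_left: "cinner (c *\<^sub>C x) z = cnj c * cinner x z"
  by (metis cinner_scaleC_right cinner_commute complex_cnj_mult)

lemma cinner_zero_left [simp]: "cinner 0 x = 0"
  using cinner_add_left[of 0 0 x] by simp

lemma cinner_minus_left: "cinner (- x) y = - cinner x y"
  using cinner_add_left[of x "- x" y] by (simp add: add_eq_0_iff)

lemma cinner_diff_left: "cinner (x - y) z = cinner x z - cinner y z"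
  using cinner_add_left[of x "- y" z] by (simp add: cinner_minus_left)

lemma cinner_sum_right: "cinner x (\<Sum>i\<in>I. f i) = (\<Sum>i\<in>I. cinner x (f i))"
  by (induction I rule: infinite_finite_induct) (auto simp: cinner_add_right)

lemma cinner_sum_left: "cinner (\<Sum>i\<in>I. f i) x = (\<Sum>i\<in>I. cinner (f i) x)"
  by (induction I rule: infinite_finite_induct) (auto simp: cinner_add_left)

lemma cinner_self: "cinner x x = of_real ((norm x)\<^sup>2)"
proof -
  have "Im (cinner x x) = 0"
    using cinner_commute[of x x] by (simp add: complex_eq_iff)
  moreover have "Re (cinner x x) = (norm x)\<^sup>2"
    by (simp add: Re_cinner power2_norm_eq_inner)
  ultimately show ?thesis by (simp add: complex_eq_iff)
qed

lemma scaleC_one [simp]: "1 *\<^sub>C (x::'a::complex_inner) = x"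
  using scaleC_of_real[of 1 x] by simp

lemma scaleC_zero_left [simp]: "0 *\<^sub>C (x::'a::complex_inner) = 0"
  using scaleC_of_real[of 0 x] by simp

lemma scaleC_scaleR: "c *\<^sub>C scaleR r x = scaleR r (c *\<^sub>C (x::'a::complex_inner))"
  by (simp add: scaleC_of_real[symmetric] scaleC_scaleC mult.commute)

lemma scaleC_sum_right: "c *\<^sub>C (\<Sum>i\<in>I. f i) = (\<Sum>i\<in>I. c *\<^sub>C (f i :: 'a::complex_inner))"
  by (induction I rule: infinite_finite_induct) (auto simp: scaleC_add_right scaleC_zero_right)

lemma norm_scaleC: "norm (c *\<^sub>C (x::'a::complex_inner)) = cmod c * norm x"
proof -
  have "complex_of_real ((norm (c *\<^sub>C x))\<^sup>2) = of_real ((cmod c * norm x)\<^sup>2)"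
    unfolding cinner_self[symmetric] cinner_scaleC_left cinner_scaleC_right
    by (simp only: cinner_self power_mult_distrib of_real_mult complex_norm_square mult_ac)
  then have "(norm (c *\<^sub>C x))\<^sup>2 = (cmod c * norm x)\<^sup>2"
    unfolding of_real_eq_iff .
  then show ?thesis by (rule power2_eq_imp_eq) auto
qed

lemma cinner_Cauchy_Schwarz: "cmod (cinner x y) \<le> norm x * norm y"
proof (cases "cinner x y = 0")
  case False
  define u where "u = cnj (cinner x y) / cmod (cinner x y)"
  have "cinner x (u *\<^sub>C y) = cmod (cinner x y)"
    using False complex_norm_square[of "cinner x y"]
    by (simp add: cinner_scaleC_right u_def power2_eq_square field_simps)
  then have "cmod (cinner x y) = inner x (u *\<^sub>C y)"
    by (metis Re_cinner Re_complex_of_real)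
  also have "\<dots> \<le> norm x * norm (u *\<^sub>C y)"
    by (rule norm_cauchy_schwarz)
  also have "norm (u *\<^sub>C y) = norm y"
    using False by (simp add: norm_scaleC u_def norm_divide)
  finally show ?thesis .
qed simp

lemma bounded_bilinear_cinner: "bounded_bilinear (cinner :: 'a::complex_inner \<Rightarrow> 'a \<Rightarrow> complex)"
proof
  show "\<exists>K. \<forall>a b::'a. cmod (cinner a b) \<le> norm a * norm b * K"
    by (rule exI[of _ 1]) (simp add: cinner_Cauchy_Schwarz)
qed (simp_all add: cinner_add_left cinner_add_right cinner_scaleC_left cinner_scaleC_right
    scaleC_of_real[symmetric] scaleR_conv_of_real)

lemma bounded_bilinear_scaleC: "bounded_bilinear (scaleC :: complex \<Rightarrow> 'a::complex_inner \<Rightarrow> 'a)"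
proof
  show "\<exists>K. \<forall>a. \<forall>b::'a. norm (a *\<^sub>C b) \<le> norm a * norm b * K"
    by (rule exI[of _ 1]) (simp add: norm_scaleC)
qed (simp_all add: scaleC_add_left scaleC_add_right scaleC_scaleR
    scaleC_of_real[symmetric] scaleR_conv_of_real scaleC_scaleC mult.commute)

lemmas tendsto_cinner = bounded_bilinear.tendsto[OF bounded_bilinear_cinner]
lemmas bounded_linear_cinner_right = bounded_bilinear.bounded_linear_right[OF bounded_bilinear_cinner]
definition onb_proj :: "'a::complex_inner set \<Rightarrow> 'a \<Rightarrow> 'a" where
  "onb_proj F x = (\<Sum>e\<in>F. cinner e x *\<^sub>C e)"

definition orthonormal :: "'a::complex_inner set \<Rightarrow> bool" where
  "orthonormal F \<longleftrightarrow> (\<forall>e\<in>F. \<forall>f\<in>F. cinner e f = (if e = f then 1 else 0))"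

lemma orthonormal_subset: "orthonormal E \<Longrightarrow> F \<subseteq> E \<Longrightarrow> orthonormal F"
  unfolding orthonormal_def by blast

lemma orthonormal_basis_imp_orthonormal: "orthonormal_basis E \<Longrightarrow> orthonormal E"
  by (simp add: orthonormal_basis_def orthonormal_def)

lemma cinner_onb_proj_eq: "cinner y (onb_proj F x) = (\<Sum>e\<in>F. cinner y e * cinner e x)"
  by (simp add: onb_proj_def cinner_sum_right cinner_scaleC_right mult.commute)

lemma onb_proj_self_adjoint: "cinner (onb_proj F y) x = cinner y (onb_proj F x)"
  unfolding cinner_onb_proj_eq unfolding onb_proj_def cinner_sum_left cinner_scaleC_left
  by (intro sum.cong refl) (simp only: cinner_commute[of y] mult.commute)

lemma cinner_orthonormal_sum:
  assumes "orthonormal E" "finite F" "F \<subseteq> E" "e \<in> E"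
  shows "cinner e (\<Sum>g\<in>F. a g *\<^sub>C g) = (if e \<in> F then a e else 0)"
proof -
  have "cinner e (\<Sum>g\<in>F. a g *\<^sub>C g) = (\<Sum>g\<in>F. if g = e then a e else 0)"
    unfolding cinner_sum_right
    by (intro sum.cong refl) (use assms in \<open>auto simp: cinner_scaleC_right orthonormal_def\<close>)
  then show ?thesis using assms(2) by (simp add: sum.delta)
qed

lemma cinner_onb_proj:
  assumes "orthonormal E" "finite F" "F \<subseteq> E" "e \<in> E"
  shows "cinner e (onb_proj F x) = (if e \<in> F then cinner e x else 0)"
  unfolding onb_proj_def by (rule cinner_orthonormal_sum[OF assms])

lemma norm_orthonormal_sum:
  assumes "orthonormal F" "finite F"
  shows "(norm (\<Sum>e\<in>F. a e *\<^sub>C e))\<^sup>2 = (\<Sum>e\<in>F. (cmod (a e))\<^sup>2)"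
proof -
  let ?z = "\<Sum>e\<in>F. a e *\<^sub>C e"
  have "complex_of_real ((norm ?z)\<^sup>2) = cinner ?z ?z"
    by (simp add: cinner_self)
  also have "\<dots> = (\<Sum>e\<in>F. cnj (a e) * cinner e ?z)"
    by (subst (1) cinner_sum_left) (simp add: cinner_scaleC_left)
  also have "\<dots> = (\<Sum>e\<in>F. of_real ((cmod (a e))\<^sup>2))"
    by (intro sum.cong refl)
      (use assms in \<open>simp add: cinner_orthonormal_sum[of F] complex_norm_square mult.commute del: of_real_power\<close>)
  finally show ?thesis unfolding of_real_sum[symmetric] of_real_eq_iff .
qed

lemma norm_onb_proj:
  assumes "orthonormal F" "finite F"
  shows "(norm (onb_proj F x))\<^sup>2 = (\<Sum>e\<in>F. (cmod (cinner e x))\<^sup>2)"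
  unfolding onb_proj_def by (rule norm_orthonormal_sum[OF assms])

lemma norm_minus_onb_proj:
  assumes "orthonormal F" "finite F"
  shows "(norm (x - onb_proj F x))\<^sup>2 = (norm x)\<^sup>2 - (\<Sum>e\<in>F. (cmod (cinner e x))\<^sup>2)"
proof -
  have 1: "cinner x (onb_proj F x) = (\<Sum>e\<in>F. of_real ((cmod (cinner e x))\<^sup>2))"
    unfolding cinner_onb_proj_eq
    by (intro sum.cong refl) (simp only: complex_norm_square cinner_commute[of x] mult.commute)
  have 2: "cinner (onb_proj F x) x = (\<Sum>e\<in>F. of_real ((cmod (cinner e x))\<^sup>2))"
    unfolding onb_proj_self_adjoint 1 ..
  have "complex_of_real ((norm (x - onb_proj F x))\<^sup>2) =
      cinner (x - onb_proj F x) (x - onb_proj F x)"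
    by (simp add: cinner_self)
  also have "\<dots> = of_real ((norm x)\<^sup>2 - (\<Sum>e\<in>F. (cmod (cinner e x))\<^sup>2))"
    unfolding cinner_diff_left cinner_diff_right 1 2
    by (simp add: cinner_self norm_onb_proj[OF assms] del: of_real_power)
  finally show ?thesis unfolding of_real_eq_iff .
qed

lemma bessel:
  assumes "orthonormal F" "finite F"
  shows "(\<Sum>e\<in>F. (cmod (cinner e x))\<^sup>2) \<le> (norm x)\<^sup>2"
  using norm_minus_onb_proj[OF assms, of x] zero_le_power2[of "norm (x - onb_proj F x)"] by linarith

lemma norm_onb_proj_le:
  assumes "orthonormal F" "finite F"
  shows "norm (onb_proj F x) \<le> norm x"
  using bessel[OF assms, of x] unfolding norm_onb_proj[OF assms, symmetric] by (rule power2_le_imp_le) simp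

text \<open>Completeness enters the theory of bases only here: the partial sums over finite sets
  form a Cauchy filter, since the squared distance of two nested ones is a difference of partial
  sums of squared moduli.\<close>

lemma orthonormal_series_converges:
  fixes E :: "'a::{complex_inner, banach} set"
  assumes oE: "orthonormal E"
    and bd: "\<And>F. finite F \<Longrightarrow> F \<subseteq> E \<Longrightarrow> (\<Sum>e\<in>F. (cmod (a e))\<^sup>2) \<le> B"
  obtains y where "((\<lambda>F. \<Sum>e\<in>F. a e *\<^sub>C e) \<longlongrightarrow> y) (finite_subsets_at_top E)"
proof -
  define z where "z = (\<lambda>F. \<Sum>e\<in>F. a e *\<^sub>C e)"
  define b where "b = (\<lambda>e. (cmod (a e))\<^sup>2)"
  have "b summable_on E"
  proof (rule nonneg_bdd_above_summable_on)
    show "bdd_above (sum b ` {F. F \<subseteq> E \<and> finite F})"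
      using bd by (intro bdd_aboveI2[where M = B]) (auto simp: b_def)
  qed (simp add: b_def)
  then obtain s where s: "(sum b \<longlongrightarrow> s) (finite_subsets_at_top E)"
    by (auto simp: summable_on_def has_sum_def)
  have "\<exists>P. eventually P (finite_subsets_at_top E) \<and>
      (\<forall>F F'. P F \<and> P F' \<longrightarrow> dist (z F) (z F') < e)" if e: "e > 0" for e
  proof -
    \<comment> \<open>Two sections that are both \<open>d\<close>-close to the limit of the squared moduli differ by less than \<open>2 * d\<close>, and \<open>2 * d \<le> (e/2)\<^sup>2\<close>.\<close>
    define d where "d = e\<^sup>2 / 16"
    define P where "P F \<longleftrightarrow> finite F \<and> F \<subseteq> E \<and> dist (sum b F) s < d" for F
    have d: "d > 0" using e by (simp add: d_def)
    have ev: "eventually P (finite_subsets_at_top E)"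
      using s by (auto simp add: P_def[abs_def] d tendsto_iff eventually_conj_iff eventually_finite_subsets_at_top_weakI)
    moreover have "dist (z F1) (z F2) < e" if P: "P F1" "P F2" for F1 F2
    proof -
      from ev obtain F' where F': "finite F'" "F' \<subseteq> E" and P': "\<And>F. finite F \<and> F \<supseteq> F' \<and> F \<subseteq> E \<Longrightarrow> P F"
        by atomize_elim (simp add: eventually_finite_subsets_at_top)
      define F where "F = F' \<union> F1 \<union> F2"
      have F12sub: "F1 \<subseteq> F" "F2 \<subseteq> F"
        by (auto simp: F_def)
      have F12: "finite F" "F \<subseteq> E"
        using P F' unfolding F_def P_def by blast+
      have F: "finite F" "F \<subseteq> E" "P F"
        using P'[of F] F12 by (auto simp: F_def)
      have half: "dist (z F) (z G) < e / 2" if G: "G \<subseteq> F" "P G" for G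
      proof -
        have "z F - z G = z (F - G)"
          unfolding z_def using F(1) G(1) by (simp add: sum_diff)
        then have "(dist (z F) (z G))\<^sup>2 = sum b (F - G)"
          using norm_orthonormal_sum[of "F - G" a] orthonormal_subset[OF oE, of "F - G"] F
          by (auto simp: dist_norm b_def z_def)
        also have "\<dots> = sum b F - sum b G"
          using F(1) G(1) by (simp add: sum_diff)
        also have "\<dots> < 2 * d"
          using F(3) G(2) by (auto simp: P_def dist_real_def)
        also have "\<dots> \<le> (e / 2)\<^sup>2" using e by (simp add: d_def power2_eq_square)
        finally show ?thesis by (rule power2_less_imp_less) (use e in simp)
      qed
      have "dist (z F1) (z F2) \<le> dist (z F) (z F1) + dist (z F) (z F2)"
        by (rule dist_triangle3)
      also have "\<dots> < e" using half[of F1] half[of F2] P F12sub by simp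
      finally show ?thesis .
    qed
    ultimately show ?thesis by blast
  qed
  then have "cauchy_filter (filtermap z (finite_subsets_at_top E))"
    by (simp add: cauchy_filter_metric_filtermap)
  moreover have "complete (UNIV::'a set)"
    by (meson Cauchy_convergent UNIV_I complete_def convergent_def)
  ultimately obtain y where y: "(z \<longlongrightarrow> y) (finite_subsets_at_top E)"
    using cauchy_filter_complete_converges[of "filtermap z (finite_subsets_at_top E)" UNIV]
    by (auto simp: filterlim_def filtermap_bot_iff)
  then show thesis using that by (simp add: z_def)
qed

lemma onb_expansion:
  fixes E :: "'a::{complex_inner, banach} set"
  assumes E: "orthonormal_basis E"
  shows "((\<lambda>F. onb_proj F x) \<longlongrightarrow> x) (finite_subsets_at_top E)"
proof -
  have oE: "orthonormal E" by (rule orthonormal_basis_imp_orthonormal[OF E])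
  obtain y where "((\<lambda>F. \<Sum>e\<in>F. cinner e x *\<^sub>C e) \<longlongrightarrow> y) (finite_subsets_at_top E)"
    by (rule orthonormal_series_converges[OF oE bessel]) (auto intro: orthonormal_subset[OF oE])
  then have y: "((\<lambda>F. onb_proj F x) \<longlongrightarrow> y) (finite_subsets_at_top E)"
    by (simp add: onb_proj_def)
  have "cinner e (y - x) = 0" if e: "e \<in> E" for e
  proof -
    have "((\<lambda>F. cinner e (onb_proj F x)) \<longlongrightarrow> cinner e y) (finite_subsets_at_top E)"
      by (intro tendsto_cinner tendsto_const y)
    moreover have "((\<lambda>F. cinner e (onb_proj F x)) \<longlongrightarrow> cinner e x) (finite_subsets_at_top E)"
    proof (rule tendsto_eventually)
      show "\<forall>\<^sub>F F in finite_subsets_at_top E. cinner e (onb_proj F x) = cinner e x"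
        unfolding eventually_finite_subsets_at_top
        by (rule exI[of _ "{e}"]) (use e oE in \<open>auto simp: cinner_onb_proj[of E]\<close>)
    qed
    ultimately have "cinner e y = cinner e x"
      by (rule tendsto_unique[OF finite_subsets_at_top_neq_bot])
    then show ?thesis by (simp add: cinner_diff_right)
  qed
  then have "y - x = 0" using E unfolding orthonormal_basis_def by blast
  with y show ?thesis by simp
qed

lemma bounded_clinear_add: "bounded_clinear A \<Longrightarrow> A (x + y) = A x + A y"
  by (simp add: bounded_clinear_def linear_simps)

lemma bounded_clinear_scaleC: "bounded_clinear A \<Longrightarrow> A (c *\<^sub>C x) = c *\<^sub>C A x"
  by (simp add: bounded_clinear_def)

section \<open>Functionals and adjoints\<close>

text \<open>The vector has to be \<open>\<Sum>\<^sub>e cnj (f e) e\<close>; the finite sums are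
  bounded because \<open>f\<close> takes the value \<open>norm\<^sup>2\<close> on them.\<close>

lemma riesz_representation:
  fixes E :: "'a::{complex_inner, banach} set" and f :: "'a \<Rightarrow> complex"
  assumes E: "orthonormal_basis E" and f: "bounded_linear f" and fC: "\<And>c x. f (c *\<^sub>C x) = c * f x"
  obtains y where "\<And>x. f x = cinner y x" "norm y \<le> onorm f"
proof -
  have oE: "orthonormal E" by (rule orthonormal_basis_imp_orthonormal[OF E])
  define a where "a = (\<lambda>e. cnj (f e))"
  define z where "z = (\<lambda>F. \<Sum>e\<in>F. a e *\<^sub>C e)"
  have fz: "f (z F) = (\<Sum>e\<in>F. of_real ((cmod (a e))\<^sup>2))" if "finite F" for F
    unfolding z_def bounded_linear.linear[OF f, THEN linear_sum] fC
    by (intro sum.cong refl) (simp add: a_def complex_norm_square mult.commute del: of_real_power)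
  have nz: "(norm (z F))\<^sup>2 = (\<Sum>e\<in>F. (cmod (a e))\<^sup>2)" if "finite F" "F \<subseteq> E" for F
    unfolding z_def using that orthonormal_subset[OF oE] by (intro norm_orthonormal_sum) auto
  have bd: "(\<Sum>e\<in>F. (cmod (a e))\<^sup>2) \<le> (onorm f)\<^sup>2" if F: "finite F" "F \<subseteq> E" for F
  proof -
    have "(norm (z F))\<^sup>2 = cmod (f (z F))"
      unfolding fz[OF F(1)] of_real_sum[symmetric] norm_of_real nz[OF F] by (simp add: sum_nonneg)
    also have "\<dots> \<le> onorm f * norm (z F)" by (rule onorm[OF f])
    finally have "norm (z F) \<le> onorm f"
      using onorm_pos_le[OF f] by (cases "norm (z F) = 0") (auto simp: power2_eq_square)
    then have "(norm (z F))\<^sup>2 \<le> (onorm f)\<^sup>2" by (simp add: power_mono)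
    then show ?thesis by (simp add: nz[OF F])
  qed
  obtain y where y: "(z \<longlongrightarrow> y) (finite_subsets_at_top E)"
    unfolding z_def by (rule orthonormal_series_converges[OF oE bd])
  show thesis
  proof
    fix x
    have 1: "((\<lambda>F. f (onb_proj F x)) \<longlongrightarrow> f x) (finite_subsets_at_top E)"
      by (intro bounded_linear.tendsto[OF f] onb_expansion E)
    have 2: "((\<lambda>F. cinner (z F) x) \<longlongrightarrow> cinner y x) (finite_subsets_at_top E)"
      by (intro tendsto_cinner tendsto_const y)
    have fp: "f (onb_proj F x) = cinner (z F) x" for F
      unfolding onb_proj_def z_def bounded_linear.linear[OF f, THEN linear_sum] fC cinner_sum_left
      by (simp add: cinner_scaleC_left a_def mult.commute)
    show "f x = cinner y x"
      using 1 2 unfolding fp by (rule tendsto_unique[OF finite_subsets_at_top_neq_bot])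
  next
    have "((\<lambda>F. norm (z F)) \<longlongrightarrow> norm y) (finite_subsets_at_top E)"
      by (rule tendsto_norm[OF y])
    moreover have "\<forall>\<^sub>F F in finite_subsets_at_top E. norm (z F) \<le> onorm f"
    proof (rule eventually_finite_subsets_at_top_weakI)
      fix F assume "finite F" "F \<subseteq> E"
      then have "(norm (z F))\<^sup>2 \<le> (onorm f)\<^sup>2" by (subst nz) (auto intro: bd)
      then show "norm (z F) \<le> onorm f"
        by (rule power2_le_imp_le) (rule onorm_pos_le[OF f])
    qed
    ultimately show "norm y \<le> onorm f"
      by (rule tendsto_upperbound) simp
  qed
qed

text \<open>Existence and norm bound suffice: the adjoint only serves to move a bounded operator
  to the other side of a nuclear series.\<close>

lemma adjoint_exists:
  fixes E :: "'a::{complex_inner, banach} set" and A :: "'a \<Rightarrow> 'a"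
  assumes E: "orthonormal_basis E" and A: "bounded_clinear A"
  obtains A' where "\<And>x y. cinner y (A x) = cinner (A' y) x" "\<And>y. norm (A' y) \<le> onorm A * norm y"
proof -
  have bA: "bounded_linear A" using A by (simp add: bounded_clinear_def)
  have "\<exists>w. (\<forall>x. cinner y (A x) = cinner w x) \<and> norm w \<le> onorm A * norm y" for y
  proof -
    have b: "bounded_linear (\<lambda>x. cinner y (A x))"
      by (rule bounded_linear_compose[OF bounded_linear_cinner_right bA])
    obtain w where w: "\<And>x. cinner y (A x) = cinner w x" "norm w \<le> onorm (\<lambda>x. cinner y (A x))"
      by (rule riesz_representation[OF E b]) (simp_all add: bounded_clinear_scaleC[OF A] cinner_scaleC_right)
    have "onorm (\<lambda>x. cinner y (A x)) \<le> onorm A * norm y"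
    proof (rule onorm_bound)
      show "0 \<le> onorm A * norm y" by (simp add: onorm_pos_le[OF bA])
      fix x
      have "cmod (cinner y (A x)) \<le> norm y * norm (A x)" by (rule cinner_Cauchy_Schwarz)
      also have "\<dots> \<le> norm y * (onorm A * norm x)" by (intro mult_left_mono onorm[OF bA]) auto
      finally show "norm (cinner y (A x)) \<le> onorm A * norm y * norm x" by (simp add: mult_ac)
    qed
    with w show ?thesis by force
  qed
  then obtain A' where "\<And>y. (\<forall>x. cinner y (A x) = cinner (A' y) x) \<and> norm (A' y) \<le> onorm A * norm y"
    by metis
  then show thesis using that by blast
qed

section \<open>Fredholm determinants\<close>

lemma tendsto_fdet:
  assumes "\<And>i j. i < n \<Longrightarrow> j < n \<Longrightarrow> ((\<lambda>a. f a i j) \<longlongrightarrow> g i j) F"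
  shows "((\<lambda>a. fdet n (f a)) \<longlongrightarrow> fdet n g) F"
  unfolding fdet_leibniz
  by (intro tendsto_sum tendsto_mult tendsto_const tendsto_prod assms) (auto simp: permutes_in_image)

definition gram_det :: "(nat \<Rightarrow> 'a::complex_inner) \<Rightarrow> (nat \<Rightarrow> 'a) \<Rightarrow> nat \<Rightarrow> complex" where
  "gram_det y x N = fdet N (\<lambda>i j. (if i = j then 1 else 0) + cinner (y i) (x j))"

text \<open>The analytic core of the theory of determinants. The vectors \<open>X F n\<close> may
  depend on the section \<open>F\<close>, which is needed for products; the constant choice gives
  the determinant itself. Truncations of the series converge to the section determinant uniformly
  in \<open>F\<close>, with summable increments by Hadamard's inequality, so the limits over
  truncations and over sections can be exchanged.\<close>

lemma section_det_limit:
  fixes E :: "'a::{complex_inner, banach} set" and X :: "'a set \<Rightarrow> nat \<Rightarrow> 'a"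
  assumes E: "orthonormal_basis E" and c: "summable c"
    and X: "\<And>F n. finite F \<Longrightarrow> F \<subseteq> E \<Longrightarrow> (norm (X F n))\<^sup>2 \<le> c n"
    and y: "\<And>n. (norm (y n))\<^sup>2 \<le> c n"
    and lim: "\<And>n. ((\<lambda>F. X F n) \<longlongrightarrow> x n) (finite_subsets_at_top E)"
    and T: "\<And>F v. finite F \<Longrightarrow> F \<subseteq> E \<Longrightarrow> (\<lambda>n. cinner (y n) v *\<^sub>C X F n) sums (T F v - v)"
  obtains L where "gram_det y x \<longlonglongrightarrow> L"
    "((\<lambda>F. section_det (T F) F) \<longlongrightarrow> L) (finite_subsets_at_top E)"
proof -
  let ?\<F> = "finite_subsets_at_top E"
  have oE: "orthonormal E" by (rule orthonormal_basis_imp_orthonormal[OF E])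
  define fin where "fin = {F. finite F \<and> F \<subseteq> E}"
  \<comment> \<open>Truncation at \<open>N\<close> of the determinant belonging to the section \<open>F\<close>.\<close>
  define dF where "dF = (\<lambda>N F. fdet N (\<lambda>i j. (if i = j then 1 else 0) + (\<Sum>e\<in>F. cnj (cinner e (y i)) * cinner e (X F j))))"
  \<comment> \<open>The products in the increment bound stay below this constant.\<close>
  define K where "K = exp (suminf c)"
  have c0: "0 \<le> c n" for n using y[of n] zero_le_power2[of "norm (y n)"] by linarith
  have prodK: "(\<Prod>i<n. 1 + c i) \<le> K" for n
  proof -
    have "(\<Prod>i<n. 1 + c i) \<le> (\<Prod>i<n. exp (c i))"
      using c0 by (intro prod_mono) (auto intro: add_nonneg_nonneg)
    also have "\<dots> = exp (\<Sum>i<n. c i)" by (simp add: exp_sum)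
    also have "\<dots> \<le> K" unfolding K_def using c c0 by (simp add: sum_le_suminf)
    finally show ?thesis .
  qed
  have step: "cmod (dF (Suc n) F - dF n F) \<le> K * c n" if F: "F \<in> fin" for n F
  proof -
    have F': "finite F" "F \<subseteq> E" "orthonormal F"
      using F orthonormal_subset[OF oE] by (auto simp: fin_def)
    have "cmod (dF (Suc n) F - dF n F) \<le> c n * (\<Prod>i<n. 1 + c i)"
      unfolding dF_def
    proof (rule fdet_Suc_diff_bound)
      show "(\<Sum>e\<in>F. (cmod (cinner e (X F i)))\<^sup>2) \<le> c i" for i
        using bessel[OF F'(3,1), of "X F i"] X[OF F'(1,2), of i] by linarith
      show "(\<Sum>e\<in>F. (cmod (cinner e (y i)))\<^sup>2) \<le> c i" for i
        using bessel[OF F'(3,1), of "y i"] y[of i] by linarith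
    qed (fact F')
    also have "\<dots> \<le> c n * K" by (intro mult_left_mono prodK c0)
    finally show ?thesis by (simp add: mult.commute)
  qed
  have dF0: "dF 0 F = 1" for F by (simp add: dF_def fdet_leibniz)
  have tele: "(\<Sum>i<n. dF (Suc i) F - dF i F) = dF n F - 1" for n F
    by (induction n) (auto simp: dF0)
  have sK: "summable (\<lambda>n. K * c n)" using c by (rule summable_mult)
  have tof: "(\<lambda>N. dF N F) \<longlonglongrightarrow> section_det (T F) F" if F: "F \<in> fin" for F
  proof -
    have F': "finite F" "F \<subseteq> E" "orthonormal F"
      using F orthonormal_subset[OF oE] by (auto simp: fin_def)
    obtain h where h: "bij_betw h {0..<card F} F"
      using ex_bij_betw_nat_finite[OF F'(1)] by blast
    have hF: "h a \<in> F" if "a < card F" for a using h that by (auto simp: bij_betw_def)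
    have inj: "h a = h b \<longleftrightarrow> a = b" if "a < card F" "b < card F" for a b
      using h that by (auto simp: bij_betw_def inj_on_def)
    have eq: "dF N F = fdet (card F) (\<lambda>a b. (if a = b then 1 else 0) + (\<Sum>l<N. cinner (h a) (X F l) * cinner (y l) (h b)))" for N
    proof -
      have "dF N F = fdet N (\<lambda>i j. (if i = j then 1 else 0) + (\<Sum>a<card F. cinner (y i) (h a) * cinner (h a) (X F j)))"
        unfolding dF_def
      proof (rule fdet_cong)
        fix i j
        have "(\<Sum>e\<in>F. cnj (cinner e (y i)) * cinner e (X F j)) = (\<Sum>a = 0..<card F. cnj (cinner (h a) (y i)) * cinner (h a) (X F j))"
          by (rule sum.reindex_bij_betw[OF h, symmetric])
        also have "\<dots> = (\<Sum>a<card F. cinner (y i) (h a) * cinner (h a) (X F j))"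
          unfolding atLeast0LessThan by (simp only: cinner_commute[of "y i"])
        finally show "(if i = j then 1 else 0) + (\<Sum>e\<in>F. cnj (cinner e (y i)) * cinner e (X F j)) =
          (if i = j then 1 else 0) + (\<Sum>a<card F. cinner (y i) (h a) * cinner (h a) (X F j))" by simp
      qed
      then show ?thesis by (simp only: fdet_sylvester[where n = N and m = "card F"])
    qed
    have "(\<lambda>N. dF N F) \<longlonglongrightarrow> fdet (card F) (\<lambda>a b. cinner (h a) (T F (h b)))"
      unfolding eq
    proof (rule tendsto_fdet)
      fix a b assume ab: "a < card F" "b < card F"
      have "(\<lambda>l. cinner (h a) (cinner (y l) (h b) *\<^sub>C X F l)) sums cinner (h a) (T F (h b) - h b)"
        by (rule bounded_linear.sums[OF bounded_linear_cinner_right T[OF F'(1,2)]])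
      then have "(\<lambda>N. \<Sum>l<N. cinner (h a) (X F l) * cinner (y l) (h b)) \<longlonglongrightarrow> cinner (h a) (T F (h b)) - cinner (h a) (h b)"
        unfolding sums_def cinner_scaleC_right cinner_diff_right by (simp only: mult.commute)
      moreover have "cinner (h a) (h b) = (if a = b then 1 else 0)"
        using F'(3) hF ab inj[OF ab] by (auto simp: orthonormal_def)
      ultimately show "(\<lambda>N. (if a = b then 1 else 0) + (\<Sum>l<N. cinner (h a) (X F l) * cinner (y l) (h b))) \<longlonglongrightarrow> cinner (h a) (T F (h b))"
        using tendsto_add[OF tendsto_const[of "if a = b then 1 else 0 :: complex"]] by fastforce
    qed
    then show ?thesis by (simp add: section_det_eq_fdet[OF h])
  qed
  have uni: "uniform_limit fin dF (\<lambda>F. section_det (T F) F) sequentially"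
  proof -
    have "uniform_limit fin (\<lambda>n F. \<Sum>i<n. dF (Suc i) F - dF i F) (\<lambda>F. \<Sum>i. dF (Suc i) F - dF i F) sequentially"
      by (rule Weierstrass_m_test[OF step sK])
    then have *: "uniform_limit fin (\<lambda>n F. dF n F - 1) (\<lambda>F. \<Sum>i. dF (Suc i) F - dF i F) sequentially"
      by (simp only: tele)
    have "(\<Sum>i. dF (Suc i) F - dF i F) = section_det (T F) F - 1" if "F \<in> fin" for F
    proof (rule sums_unique[symmetric])
      show "(\<lambda>i. dF (Suc i) F - dF i F) sums (section_det (T F) F - 1)"
        unfolding sums_def tele by (intro tendsto_diff tof that tendsto_const)
    qed
    with * have "uniform_limit fin (\<lambda>n F. dF n F - 1) (\<lambda>F. section_det (T F) F - 1) sequentially"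
      by (subst (asm) uniform_limit_cong') auto
    then have "uniform_limit fin (\<lambda>n F. (dF n F - 1) + 1) (\<lambda>F. (section_det (T F) F - 1) + 1) sequentially"
      by (intro uniform_limit_add uniform_limit_const)
    then show ?thesis by simp
  qed
  have limN: "((\<lambda>F. dF N F) \<longlongrightarrow> gram_det y x N) ?\<F>" for N
    unfolding dF_def gram_det_def
  proof (rule tendsto_fdet)
    fix i j
    have "(\<Sum>e\<in>F. cnj (cinner e (y i)) * cinner e (X F j)) = cinner (onb_proj F (y i)) (X F j)" for F
      by (simp add: onb_proj_def cinner_sum_left cinner_scaleC_left)
    then show "((\<lambda>F. (if i = j then 1 else 0) + (\<Sum>e\<in>F. cnj (cinner e (y i)) * cinner e (X F j))) \<longlongrightarrow> (if i = j then 1 else 0) + cinner (y i) (x j)) ?\<F>"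
      by (simp only:) (intro tendsto_add tendsto_const tendsto_cinner onb_expansion E lim)
  qed
  have ev: "\<forall>\<^sub>F F in ?\<F>. F \<in> fin"
    by (rule eventually_finite_subsets_at_top_weakI) (simp add: fin_def)
  have gstep: "norm (gram_det y x (Suc n) - gram_det y x n) \<le> K * c n" for n
  proof (rule tendsto_upperbound)
    show "((\<lambda>F. norm (dF (Suc n) F - dF n F)) \<longlongrightarrow> norm (gram_det y x (Suc n) - gram_det y x n)) ?\<F>"
      by (intro tendsto_norm tendsto_diff limN)
    show "\<forall>\<^sub>F F in ?\<F>. norm (dF (Suc n) F - dF n F) \<le> K * c n"
      using ev by eventually_elim (rule step)
  qed simp
  have "summable (\<lambda>n. gram_det y x (Suc n) - gram_det y x n)"
    by (rule summable_comparison_test'[OF sK, of 0]) (simp add: gstep)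
  then have "(\<lambda>n. gram_det y x n - gram_det y x 0) \<longlonglongrightarrow> (\<Sum>n. gram_det y x (Suc n) - gram_det y x n)"
    using summable_LIMSEQ by (simp only: sum_lessThan_telescope[symmetric])
  from tendsto_add[OF this tendsto_const[of "gram_det y x 0"]]
  obtain L where L: "gram_det y x \<longlonglongrightarrow> L" by simp
  have "((\<lambda>F. section_det (T F) F) \<longlongrightarrow> L) ?\<F>"
    by (rule swap_uniform_limit'[OF _ L uni ev]) (auto simp: limN)
  with L show thesis by (rule that)
qed

text \<open>One bound serves for \<open>x n\<close> and for \<open>y n\<close>, so that both
  families are square summable as the determinant bounds require. The common bound
  \<open>c\<close> is flexible enough to absorb the norm of an operator applied to one
  side.\<close>

definition nuclear_rep :: "('a::complex_inner \<Rightarrow> 'a) \<Rightarrow> (nat \<Rightarrow> 'a) \<Rightarrow> (nat \<Rightarrow> 'a) \<Rightarrow> bool" where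
  "nuclear_rep A y x \<longleftrightarrow> (\<exists>c. summable c \<and> (\<forall>n. (norm (x n))\<^sup>2 \<le> c n \<and> (norm (y n))\<^sup>2 \<le> c n)) \<and>
     (\<forall>v. (\<lambda>n. cinner (y n) v *\<^sub>C x n) sums A v)"

text \<open>Rescaling \<open>x n\<close> and \<open>y n\<close> by reciprocal factors leaves the
  series unchanged and makes the two norms equal to the geometric mean of the original
  ones.\<close>

lemma trace_class_nuclear_rep:
  assumes "trace_class A"
  obtains x y where "nuclear_rep A y x"
proof -
  from assms obtain x y where s: "summable (\<lambda>n. norm (x n) * norm (y n))"
    and A: "\<And>v. (\<lambda>n. cinner (y n) v *\<^sub>C x n) sums A v"
    unfolding trace_class_def by blast
  \<comment> \<open>A zero term of the series needs a separate case, since the other factor need not vanish; both vectors are then replaced by zero.\<close>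
  define r where "r = (\<lambda>n. if x n = 0 \<or> y n = 0 then 0 else sqrt (norm (y n) / norm (x n)))"
  define x' where "x' = (\<lambda>n. scaleR (r n) (x n))"
  define y' where "y' = (\<lambda>n. scaleR (inverse (r n)) (y n))"
  have "(norm (x' n))\<^sup>2 = norm (x n) * norm (y n)" for n
    by (simp add: x'_def r_def power_mult_distrib) (simp add: power2_eq_square)
  moreover have "(norm (y' n))\<^sup>2 = norm (x n) * norm (y n)" for n
    by (simp add: y'_def r_def power_mult_distrib power_inverse) (simp add: power2_eq_square)
  moreover have "cinner (y' n) v *\<^sub>C x' n = cinner (y n) v *\<^sub>C x n" for n v
  proof (cases "x n = 0 \<or> y n = 0")
    case False
    then have "r n \<noteq> 0" by (simp add: r_def)
    have "cinner (y' n) v *\<^sub>C x' n = (inverse (of_real (r n)) * of_real (r n) * cinner (y n) v) *\<^sub>C x n"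
      by (simp add: x'_def y'_def scaleC_of_real[symmetric] cinner_scaleC_left scaleC_scaleC mult_ac)
    with \<open>r n \<noteq> 0\<close> show ?thesis by simp
  qed (auto simp: x'_def y'_def r_def scaleC_zero_right)
  ultimately have "nuclear_rep A y' x'"
    unfolding nuclear_rep_def using s A by (intro conjI exI[of _ "\<lambda>n. norm (x n) * norm (y n)"]) auto
  then show thesis by (rule that)
qed

lemma nuclear_rep_imp_trace_class: "nuclear_rep A y x \<Longrightarrow> trace_class A"
proof -
  assume "nuclear_rep A y x"
  then obtain c where c: "summable c" "\<And>n. (norm (x n))\<^sup>2 \<le> c n" "\<And>n. (norm (y n))\<^sup>2 \<le> c n"
    and A: "\<And>v. (\<lambda>n. cinner (y n) v *\<^sub>C x n) sums A v"
    unfolding nuclear_rep_def by blast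
  have "norm (x n) * norm (y n) \<le> c n" for n
    using c(2,3)[of n] sum_squares_bound[of "norm (x n)" "norm (y n)"] by simp
  then have "summable (\<lambda>n. norm (x n) * norm (y n))"
    by (intro summable_comparison_test'[OF c(1), of 0]) simp
  with A show ?thesis unfolding trace_class_def by blast
qed

lemma fredholm_det_eqI:
  fixes T :: "'a::{complex_inner, banach} \<Rightarrow> 'a"
  assumes "orthonormal_basis (E :: 'a set)"
    and "\<And>E. orthonormal_basis E \<Longrightarrow> (section_det T \<longlongrightarrow> d) (finite_subsets_at_top E)"
  shows "fredholm_det T = d"
  unfolding fredholm_det_def
proof (rule the_equality)
  fix d' assume "\<forall>E. orthonormal_basis E \<longrightarrow> (section_det T \<longlongrightarrow> d') (finite_subsets_at_top E)"
  with assms show "d' = d"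
    using tendsto_unique[OF finite_subsets_at_top_neq_bot] by blast
qed (use assms in blast)

text \<open>Since \<^const>\<open>gram_det\<close> does not mention a basis, the limits over the
  sections of all bases agree. As the sections do not mention the series, the limit does not
  depend on the series either.\<close>

lemma fredholm_det_gram:
  fixes T :: "'a::{complex_inner, banach} \<Rightarrow> 'a"
  assumes E: "orthonormal_basis (E :: 'a set)" and rep: "nuclear_rep (\<lambda>v. T v - v) y x"
  shows "gram_det y x \<longlonglongrightarrow> fredholm_det T"
    and "orthonormal_basis E' \<Longrightarrow> (section_det T \<longlongrightarrow> fredholm_det T) (finite_subsets_at_top E')"
proof -
  from rep obtain c where c: "summable c" "\<And>n. (norm (x n))\<^sup>2 \<le> c n" "\<And>n. (norm (y n))\<^sup>2 \<le> c n"
    and A: "\<And>v. (\<lambda>n. cinner (y n) v *\<^sub>C x n) sums (T v - v)"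
    unfolding nuclear_rep_def by blast
  obtain L where L: "gram_det y x \<longlonglongrightarrow> L"
    by (rule section_det_limit[OF E c(1), of "\<lambda>F. x" y x "\<lambda>F. T"]) (use c A in auto)
  have lim: "(section_det T \<longlongrightarrow> L) (finite_subsets_at_top E')" if E': "orthonormal_basis E'" for E'
  proof -
    obtain L' where "gram_det y x \<longlonglongrightarrow> L'" "((\<lambda>F. section_det T F) \<longlongrightarrow> L') (finite_subsets_at_top E')"
      by (rule section_det_limit[OF E' c(1), of "\<lambda>F. x" y x "\<lambda>F. T"]) (use c A in auto)
    with LIMSEQ_unique[OF L] show ?thesis by blast
  qed
  have "fredholm_det T = L" by (rule fredholm_det_eqI[OF E lim])
  with L lim show "gram_det y x \<longlonglongrightarrow> fredholm_det T"
    "orthonormal_basis E' \<Longrightarrow> (section_det T \<longlongrightarrow> fredholm_det T) (finite_subsets_at_top E')" by auto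
qed

text \<open>Inserting the projection onto the span of \<open>F\<close> between the operators is
  exactly the sum over the inner index in a product of matrices.\<close>

lemma section_det_mult:
  assumes F: "finite F" and T: "bounded_clinear T"
  shows "section_det T F * section_det U F = section_det (\<lambda>v. T (onb_proj F (U v))) F"
proof -
  obtain h where h: "bij_betw h {0..<card F} F"
    using ex_bij_betw_nat_finite[OF F] by blast
  have "cinner (h i) (T (onb_proj F (U (h j)))) = (\<Sum>l<card F. cinner (h i) (T (h l)) * cinner (h l) (U (h j)))" for i j
  proof -
    have "T (onb_proj F (U (h j))) = (\<Sum>e\<in>F. cinner e (U (h j)) *\<^sub>C T e)"
      using T unfolding onb_proj_def bounded_clinear_def
      by (simp add: bounded_linear.linear[THEN linear_sum])
    then have "cinner (h i) (T (onb_proj F (U (h j)))) = (\<Sum>e\<in>F. cinner (h i) (T e) * cinner e (U (h j)))"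
      by (simp add: cinner_sum_right cinner_scaleC_right mult.commute)
    also have "\<dots> = (\<Sum>l = 0..<card F. cinner (h i) (T (h l)) * cinner (h l) (U (h j)))"
      by (rule sum.reindex_bij_betw[OF h, symmetric])
    finally show ?thesis by (simp only: atLeast0LessThan)
  qed
  then show ?thesis
    unfolding section_det_eq_fdet[OF h] by (simp only: fdet_mult)
qed

lemma sums_interleave:
  fixes f g :: "nat \<Rightarrow> 'a::real_normed_vector"
  assumes "f sums a" "g sums b"
  shows "(\<lambda>n. if even n then f (n div 2) else g (n div 2)) sums (a + b)"
proof -
  have eq: "(\<Sum>i<n. if even i then f (i div 2) else g (i div 2)) = (\<Sum>i<(n + 1) div 2. f i) + (\<Sum>i<n div 2. g i)" for n
    by (induction n) (auto elim!: evenE oddE)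
  have t: "filterlim (\<lambda>n::nat. (n + k) div 2) at_top at_top" for k
    unfolding filterlim_at_top
  proof
    fix Z :: nat
    show "\<forall>\<^sub>F n in sequentially. Z \<le> (n + k) div 2"
      using eventually_ge_at_top[of "2 * Z"] by eventually_elim auto
  qed
  show ?thesis
    unfolding sums_def eq
    by (intro tendsto_add filterlim_compose[OF assms(1)[unfolded sums_def] t]
      filterlim_compose[OF assms(2)[unfolded sums_def] t[of 0, simplified]])
qed

text \<open>The interleaved sequences are named explicitly because the product formula below
  compares determinants formed from them with determinants of sections.\<close>

lemma nuclear_rep_interleave:
  assumes "nuclear_rep A y x" "nuclear_rep B v u"
  shows "nuclear_rep (\<lambda>w. A w + B w) (\<lambda>n. if even n then y (n div 2) else v (n div 2))
    (\<lambda>n. if even n then x (n div 2) else u (n div 2))"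
proof -
  from assms(1) obtain c where c: "summable c" "\<And>n. (norm (x n))\<^sup>2 \<le> c n" "\<And>n. (norm (y n))\<^sup>2 \<le> c n"
    and A: "\<And>v. (\<lambda>n. cinner (y n) v *\<^sub>C x n) sums A v"
    unfolding nuclear_rep_def by blast
  from assms(2) obtain d where d: "summable d" "\<And>n. (norm (u n))\<^sup>2 \<le> d n" "\<And>n. (norm (v n))\<^sup>2 \<le> d n"
    and B: "\<And>w. (\<lambda>n. cinner (v n) w *\<^sub>C u n) sums B w"
    unfolding nuclear_rep_def by blast
  show ?thesis
    unfolding nuclear_rep_def
  proof (intro conjI exI allI)
    show "summable (\<lambda>n. if even n then c (n div 2) else d (n div 2))"
      using sums_interleave[OF summable_sums[OF c(1)] summable_sums[OF d(1)]] by (rule sums_summable)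
    fix w
    have "(\<lambda>n. if even n then cinner (y (n div 2)) w *\<^sub>C x (n div 2) else cinner (v (n div 2)) w *\<^sub>C u (n div 2)) sums (A w + B w)"
      by (rule sums_interleave[OF A B])
    then show "(\<lambda>n. cinner (if even n then y (n div 2) else v (n div 2)) w *\<^sub>C (if even n then x (n div 2) else u (n div 2))) sums (A w + B w)"
      by (rule back_subst[of "\<lambda>s. s sums (A w + B w)"]) auto
  qed (use c d in auto)
qed

lemma nuclear_rep_compose_left:
  assumes "nuclear_rep A y x" "bounded_clinear B"
  shows "nuclear_rep (\<lambda>w. B (A w)) y (\<lambda>n. B (x n))"
proof -
  have bB: "bounded_linear B" using assms(2) by (simp add: bounded_clinear_def)
  from assms(1) obtain c where c: "summable c" "\<And>n. (norm (x n))\<^sup>2 \<le> c n" "\<And>n. (norm (y n))\<^sup>2 \<le> c n"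
    and A: "\<And>v. (\<lambda>n. cinner (y n) v *\<^sub>C x n) sums A v"
    unfolding nuclear_rep_def by blast
  define k where "k = 1 + (onorm B)\<^sup>2"
  have k: "1 \<le> k" by (simp add: k_def)
  have c0: "0 \<le> c n" for n using c(2)[of n] zero_le_power2[of "norm (x n)"] by linarith
  show ?thesis
    unfolding nuclear_rep_def
  proof (intro conjI exI allI)
    show "summable (\<lambda>n. k * c n)" using c(1) by (rule summable_mult)
    show "(norm (y n))\<^sup>2 \<le> k * c n" for n
      using c(3)[of n] mult_right_mono[OF k c0[of n]] by simp
    show "(norm (B (x n)))\<^sup>2 \<le> k * c n" for n
    proof -
      have "(norm (B (x n)))\<^sup>2 \<le> (onorm B * norm (x n))\<^sup>2"
        by (intro power_mono onorm[OF bB]) auto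
      also have "\<dots> = (onorm B)\<^sup>2 * (norm (x n))\<^sup>2" by (rule power_mult_distrib)
      also have "\<dots> \<le> k * c n" using c(2) c0 by (intro mult_mono) (auto simp: k_def)
      finally show ?thesis .
    qed
    fix w
    show "(\<lambda>n. cinner (y n) w *\<^sub>C B (x n)) sums B (A w)"
      using bounded_linear.sums[OF bB A[of w]] by (simp add: bounded_clinear_scaleC[OF assms(2)])
  qed
qed

lemma nuclear_rep_compose_right:
  assumes "nuclear_rep A y x"
    and B': "\<And>v w. cinner v (B w) = cinner (B' v) w" "\<And>v. norm (B' v) \<le> k * norm v"
  shows "nuclear_rep (\<lambda>w. A (B w)) (\<lambda>n. B' (y n)) x"
proof -
  from assms(1) obtain c where c: "summable c" "\<And>n. (norm (x n))\<^sup>2 \<le> c n" "\<And>n. (norm (y n))\<^sup>2 \<le> c n"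
    and A: "\<And>v. (\<lambda>n. cinner (y n) v *\<^sub>C x n) sums A v"
    unfolding nuclear_rep_def by blast
  define m where "m = 1 + k\<^sup>2"
  have m: "1 \<le> m" by (simp add: m_def)
  have c0: "0 \<le> c n" for n using c(2)[of n] zero_le_power2[of "norm (x n)"] by linarith
  show ?thesis
    unfolding nuclear_rep_def
  proof (intro conjI exI allI)
    show "summable (\<lambda>n. m * c n)" using c(1) by (rule summable_mult)
    show "(norm (x n))\<^sup>2 \<le> m * c n" for n
      using c(2)[of n] mult_right_mono[OF m c0[of n]] by simp
    show "(norm (B' (y n)))\<^sup>2 \<le> m * c n" for n
    proof -
      have "(norm (B' (y n)))\<^sup>2 \<le> (k * norm (y n))\<^sup>2"
        by (intro power_mono B') auto
      also have "\<dots> = k\<^sup>2 * (norm (y n))\<^sup>2" by (rule power_mult_distrib)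
      also have "\<dots> \<le> m * c n" using c(3) c0 by (intro mult_mono) (auto simp: m_def)
      finally show ?thesis .
    qed
    fix w
    show "(\<lambda>n. cinner (B' (y n)) w *\<^sub>C x n) sums A (B w)"
      using A[of "B w"] by (simp add: B'(1))
  qed
qed

lemma trace_class_add:
  assumes "trace_class A" "trace_class B"
  shows "trace_class (\<lambda>v. A v + B v)"
proof -
  obtain x y where A: "nuclear_rep A y x" by (rule trace_class_nuclear_rep[OF assms(1)])
  obtain u v where B: "nuclear_rep B v u" by (rule trace_class_nuclear_rep[OF assms(2)])
  from nuclear_rep_interleave[OF A B] show ?thesis by (rule nuclear_rep_imp_trace_class)
qed

lemma trace_class_compose_left:
  assumes "trace_class A" "bounded_clinear B"
  shows "trace_class (\<lambda>v. B (A v))"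
proof -
  obtain x y where A: "nuclear_rep A y x" by (rule trace_class_nuclear_rep[OF assms(1)])
  from nuclear_rep_compose_left[OF A assms(2)] show ?thesis by (rule nuclear_rep_imp_trace_class)
qed

lemma trace_class_compose_right:
  fixes A B :: "'a::{complex_inner, banach} \<Rightarrow> 'a"
  assumes "orthonormal_basis (E :: 'a set)" "trace_class A" "bounded_clinear B"
  shows "trace_class (\<lambda>v. A (B v))"
proof -
  obtain B' where B': "\<And>x y. cinner y (B x) = cinner (B' y) x" "\<And>y. norm (B' y) \<le> onorm B * norm y"
    by (rule adjoint_exists[OF assms(1,3)]) blast
  obtain x y where "nuclear_rep A y x" by (rule trace_class_nuclear_rep[OF assms(2)])
  from nuclear_rep_compose_right[OF this B'] show ?thesis by (rule nuclear_rep_imp_trace_class)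
qed

text \<open>The product of the sections of \<open>T\<close> and \<open>U\<close> is the section of
  \<open>T Q U\<close>, where \<open>Q\<close> is the projection onto the span of
  \<open>F\<close>. On that span this agrees, up to vectors that the section does not see, with an
  operator \<open>W F\<close> whose difference from the identity is a nuclear series with vectors
  depending on \<open>F\<close> and converging to those of \<open>T U\<close>.\<close>

lemma fredholm_det_mult:
  fixes T U :: "'a::{complex_inner, banach} \<Rightarrow> 'a"
  assumes E: "orthonormal_basis (E :: 'a set)" and T: "bounded_clinear T"
    and tT: "trace_class (\<lambda>v. T v - v)" and tU: "trace_class (\<lambda>v. U v - v)"
  shows "fredholm_det (\<lambda>v. T (U v)) = fredholm_det T * fredholm_det U"
proof -
  have oE: "orthonormal E" by (rule orthonormal_basis_imp_orthonormal[OF E])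
  have bT: "bounded_linear T" using T by (simp add: bounded_clinear_def)
  obtain x y where rT: "nuclear_rep (\<lambda>v. T v - v) y x" by (rule trace_class_nuclear_rep[OF tT])
  obtain u v where rU: "nuclear_rep (\<lambda>v. U v - v) v u" by (rule trace_class_nuclear_rep[OF tU])
  define A where "A = (\<lambda>v. T v - v)"
  have A: "bounded_clinear A"
    using T unfolding A_def bounded_clinear_def
    by (auto intro!: bounded_linear_sub bounded_linear_ident simp: scaleC_diff_right)
  then have bA: "bounded_linear A" by (simp add: bounded_clinear_def)
  from rT obtain c where c: "summable c" "\<And>n. (norm (x n))\<^sup>2 \<le> c n" "\<And>n. (norm (y n))\<^sup>2 \<le> c n"
    and rTs: "\<And>w. (\<lambda>n. cinner (y n) w *\<^sub>C x n) sums (T w - w)"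
    unfolding nuclear_rep_def by blast
  from rU obtain d where d: "summable d" "\<And>n. (norm (u n))\<^sup>2 \<le> d n" "\<And>n. (norm (v n))\<^sup>2 \<le> d n"
    and rUs: "\<And>w. (\<lambda>n. cinner (v n) w *\<^sub>C u n) sums (U w - w)"
    unfolding nuclear_rep_def by blast
  define k where "k = (1 + onorm A)\<^sup>2"
  have k: "1 \<le> k" unfolding k_def using onorm_pos_le[OF bA] by (simp add: power2_eq_square algebra_simps)
  have d0: "0 \<le> d n" for n using d(2)[of n] zero_le_power2[of "norm (u n)"] by linarith
  define y' where "y' = (\<lambda>n::nat. if even n then y (n div 2) else v (n div 2))"
  define X where "X = (\<lambda>F n::nat. if even n then x (n div 2) else u (n div 2) + A (onb_proj F (u (n div 2))))"
  define x' where "x' = (\<lambda>n::nat. if even n then x (n div 2) else T (u (n div 2)))"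
  \<comment> \<open>On a vector \<open>w\<close> of the span this is \<open>T Q U w\<close> up to a vector orthogonal to the span. The operator \<open>T Q U\<close>
    itself differs from the identity by \<open>Q - 1\<close> plus trace class, which in general has no nuclear series.\<close>
  define W where "W = (\<lambda>F w. T w + (U w - w) + A (onb_proj F (U w - w)))"
  define c' where "c' = (\<lambda>n::nat. if even n then c (n div 2) else k * d (n div 2))"
  have c': "summable c'"
    unfolding c'_def using sums_interleave[OF summable_sums[OF c(1)] summable_sums[OF summable_mult[OF d(1)]]] by (rule sums_summable)
  have y'c: "(norm (y' n))\<^sup>2 \<le> c' n" for n
    using c(3) d(3)[of "n div 2"] mult_right_mono[OF k d0[of "n div 2"]] by (auto simp: y'_def c'_def)
  have Xc: "(norm (X F n))\<^sup>2 \<le> c' n" if F: "finite F" "F \<subseteq> E" for F n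
  proof -
    have oF: "orthonormal F" using orthonormal_subset[OF oE F(2)] .
    have "(norm (w + A (onb_proj F w)))\<^sup>2 \<le> k * (norm w)\<^sup>2" for w
    proof -
      have "norm (w + A (onb_proj F w)) \<le> norm w + onorm A * norm (onb_proj F w)"
        by (rule norm_triangle_le) (use onorm[OF bA, of "onb_proj F w"] in simp)
      also have "\<dots> \<le> norm w + onorm A * norm w"
        using norm_onb_proj_le[OF oF F(1)] onorm_pos_le[OF bA] by (simp add: mult_left_mono)
      finally have "norm (w + A (onb_proj F w)) \<le> (1 + onorm A) * norm w" by (simp add: algebra_simps)
      then have "(norm (w + A (onb_proj F w)))\<^sup>2 \<le> ((1 + onorm A) * norm w)\<^sup>2" by (intro power_mono) auto
      then show ?thesis by (simp only: k_def power_mult_distrib)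
    qed
    from order_trans[OF this mult_left_mono[OF d(2)]] show ?thesis
      using c(2) k by (auto simp: X_def c'_def)
  qed
  have Xlim: "((\<lambda>F. X F n) \<longlongrightarrow> x' n) (finite_subsets_at_top E)" for n
  proof (cases "even n")
    case False
    have "((\<lambda>F. u (n div 2) + A (onb_proj F (u (n div 2)))) \<longlongrightarrow> u (n div 2) + A (u (n div 2))) (finite_subsets_at_top E)"
      by (intro tendsto_add tendsto_const bounded_linear.tendsto[OF bA] onb_expansion E)
    then show ?thesis using False by (simp add: X_def x'_def A_def)
  qed (simp add: X_def x'_def)
  have bP: "bounded_linear (onb_proj F)" for F :: "'a set"
    unfolding onb_proj_def
    by (intro bounded_linear_sum bounded_linear_compose[OF bounded_bilinear.bounded_linear_left[OF bounded_bilinear_scaleC]] bounded_linear_cinner_right)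
  have PC: "onb_proj F (a *\<^sub>C w) = a *\<^sub>C onb_proj F w" for F a and w :: 'a
    by (simp add: onb_proj_def cinner_scaleC_right scaleC_scaleC scaleC_sum_right)
  have Wsum: "(\<lambda>n. cinner (y' n) w *\<^sub>C X F n) sums (W F w - w)" for F w
  proof -
    have 1: "bounded_linear (\<lambda>w. w + A (onb_proj F w))"
      by (intro bounded_linear_add bounded_linear_ident bounded_linear_compose[OF bA] bP)
    have 2: "a *\<^sub>C w + A (onb_proj F (a *\<^sub>C w)) = a *\<^sub>C (w + A (onb_proj F w))" for a w
      by (simp add: PC bounded_clinear_scaleC[OF A] scaleC_add_right)
    have 3: "(\<lambda>n. cinner (v n) w *\<^sub>C (u n + A (onb_proj F (u n)))) sums (U w - w + A (onb_proj F (U w - w)))"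
      using bounded_linear.sums[OF 1 rUs[of w]] by (simp only: 2)
    have "(\<lambda>n. if even n then cinner (y (n div 2)) w *\<^sub>C x (n div 2) else
      cinner (v (n div 2)) w *\<^sub>C (u (n div 2) + A (onb_proj F (u (n div 2))))) sums ((T w - w) + (U w - w + A (onb_proj F (U w - w))))"
      by (rule sums_interleave[OF rTs 3])
    moreover have "(T w - w) + (U w - w + A (onb_proj F (U w - w))) = W F w - w"
      by (simp add: W_def)
    ultimately show ?thesis
      by (auto simp: y'_def X_def if_distrib[of "\<lambda>s. cinner s w"] if_distribR cong: if_cong
        elim!: back_subst[of "\<lambda>s. s sums (W F w - w)"])
  qed
  obtain L where L: "gram_det y' x' \<longlonglongrightarrow> L"
      "((\<lambda>F. section_det (W F) F) \<longlongrightarrow> L) (finite_subsets_at_top E)"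
    by (rule section_det_limit[OF E c' Xc y'c Xlim Wsum])
  have rep: "nuclear_rep (\<lambda>w. T (U w) - w) y' x'"
  proof -
    have "nuclear_rep (\<lambda>w. (T w - w) + T (U w - w)) y' x'"
      unfolding y'_def x'_def by (rule nuclear_rep_interleave[OF rT nuclear_rep_compose_left[OF rU T]])
    then show ?thesis by (simp add: linear_diff[OF bounded_linear.linear[OF bT]])
  qed
  have r1: "fredholm_det (\<lambda>v. T (U v)) = L"
    by (rule LIMSEQ_unique[OF fredholm_det_gram(1)[OF E rep] L(1)])
  have r2: "((\<lambda>F. section_det T F * section_det U F) \<longlongrightarrow> fredholm_det T * fredholm_det U) (finite_subsets_at_top E)"
    by (intro tendsto_mult fredholm_det_gram(2)[OF E rT E] fredholm_det_gram(2)[OF E rU E])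
  have r3: "\<forall>\<^sub>F F in finite_subsets_at_top E. section_det (W F) F = section_det T F * section_det U F"
  proof (rule eventually_finite_subsets_at_top_weakI)
    fix F assume F: "finite F" "F \<subseteq> E"
    have oF: "orthonormal F" using orthonormal_subset[OF oE F(2)] .
    have "cinner e (W F w) = cinner e (T (onb_proj F (U w)))" if w: "w \<in> F" and e: "e \<in> F" for w e
    proof -
      have Pw: "onb_proj F w = w"
      proof -
        have "onb_proj F w = (\<Sum>g\<in>F. if g = w then w else 0)"
          unfolding onb_proj_def by (intro sum.cong refl) (use oF w in \<open>auto simp: orthonormal_def\<close>)
        then show ?thesis using F w by (simp add: sum.delta')
      qed
      define P where "P = onb_proj F (U w)"
      have P: "P = w + onb_proj F (U w - w)"
        using linear_diff[OF bounded_linear.linear[OF bP], of F "U w" w] Pw by (simp add: P_def)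
      have AP: "A P = A w + A (onb_proj F (U w - w))"
        by (subst P) (rule linear_add[OF bounded_linear.linear[OF bA]])
      have eP: "cinner e P = cinner e (U w)"
        unfolding P_def using cinner_onb_proj[OF oF F(1) order_refl e] e by simp
      have Aw: "A w = T w - w" by (simp add: A_def)
      have "cinner e (T P) = cinner e P + cinner e (A P)"
        by (simp add: A_def cinner_diff_right)
      also have "\<dots> = cinner e (W F w)"
        unfolding eP AP by (simp add: W_def Aw cinner_add_right cinner_diff_right)
      finally show ?thesis by (simp only: P_def)
    qed
    note eq = this
    have "section_det (W F) F = section_det (\<lambda>w. T (onb_proj F (U w))) F"
      unfolding section_det_def
      by (intro sum.cong refl arg_cong2[where f = "(*)"] prod.cong eq) (simp_all add: permutes_in_image)
    then show "section_det (W F) F = section_det T F * section_det U F"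
      by (simp add: section_det_mult[OF F(1) T])
  qed
  show ?thesis
    using r1 tendsto_unique[OF finite_subsets_at_top_neq_bot Lim_transform_eventually[OF L(2) r3] r2] by simp
qed

text \<open>Conjugation by \<open>G\<close> replaces \<open>x n\<close> by \<open>G (x n)\<close>
  and \<open>y n\<close> by the image under the adjoint of the inverse, so all inner products
  \<open>\<langle>y\<^sub>i, x\<^sub>j\<rangle>\<close> stay the same.\<close>

lemma fredholm_det_conj:
  fixes T G H :: "'a::{complex_inner, banach} \<Rightarrow> 'a"
  assumes E: "orthonormal_basis (E :: 'a set)" and G: "bounded_clinear G" and H: "bounded_clinear H"
    and HG: "\<And>v. H (G v) = v" and GH: "\<And>v. G (H v) = v"
    and tT: "trace_class (\<lambda>v. T v - v)"
  shows "fredholm_det (\<lambda>v. G (T (H v))) = fredholm_det T"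
    and "trace_class (\<lambda>v. G (T (H v)) - v)"
proof -
  obtain x y where rT: "nuclear_rep (\<lambda>v. T v - v) y x" by (rule trace_class_nuclear_rep[OF tT])
  obtain H' where H': "\<And>x y. cinner y (H x) = cinner (H' y) x" "\<And>y. norm (H' y) \<le> onorm H * norm y"
    by (rule adjoint_exists[OF E H]) blast
  have "nuclear_rep (\<lambda>v. G (T (H v) - H v)) (\<lambda>n. H' (y n)) (\<lambda>n. G (x n))"
    using nuclear_rep_compose_left[OF nuclear_rep_compose_right[OF rT H'] G] .
  then have rep: "nuclear_rep (\<lambda>v. G (T (H v)) - v) (\<lambda>n. H' (y n)) (\<lambda>n. G (x n))"
    using G by (simp add: bounded_clinear_def linear_simps GH)
  then show "trace_class (\<lambda>v. G (T (H v)) - v)" by (rule nuclear_rep_imp_trace_class)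
  have "gram_det (\<lambda>n. H' (y n)) (\<lambda>n. G (x n)) = gram_det y x"
    by (simp add: gram_det_def fun_eq_iff H'(1)[symmetric] HG)
  then show "fredholm_det (\<lambda>v. G (T (H v))) = fredholm_det T"
    using fredholm_det_gram(1)[OF E rep] fredholm_det_gram(1)[OF E rT] by (simp add: LIMSEQ_unique)
qed

lemma fdet_2: "fdet 2 f = f 0 0 * f 1 1 - f 0 1 * f 1 0"
  unfolding fdet_def
  by (subst laplace_expansion_row[of _ 2 0])
    (auto simp: cofactor_def numeral_2_eq_2 lessThan_Suc mat_delete_def det_single)

text \<open>Extending the two vectors by zeros makes the sequence of Gram determinants constant
  from dimension two on.\<close>

lemma fredholm_det_rank_two:
  fixes T :: "'a::{complex_inner, banach} \<Rightarrow> 'a"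
  assumes E: "orthonormal_basis (E :: 'a set)"
    and T: "\<And>v. T v = v + cinner a v *\<^sub>C p + cinner b v *\<^sub>C q"
  shows "fredholm_det T = (1 + cinner a p) * (1 + cinner b q) - cinner a q * cinner b p"
proof -
  define y where "y = (\<lambda>n::nat. if n = 0 then a else if n = 1 then b else 0)"
  define x where "x = (\<lambda>n::nat. if n = 0 then p else if n = 1 then q else 0)"
  define c where "c = (\<lambda>n::nat. if n < 2 then (norm a)\<^sup>2 + (norm b)\<^sup>2 + (norm p)\<^sup>2 + (norm q)\<^sup>2 else 0)"
  have "summable c" by (rule summable_finite[of "{..<2}"]) (auto simp: c_def)
  moreover have "(\<lambda>n. cinner (y n) v *\<^sub>C x n) sums (T v - v)" for v
  proof -
    have "(\<lambda>n. cinner (y n) v *\<^sub>C x n) sums (\<Sum>n<2. cinner (y n) v *\<^sub>C x n)"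
      by (rule sums_finite) (auto simp: x_def scaleC_zero_right)
    then show ?thesis by (simp add: T x_def y_def numeral_2_eq_2)
  qed
  ultimately have rep: "nuclear_rep (\<lambda>v. T v - v) y x"
    unfolding nuclear_rep_def by (intro conjI exI[of _ c]) (auto simp: c_def x_def y_def)
  have g: "gram_det y x (n + 2) = gram_det y x 2" for n
  proof (induction n)
    case (Suc n)
    have "gram_det y x (Suc (n + 2)) = gram_det y x (n + 2)"
      unfolding gram_det_def by (rule fdet_last_unit_row) (auto simp: y_def)
    with Suc show ?case by (simp only: add_Suc)
  qed (simp only: add_0_left)
  have "(\<lambda>n. gram_det y x (n + 2)) \<longlonglongrightarrow> fredholm_det T"
    by (rule LIMSEQ_ignore_initial_segment[OF fredholm_det_gram(1)[OF E rep]])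
  then have "fredholm_det T = gram_det y x 2"
    unfolding g by (simp add: LIMSEQ_const_iff)
  then show ?thesis by (simp add: gram_det_def fdet_2 x_def y_def)
qed

section \<open>Square integrable functions on the circle\<close>

lemma L2_rel_refl_iff: "L2_rel f f \<longleftrightarrow> square_integrable f"
  by (auto simp: L2_rel_def)

lemma square_integrable_rep [simp]: "square_integrable (rep_circle_L2 f)"
  using Quotient_rep_reflp[OF Quotient_circle_L2] by (simp add: L2_rel_refl_iff)

lemma abs_rep_L2 [simp]: "abs_circle_L2 (rep_circle_L2 f) = f"
  by (rule Quotient_abs_rep[OF Quotient_circle_L2])

lemma rep_abs_L2:
  assumes "square_integrable f"
  shows "AE z in circle_measure. rep_circle_L2 (abs_circle_L2 f) z = f z"
  using Quotient_rep_abs[OF Quotient_circle_L2, of f] assms by (simp add: L2_rel_def)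

lemma abs_L2_eqI:
  assumes "square_integrable f" "square_integrable g" "AE z in circle_measure. f z = g z"
  shows "abs_circle_L2 f = abs_circle_L2 g"
  by (rule Quotient_rel_abs[OF Quotient_circle_L2]) (use assms in \<open>simp add: L2_rel_def\<close>)

lemma cinner_abs_L2:
  assumes "square_integrable f" "square_integrable g"
  shows "cinner (abs_circle_L2 f) (abs_circle_L2 g) = (LINT z|circle_measure. cnj (f z) * g z)"
  by (rule cinner_circle_L2.abs_eq) (use assms in \<open>simp_all add: L2_rel_refl_iff\<close>)

lemma add_abs_L2:
  assumes "square_integrable f" "square_integrable g"
  shows "abs_circle_L2 f + abs_circle_L2 g = abs_circle_L2 (\<lambda>z. f z + g z)"
  by (rule plus_circle_L2.abs_eq) (use assms in \<open>simp_all add: L2_rel_refl_iff\<close>)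

lemma scaleC_abs_L2:
  assumes "square_integrable f"
  shows "c *\<^sub>C abs_circle_L2 f = abs_circle_L2 (\<lambda>z. c * f z)"
  by (rule scaleC_circle_L2.abs_eq) (use assms in \<open>simp add: L2_rel_refl_iff\<close>)

lemma diff_abs_L2:
  assumes "square_integrable f" "square_integrable g"
  shows "abs_circle_L2 f - abs_circle_L2 g = abs_circle_L2 (\<lambda>z. f z - g z)"
  using assms add_abs_L2[OF assms(1) square_integrable_scale[OF assms(2), of "-1"]]
  by (simp add: minus_circle_L2_def uminus_circle_L2_def scaleC_abs_L2)

lemma square_integrable_diff:
  "square_integrable f \<Longrightarrow> square_integrable g \<Longrightarrow> square_integrable (\<lambda>z. f z - g z)"
  using square_integrable_add[OF _ square_integrable_scale[of g "-1"]] by simp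

lemma norm_abs_L2:
  assumes "square_integrable f"
  shows "(norm (abs_circle_L2 f))\<^sup>2 = (LINT z|circle_measure. (cmod (f z))\<^sup>2)"
proof -
  have "complex_of_real ((norm (abs_circle_L2 f))\<^sup>2) = (LINT z|circle_measure. cnj (f z) * f z)"
    using cinner_self[of "abs_circle_L2 f"] cinner_abs_L2[OF assms assms] by simp
  also have "\<dots> = (LINT z|circle_measure. complex_of_real ((cmod (f z))\<^sup>2))"
    by (intro Bochner_Integration.integral_cong) (simp_all only: complex_norm_square mult.commute)
  also have "\<dots> = of_real (LINT z|circle_measure. (cmod (f z))\<^sup>2)"
    by (rule integral_complex_of_real)
  finally show ?thesis unfolding of_real_eq_iff .
qed

lemma nn_integral_norm_L2:
  assumes "square_integrable f"
  shows "(\<integral>\<^sup>+ z. ennreal ((cmod (f z))\<^sup>2) \<partial>circle_measure) = ennreal ((norm (abs_circle_L2 f))\<^sup>2)"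
  unfolding norm_abs_L2[OF assms]
  by (rule nn_integral_eq_integral) (use assms in \<open>auto simp: square_integrable_def\<close>)

lemma square_integrable_cmod: "square_integrable f \<Longrightarrow> square_integrable (\<lambda>z. of_real (cmod (f z)))"
  by (auto simp: square_integrable_def)

lemma integral_const_circle: "(LINT z|circle_measure. c) = (c :: complex)"
  using emeasure_circle_measure by (simp add: measure_def)

text \<open>The total mass of the circle is one, so this is the Cauchy-Schwarz inequality against
  the constant function.\<close>

lemma L1_le_L2:
  assumes "square_integrable f"
  shows "integrable circle_measure f"
    "(LINT z|circle_measure. cmod (f z)) \<le> norm (abs_circle_L2 f)"
proof -
  have one: "square_integrable (\<lambda>z. 1)" by (rule square_integrable_const)
  show i: "integrable circle_measure f"
    using square_integrable_product[OF one assms] by simp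
  have n1: "(norm (abs_circle_L2 (\<lambda>z. 1)))\<^sup>2 = 1"
    unfolding norm_abs_L2[OF one] using emeasure_circle_measure by (simp add: measure_def)
  have n2: "norm (abs_circle_L2 (\<lambda>z. of_real (cmod (f z)))) = norm (abs_circle_L2 f)"
    by (rule power2_eq_imp_eq)
      (simp_all add: norm_abs_L2 square_integrable_cmod[OF assms] assms)
  have "complex_of_real (LINT z|circle_measure. cmod (f z)) =
      cinner (abs_circle_L2 (\<lambda>z. 1)) (abs_circle_L2 (\<lambda>z. of_real (cmod (f z))))"
    by (simp add: cinner_abs_L2 one square_integrable_cmod[OF assms])
  then have "cmod (complex_of_real (LINT z|circle_measure. cmod (f z))) \<le>
      norm (abs_circle_L2 (\<lambda>z. 1)) * norm (abs_circle_L2 (\<lambda>z. of_real (cmod (f z))))"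
    using cinner_Cauchy_Schwarz by metis
  moreover have "norm (abs_circle_L2 (\<lambda>z. 1)) = 1"
    by (rule power2_eq_imp_eq) (simp_all add: n1)
  ultimately show "(LINT z|circle_measure. cmod (f z)) \<le> norm (abs_circle_L2 f)"
    by (simp add: n2)
qed

lemma AE_summable_of_integrals:
  fixes d :: "nat \<Rightarrow> complex \<Rightarrow> real"
  assumes d: "\<And>k. integrable circle_measure (d k)" "\<And>k z. 0 \<le> d k z"
    and b: "\<And>k. (LINT z|circle_measure. d k z) \<le> b k" and sb: "summable b"
  shows "AE z in circle_measure. summable (\<lambda>k. d k z)"
proof -
  have [measurable]: "d k \<in> borel_measurable circle_measure" for k using d(1) by auto
  have b0: "0 \<le> b k" for k
    by (rule order_trans[OF Bochner_Integration.integral_nonneg b]) (simp add: d(2))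
  have "(\<integral>\<^sup>+ z. (\<Sum>k. ennreal (d k z)) \<partial>circle_measure) = (\<Sum>k. \<integral>\<^sup>+ z. ennreal (d k z) \<partial>circle_measure)"
    by (rule nn_integral_suminf) measurable
  also have "\<dots> = (\<Sum>k. ennreal (LINT z|circle_measure. d k z))"
    by (intro suminf_cong nn_integral_eq_integral) (auto simp: d)
  also have "\<dots> \<le> (\<Sum>k. ennreal (b k))"
    by (intro suminf_le ennreal_leI b) auto
  also have "\<dots> < \<infinity>"
    using suminf_ennreal2[OF b0 sb] by simp
  finally have "(\<integral>\<^sup>+ z. (\<Sum>k. ennreal (d k z)) \<partial>circle_measure) \<noteq> \<infinity>" by simp
  then have "AE z in circle_measure. (\<Sum>k. ennreal (d k z)) \<noteq> \<infinity>"
    by (intro nn_integral_PInf_AE) measurable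
  then show ?thesis
    by eventually_elim (auto intro: summable_suminf_not_top simp: d(2))
qed

text \<open>Riesz and Fischer: a sufficiently fast subsequence converges almost everywhere,
  because the integrals of its increments are summable; Fatou's lemma shows that the pointwise
  limit is also the limit in norm.\<close>

instance circle_L2 :: banach
proof
  fix F :: "nat \<Rightarrow> circle_L2"
  assume C: "Cauchy F"
  \<comment> \<open>The indices \<open>r k\<close> below pick a subsequence whose increments are at most \<open>(1/2) ^ k\<close>.\<close>
  have "\<exists>N. \<forall>m\<ge>N. \<forall>n\<ge>N. dist (F m) (F n) < (1/2) ^ k" for k
    using C[unfolded Cauchy_def, rule_format, of "(1/2) ^ k"] by simp
  then obtain N where N: "\<And>k m n. m \<ge> N k \<Longrightarrow> n \<ge> N k \<Longrightarrow> dist (F m) (F n) < (1/2) ^ k"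
    by metis
  define r where "r k = (\<Sum>i\<le>k. N i)" for k
  have rN: "N k \<le> r j" if "k \<le> j" for k j
    unfolding r_def using that by (intro member_le_sum) auto
  define g where "g k = rep_circle_L2 (F (r k))" for k
  have g: "square_integrable (g k)" "abs_circle_L2 (g k) = F (r k)" for k by (simp_all add: g_def)
  have [measurable]: "g k \<in> borel_measurable circle_measure" for k
    using g(1)[of k] by (simp add: square_integrable_def)
  have gg: "square_integrable (\<lambda>z. g j z - g k z)" for j k by (intro square_integrable_diff g)
  have ndist: "norm (abs_circle_L2 (\<lambda>z. g j z - g k z)) = dist (F (r j)) (F (r k))" for j k
    by (simp add: diff_abs_L2[symmetric] g dist_norm)
  define d where "d k z = cmod (g (Suc k) z - g k z)" for k z
  have "AE z in circle_measure. summable (\<lambda>k. d k z)"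
  proof (rule AE_summable_of_integrals)
    show "integrable circle_measure (d k)" for k
      unfolding d_def by (intro integrable_norm L1_le_L2 gg)
    show "(LINT z|circle_measure. d k z) \<le> (1/2) ^ k" for k
      unfolding d_def
      using L1_le_L2(2)[OF gg[of "Suc k" k]] N[OF rN[of k "Suc k"] rN[of k k]] unfolding ndist by simp
    show "summable (\<lambda>k. (1/2 :: real) ^ k)" by (rule summable_geometric) simp
  qed (simp add: d_def)
  then have conv: "AE z in circle_measure. convergent (\<lambda>k. g k z)"
  proof eventually_elim
    case (elim z)
    then have "summable (\<lambda>k. g (Suc k) z - g k z)"
      unfolding d_def by (rule summable_norm_cancel)
    from summable_LIMSEQ[OF this] have "(\<lambda>n. g n z - g 0 z) \<longlonglongrightarrow> (\<Sum>k. g (Suc k) z - g k z)"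
      by (simp only: sum_lessThan_telescope[of "\<lambda>n. g n z"])
    from tendsto_add[OF this tendsto_const[of "g 0 z"]] show ?case
      by (auto simp: convergent_def)
  qed
  define G where "G z = lim (\<lambda>k. g k z)" for z
  have [measurable]: "G \<in> borel_measurable circle_measure"
    unfolding G_def by measurable
  have bound: "(\<integral>\<^sup>+ z. ennreal ((cmod (G z - g k z))\<^sup>2) \<partial>circle_measure) \<le> ennreal (((1/2) ^ k)\<^sup>2)" for k
  proof -
    have "(\<integral>\<^sup>+ z. ennreal ((cmod (G z - g k z))\<^sup>2) \<partial>circle_measure) =
        (\<integral>\<^sup>+ z. liminf (\<lambda>j. ennreal ((cmod (g j z - g k z))\<^sup>2)) \<partial>circle_measure)"
    proof (rule nn_integral_cong_AE)
      show "AE z in circle_measure. ennreal ((cmod (G z - g k z))\<^sup>2) = liminf (\<lambda>j. ennreal ((cmod (g j z - g k z))\<^sup>2))"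
        using conv
      proof eventually_elim
        case (elim z)
        then have "(\<lambda>j. g j z) \<longlonglongrightarrow> G z" unfolding G_def by (simp add: convergent_LIMSEQ_iff)
        then have "(\<lambda>j. ennreal ((cmod (g j z - g k z))\<^sup>2)) \<longlonglongrightarrow> ennreal ((cmod (G z - g k z))\<^sup>2)"
          by (intro tendsto_intros)
        then show ?case by (intro lim_imp_Liminf[symmetric]) auto
      qed
    qed
    also have "\<dots> \<le> liminf (\<lambda>j. \<integral>\<^sup>+ z. ennreal ((cmod (g j z - g k z))\<^sup>2) \<partial>circle_measure)"
      by (rule nn_integral_liminf) measurable
    also have "\<dots> \<le> limsup (\<lambda>j. \<integral>\<^sup>+ z. ennreal ((cmod (g j z - g k z))\<^sup>2) \<partial>circle_measure)"
      by (intro Liminf_le_Limsup) auto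
    also have "\<dots> \<le> ennreal (((1/2) ^ k)\<^sup>2)"
    proof (rule Limsup_bounded)
      show "\<forall>\<^sub>F j in sequentially. (\<integral>\<^sup>+ z. ennreal ((cmod (g j z - g k z))\<^sup>2) \<partial>circle_measure) \<le> ennreal (((1/2) ^ k)\<^sup>2)"
        using eventually_ge_at_top[of k]
      proof eventually_elim
        case (elim j)
        then show ?case
          unfolding nn_integral_norm_L2[OF gg] ndist
          using N[OF rN[OF elim] rN[of k k]] by (intro ennreal_leI power_mono) auto
      qed
    qed
    finally show ?thesis .
  qed
  have Gg: "square_integrable (\<lambda>z. G z - g k z)" for k
    unfolding square_integrable_def
  proof
    show "integrable circle_measure (\<lambda>z. (cmod (G z - g k z))\<^sup>2)"
      using bound[of k] by (intro integrableI_bounded) (auto simp: less_top[symmetric] top_unique intro: le_less_trans)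
  qed measurable
  have Gs: "square_integrable G"
    using square_integrable_add[OF Gg[of 0] g(1)[of 0]] by simp
  have dl: "dist (F (r k)) (abs_circle_L2 G) \<le> (1/2) ^ k" for k
  proof -
    have "ennreal ((norm (abs_circle_L2 (\<lambda>z. G z - g k z)))\<^sup>2) \<le> ennreal (((1/2) ^ k)\<^sup>2)"
      using bound[of k] by (simp add: nn_integral_norm_L2[OF Gg])
    then have "(norm (abs_circle_L2 (\<lambda>z. G z - g k z)))\<^sup>2 \<le> ((1/2) ^ k)\<^sup>2"
      by (subst (asm) ennreal_le_iff) auto
    then have "norm (abs_circle_L2 (\<lambda>z. G z - g k z)) \<le> (1/2) ^ k"
      by (rule power2_le_imp_le) simp
    then show ?thesis
      by (simp add: diff_abs_L2[symmetric] Gs g dist_norm norm_minus_commute)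
  qed
  have "F \<longlonglongrightarrow> abs_circle_L2 G"
  proof (rule metric_LIMSEQ_I)
    fix e :: real assume e: "0 < e"
    obtain k where k: "(1/2) ^ k < e / 2"
      using real_arch_pow_inv[of "e / 2" "1/2"] e by auto
    have "dist (F n) (abs_circle_L2 G) < e" if "n \<ge> N k" for n
      using dist_triangle[of "F n" "abs_circle_L2 G" "F (r k)"] N[OF that rN[of k k]] dl[of k] k by simp
    then show "\<exists>no. \<forall>n\<ge>no. dist (F n) (abs_circle_L2 G) < e" by blast
  qed
  then show "convergent F" by (auto simp: convergent_def)
qed

lemma tendsto_fourier_coeff: "(f \<longlongrightarrow> l) F \<Longrightarrow> ((\<lambda>a. fourier_coeff (f a) k) \<longlongrightarrow> fourier_coeff l k) F"
  unfolding fourier_coeff_def by (intro tendsto_cinner tendsto_const)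

text \<open>Vanishing of the Fourier coefficients with negative index is a closed
  condition.\<close>

instance hardy :: banach
proof
  fix F :: "nat \<Rightarrow> hardy"
  assume C: "Cauchy F"
  have dist: "dist x y = dist (Rep_hardy x) (Rep_hardy y)" for x y
    by (simp add: dist_norm norm_hardy.rep_eq minus_hardy.rep_eq)
  have "Cauchy (\<lambda>n. Rep_hardy (F n))" using C by (simp add: Cauchy_def dist)
  then obtain l where l: "(\<lambda>n. Rep_hardy (F n)) \<longlonglongrightarrow> l" by (auto simp: Cauchy_convergent_iff convergent_def)
  have "fourier_coeff l k = 0" if "k < 0" for k
  proof -
    have "(\<lambda>n. fourier_coeff (Rep_hardy (F n)) k) \<longlonglongrightarrow> fourier_coeff l k"
      by (rule tendsto_fourier_coeff[OF l])
    moreover have "fourier_coeff (Rep_hardy (F n)) k = 0" for n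
      using Rep_hardy[of "F n"] that by simp
    ultimately show ?thesis by (simp add: LIMSEQ_const_iff)
  qed
  then have "Rep_hardy (Abs_hardy l) = l" by (intro Abs_hardy_inverse) simp
  with l have "F \<longlonglongrightarrow> Abs_hardy l" by (simp add: tendsto_iff dist)
  then show "convergent F" by (auto simp: convergent_def)
qed

section \<open>Completeness of the trigonometric system\<close>

lemma measurable_circle_continuous:
  assumes "continuous_on circle f"
  shows "f \<in> borel_measurable circle_measure"
  by (subst measurable_cong_sets[OF sets_circle_measure refl])
    (rule borel_measurable_continuous_on_restrict[OF assms])

lemma AE_circleI: "(\<And>z. z \<in> circle \<Longrightarrow> P z) \<Longrightarrow> AE z in circle_measure. P z"
  by (rule AE_I2) simp

lemma continuous_bounded_circle:
  fixes q :: "complex \<Rightarrow> complex"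
  assumes "continuous_on circle q"
  obtains B where "\<And>z. z \<in> circle \<Longrightarrow> cmod (q z) \<le> B" "B > 0"
proof -
  have "bounded (q ` circle)"
    by (intro compact_imp_bounded compact_continuous_image assms) simp
  then obtain B where "B > 0" "\<forall>z\<in>circle. cmod (q z) \<le> B" by (auto simp: bounded_pos)
  then show thesis using that by blast
qed

lemma integrable_circle_mult:
  assumes q: "continuous_on circle q" and f: "integrable circle_measure f"
  shows "integrable circle_measure (\<lambda>z. q z * f z :: complex)"
proof -
  obtain B where B: "\<And>z. z \<in> circle \<Longrightarrow> cmod (q z) \<le> B" "B > 0"
    by (rule continuous_bounded_circle[OF q]) blast
  note [measurable] = measurable_circle_continuous[OF q] borel_measurable_integrable[OF f]
  show ?thesis
  proof (rule Bochner_Integration.integrable_bound)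
    show "integrable circle_measure (\<lambda>z. of_real B * f z)" using f by simp
    show "AE z in circle_measure. norm (q z * f z) \<le> norm (of_real B * f z)"
      using B by (intro AE_circleI) (auto simp: norm_mult intro!: mult_right_mono)
  qed measurable
qed

lemma square_integrable_mult:
  assumes q: "continuous_on circle q" and f: "square_integrable f"
  shows "square_integrable (\<lambda>z. q z * f z)"
proof -
  obtain B where B: "\<And>z. z \<in> circle \<Longrightarrow> cmod (q z) \<le> B" "B > 0"
    by (rule continuous_bounded_circle[OF q]) blast
  have [measurable]: "f \<in> borel_measurable circle_measure" using f by (simp add: square_integrable_def)
  note [measurable] = measurable_circle_continuous[OF q]
  have "integrable circle_measure (\<lambda>z. (cmod (q z * f z))\<^sup>2)"
  proof (rule Bochner_Integration.integrable_bound)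
    show "integrable circle_measure (\<lambda>z. B\<^sup>2 * (cmod (f z))\<^sup>2)"
      using f by (simp add: square_integrable_def)
    show "AE z in circle_measure. norm ((cmod (q z * f z))\<^sup>2) \<le> norm (B\<^sup>2 * (cmod (f z))\<^sup>2)"
      using B by (intro AE_circleI) (auto simp: norm_mult power_mult_distrib intro!: mult_right_mono power_mono)
  qed measurable
  then show ?thesis by (simp add: square_integrable_def)
qed

lemma continuous_on_powi_circle: "continuous_on circle (\<lambda>z::complex. z powi k)"
  by (intro continuous_intros) auto

lemma cnj_circle: "z \<in> circle \<Longrightarrow> cnj z = inverse z"
  using complex_norm_square[of z] by (intro inverse_unique[symmetric]) simp

text \<open>The real coordinates of a point \<open>z\<close> of the circle are combinations of
  \<open>z\<close> and \<open>1/z\<close>, so orthogonality to all powers of \<open>z\<close>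
  persists under multiplication by real polynomials. The factor \<open>q\<close> makes the
  induction go through products.\<close>

lemma real_polynomial_times_orthogonal:
  assumes f: "integrable circle_measure f" and p: "real_polynomial_function p"
  shows "continuous_on circle q \<Longrightarrow> (\<And>k. (LINT z|circle_measure. z powi k * (q z * f z)) = 0) \<Longrightarrow>
    continuous_on circle (\<lambda>z. of_real (p z) * q z) \<and>
    (\<forall>k. (LINT z|circle_measure. z powi k * (of_real (p z) * q z * f z)) = 0)"
  using p
proof (induction arbitrary: q rule: real_polynomial_function.induct)
  case (linear l)
  have int: "integrable circle_measure (\<lambda>z. z powi k * (q z * f z))" for k
    by (intro integrable_circle_mult continuous_on_powi_circle linear f)
  \<comment> \<open>On the circle a real linear form is \<open>a * z + cnj a / z\<close> for this \<open>a\<close>.\<close>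
  define a where "a = Complex (l 1 / 2) (- l \<i> / 2)"
  have l: "complex_of_real (l z) = a * z powi 1 + cnj a * z powi (-1)" if "z \<in> circle" for z
  proof -
    have "l z = Re z * l 1 + Im z * l \<i>"
    proof -
      have "z = scaleR (Re z) 1 + scaleR (Im z) \<i>" by (simp add: complex_eq_iff)
      then have "l z = l (scaleR (Re z) 1 + scaleR (Im z) \<i>)" by simp
      also have "\<dots> = Re z * l 1 + Im z * l \<i>"
        using linear(1) by (simp add: linear_simps)
      finally show ?thesis .
    qed
    moreover have "inverse z = cnj z" using that by (simp add: cnj_circle)
    ultimately show ?thesis by (simp add: complex_eq_iff a_def power_int_minus algebra_simps)
  qed
  have "(LINT z|circle_measure. z powi k * (of_real (l z) * q z * f z)) = 0" for k
  proof -
    have "(LINT z|circle_measure. z powi k * (of_real (l z) * q z * f z)) =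
      (LINT z|circle_measure. a * (z powi (k + 1) * (q z * f z)) + cnj a * (z powi (k - 1) * (q z * f z)))"
    proof (rule Bochner_Integration.integral_cong)
      fix z assume "z \<in> space circle_measure"
      then have z: "z \<in> circle" "z \<noteq> 0" by auto
      show "z powi k * (of_real (l z) * q z * f z) =
        a * (z powi (k + 1) * (q z * f z)) + cnj a * (z powi (k - 1) * (q z * f z))"
        unfolding l[OF z(1)] using z(2) by (simp add: power_int_add power_int_diff power_int_minus field_simps)
    qed simp
    also have "\<dots> = 0" using linear(3) int by simp
    finally show ?thesis .
  qed
  then show ?case
    using continuous_on_mult[OF continuous_on_of_real[OF linear_continuous_on[OF linear(1)]] linear(2)] by blast
next
  case (const c)
  have "(LINT z|circle_measure. z powi k * (of_real c * q z * f z)) = of_real c * (LINT z|circle_measure. z powi k * (q z * f z))" for k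
    by (subst integral_mult_right_zero[symmetric]) (simp add: mult_ac)
  then show ?case using const by (auto intro!: continuous_intros)
next
  case (add p1 p2)
  have 1: "continuous_on circle (\<lambda>z. of_real (p1 z) * q z)" "\<And>k. (LINT z|circle_measure. z powi k * (of_real (p1 z) * q z * f z)) = 0"
    using add.IH(1)[OF add.prems] by auto
  have 2: "continuous_on circle (\<lambda>z. of_real (p2 z) * q z)" "\<And>k. (LINT z|circle_measure. z powi k * (of_real (p2 z) * q z * f z)) = 0"
    using add.IH(2)[OF add.prems] by auto
  have "(LINT z|circle_measure. z powi k * (of_real (p1 z + p2 z) * q z * f z)) = 0" for k
  proof -
    have "(LINT z|circle_measure. z powi k * (of_real (p1 z + p2 z) * q z * f z)) =
      (LINT z|circle_measure. z powi k * (of_real (p1 z) * q z * f z) + z powi k * (of_real (p2 z) * q z * f z))"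
      by (intro Bochner_Integration.integral_cong) (simp_all add: algebra_simps)
    also have "\<dots> = 0"
      using 1 2 f by (simp add: integrable_circle_mult continuous_on_powi_circle)
    finally show ?thesis .
  qed
  then show ?case
    using continuous_on_add[OF 1(1) 2(1)] by (simp add: algebra_simps)
next
  case (mult p1 p2)
  have "continuous_on circle (\<lambda>z. of_real (p2 z) * q z) \<and> (\<forall>k. (LINT z|circle_measure. z powi k * (of_real (p2 z) * q z * f z)) = 0)"
    by (rule mult.IH(2)[OF mult.prems])
  then have "continuous_on circle (\<lambda>z. of_real (p1 z) * (of_real (p2 z) * q z)) \<and>
      (\<forall>k. (LINT z|circle_measure. z powi k * (of_real (p1 z) * (of_real (p2 z) * q z) * f z)) = 0)"
    by (intro mult.IH(1)) auto
  then show ?case by (simp add: mult.assoc)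
qed

text \<open>Orthogonality extends from the powers of \<open>z\<close> to real polynomials, by the
  Stone-Weierstrass theorem to continuous functions, by dominated convergence to indicators of
  closed sets, and by Dynkin's lemma to indicators of Borel sets.\<close>

lemma fourier_uniqueness_L1:
  assumes f: "integrable circle_measure f" and 0: "\<And>k. (LINT z|circle_measure. z powi k * f z) = 0"
  shows "AE z in circle_measure. f z = (0 :: complex)"
proof -
  note [measurable] = borel_measurable_integrable[OF f]
  have poly: "(LINT z|circle_measure. of_real (p z) * f z) = 0" if p: "real_polynomial_function p" for p
    using real_polynomial_times_orthogonal[OF f p, of "\<lambda>_. 1"] 0 by (auto dest!: spec[of _ 0])
  have cont: "(LINT z|circle_measure. of_real (g z) * f z) = 0"
    if g: "continuous_on circle g" for g :: "complex \<Rightarrow> real"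
  proof -
    define M where "M = (LINT z|circle_measure. cmod (f z))"
    have M0: "0 \<le> M" unfolding M_def by simp
    have "cmod (LINT z|circle_measure. of_real (g z) * f z) \<le> e * M" if e: "e > 0" for e
    proof -
      obtain p where p: "real_polynomial_function p" "\<And>z. z \<in> circle \<Longrightarrow> \<bar>g z - p z\<bar> < e"
        using Stone_Weierstrass_real_polynomial_function[OF _ g e] by auto
      have cp: "continuous_on circle p"
        using p(1) by (simp add: continuous_on_polymonial_function real_polynomial_function_eq)
      have ig: "integrable circle_measure (\<lambda>z. of_real (g z) * f z)" "integrable circle_measure (\<lambda>z. of_real (p z) * f z)"
        by (intro integrable_circle_mult f continuous_intros g cp)+
      have id: "integrable circle_measure (\<lambda>z. (of_real (g z) - of_real (p z)) * f z)"
        by (intro integrable_circle_mult f continuous_intros g cp)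
      have "(LINT z|circle_measure. of_real (g z) * f z) = (LINT z|circle_measure. of_real (g z) * f z) - (LINT z|circle_measure. of_real (p z) * f z)"
        by (simp add: poly[OF p(1)])
      also have "\<dots> = (LINT z|circle_measure. (of_real (g z) - of_real (p z)) * f z)"
        using ig by (simp add: left_diff_distrib)
      also have "cmod \<dots> \<le> (LINT z|circle_measure. cmod ((of_real (g z) - of_real (p z)) * f z))"
        by (rule integral_norm_bound)
      also have "\<dots> \<le> (LINT z|circle_measure. e * cmod (f z))"
      proof (rule integral_mono_AE)
        show "AE z in circle_measure. cmod ((of_real (g z) - of_real (p z)) * f z) \<le> e * cmod (f z)"
          using less_imp_le[OF p(2)] by (intro AE_circleI) (auto simp: norm_mult simp flip: of_real_diff intro!: mult_right_mono)
      qed (use id f in auto)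
      also have "\<dots> = e * M" by (simp add: M_def)
      finally show ?thesis .
    qed
    note le = this
    have "cmod (LINT z|circle_measure. of_real (g z) * f z) \<le> 0"
    proof (rule field_le_epsilon)
      fix e :: real assume e: "0 < e"
      \<comment> \<open>The summand \<open>1\<close> is there because \<open>M\<close> may vanish.\<close>
      have "cmod (LINT z|circle_measure. of_real (g z) * f z) \<le> e / (M + 1) * M"
        using M0 e by (intro le) simp
      also have "\<dots> \<le> e" using M0 e by (simp add: field_simps)
      finally show "cmod (LINT z|circle_measure. of_real (g z) * f z) \<le> 0 + e" by simp
    qed
    then show ?thesis by simp
  qed
  have clo: "(LINT z|circle_measure. indicat_real C z *\<^sub>R f z) = 0" if C: "closed C" for C
  proof (cases "C = {}")
    case False
    \<comment> \<open>Continuous functions decreasing to the indicator of the closed set.\<close>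
    define g where "g n z = max 0 (1 - real n * infdist z C)" for n and z :: complex
    have cg: "continuous_on circle (g n)" for n
      unfolding g_def by (intro continuous_intros continuous_on_infdist)
    have "(\<lambda>n. LINT z|circle_measure. of_real (g n z) * f z) \<longlonglongrightarrow> (LINT z|circle_measure. indicat_real C z *\<^sub>R f z)"
    proof (rule integral_dominated_convergence)
      show "integrable circle_measure (\<lambda>z. cmod (f z))" using f by simp
      show "(\<lambda>z. indicat_real C z *\<^sub>R f z) \<in> borel_measurable circle_measure"
      proof -
        have "indicat_real C \<in> borel_measurable circle_measure"
          by (subst measurable_cong_sets[OF sets_circle_measure refl])
            (intro measurable_restrict_space1 borel_measurable_indicator borel_closed C)
        then show ?thesis by measurable
      qed
      show "(\<lambda>z. of_real (g n z) * f z) \<in> borel_measurable circle_measure" for n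
        by (intro borel_measurable_integrable integrable_circle_mult f continuous_intros cg)
      show "AE z in circle_measure. (\<lambda>n. of_real (g n z) * f z) \<longlonglongrightarrow> indicat_real C z *\<^sub>R f z"
      proof (rule AE_I2)
        fix z
        have "(\<lambda>n. g n z) \<longlonglongrightarrow> indicat_real C z"
        proof (cases "z \<in> C")
          case True
          then show ?thesis by (simp add: g_def)
        next
          case out: False
          have pos: "infdist z C > 0"
            using C False out by (simp add: infdist_pos_not_in_closed)
          obtain m where m: "1 < real m * infdist z C"
            using reals_Archimedean3[OF pos] by blast
          have "\<forall>\<^sub>F n in sequentially. g n z = indicat_real C z"
            using eventually_ge_at_top[of m]
          proof eventually_elim
            case (elim n)
            then have "real m * infdist z C \<le> real n * infdist z C" using pos by (intro mult_right_mono) auto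
            with m out show ?case by (simp add: g_def)
          qed
          then show ?thesis by (rule tendsto_eventually)
        qed
        then show "(\<lambda>n. of_real (g n z) * f z) \<longlonglongrightarrow> indicat_real C z *\<^sub>R f z"
          unfolding scaleR_conv_of_real by (intro tendsto_intros)
      qed
      show "AE z in circle_measure. norm (of_real (g n z) * f z) \<le> cmod (f z)" for n
      proof (rule AE_I2)
        fix z
        have "\<bar>g n z\<bar> \<le> 1" using infdist_nonneg[of z C] by (simp add: g_def)
        then have "\<bar>g n z\<bar> * cmod (f z) \<le> 1 * cmod (f z)" by (intro mult_right_mono) auto
        then show "norm (of_real (g n z) * f z) \<le> cmod (f z)" by (simp add: norm_mult)
      qed
    qed
    then show ?thesis by (simp add: cont[OF cg] LIMSEQ_const_iff)
  qed simp
  have ind: "integrable circle_measure (\<lambda>z. indicat_real A z *\<^sub>R f z)" if "A \<in> sets borel" for A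
  proof -
    have "indicat_real A \<in> borel_measurable circle_measure"
      by (subst measurable_cong_sets[OF sets_circle_measure refl])
        (intro measurable_restrict_space1 borel_measurable_indicator that)
    then have m: "(\<lambda>z. indicat_real A z *\<^sub>R f z) \<in> borel_measurable circle_measure"
      by measurable
    show ?thesis
      by (rule Bochner_Integration.integrable_bound[OF f m]) (auto simp: indicator_def)
  qed
  have bor: "(LINT z|circle_measure. indicat_real A z *\<^sub>R f z) = 0" if "A \<in> sets borel" for A
  proof -
    have "Int_stable (Collect closed :: complex set set)" by (auto simp: Int_stable_def)
    moreover have "Collect closed \<subseteq> Pow (UNIV :: complex set)" by simp
    moreover have "A \<in> sigma_sets UNIV (Collect closed)" using that by (simp add: borel_eq_closed)
    ultimately show ?thesis
    proof (induction rule: sigma_sets_induct_disjoint)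
      case (compl A)
      then have A: "A \<in> sets borel" by (simp add: borel_eq_closed)
      have "(LINT z|circle_measure. indicat_real (UNIV - A) z *\<^sub>R f z) = (LINT z|circle_measure. f z - indicat_real A z *\<^sub>R f z)"
        by (intro Bochner_Integration.integral_cong) (auto simp: indicator_def)
      also have "\<dots> = 0" using compl f ind[OF A] 0[of 0] by simp
      finally show ?case .
    next
      case (union A)
      have A: "A i \<in> sets borel" for i using union(2) by (auto simp: borel_eq_closed)
      have Ai: "(LINT z|circle_measure. indicat_real (A i \<inter> circle) z *\<^sub>R f z) = 0" for i
        using union(3)[of i]
        by (subst Bochner_Integration.integral_cong[of _ circle_measure _ "\<lambda>z. indicat_real (A i) z *\<^sub>R f z"]) (auto simp: indicator_def)
      have s: "A i \<inter> circle \<in> sets circle_measure" for i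
        unfolding sets_circle_measure using A[of i] by (auto simp: sets_restrict_space)
      have U: "(\<Union>i. A i) \<in> sets borel" using A by auto
      have "(LINT z|circle_measure. indicat_real (\<Union>i. A i) z *\<^sub>R f z) = (LINT z:(\<Union>i. A i \<inter> circle)|circle_measure. f z)"
        unfolding set_lebesgue_integral_def
        by (intro Bochner_Integration.integral_cong) (auto simp: indicator_def)
      also have "\<dots> = (\<Sum>i. (LINT z:(A i \<inter> circle)|circle_measure. f z))"
      proof (rule lebesgue_integral_countable_add)
        show "set_integrable circle_measure (\<Union>i. A i \<inter> circle) f"
        proof -
          have "integrable circle_measure (\<lambda>z. indicat_real (\<Union>i. A i \<inter> circle) z *\<^sub>R f z) =
              integrable circle_measure (\<lambda>z. indicat_real (\<Union>i. A i) z *\<^sub>R f z)"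
            by (rule Bochner_Integration.integrable_cong) (auto simp: indicator_def)
          then show ?thesis using ind[OF U] by (simp only: set_integrable_def)
        qed
      qed (use s union(1) in \<open>auto simp: disjoint_family_on_def\<close>)
      also have "\<dots> = 0" using Ai by (simp add: set_lebesgue_integral_def)
      finally show ?case .
    qed (auto simp: clo)
  qed
  interpret finite_measure circle_measure by (rule finite_measure_circle)
  show ?thesis
  proof (rule density_zero[OF f])
    fix A assume "A \<in> sets circle_measure"
    then obtain B where B: "B \<in> sets borel" "A = circle \<inter> B"
      unfolding sets_circle_measure sets_restrict_space by auto
    have "set_lebesgue_integral circle_measure A f = (LINT z|circle_measure. indicat_real B z *\<^sub>R f z)"
      unfolding set_lebesgue_integral_def
      by (intro Bochner_Integration.integral_cong) (auto simp: indicator_def B)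
    then show "set_lebesgue_integral circle_measure A f = 0" by (simp add: bor[OF B(1)])
  qed
qed

lemma cinner_ext: "(\<And>h. cinner h x = cinner h y) \<Longrightarrow> x = (y::'a::complex_inner)"
  using cinner_self[of "x - y"] by (simp add: cinner_diff_right)

lemma square_integrable_continuous:
  assumes "continuous_on circle q" shows "square_integrable q"
  using square_integrable_mult[OF assms square_integrable_const[of 1]] by simp

lemma L2_monom_eq: "L2_monom k = abs_circle_L2 (\<lambda>z. z powi k)"
  by (rule L2_monom.abs_eq)

lemma square_integrable_powi: "square_integrable (\<lambda>z. z powi k)"
  by (rule square_integrable_continuous[OF continuous_on_powi_circle])

lemma cnj_powi_circle: "z \<in> circle \<Longrightarrow> cnj (z powi k) = z powi (- k)"
  by (simp add: cnj_circle power_int_inverse power_int_minus)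

lemma fourier_coeff_eq: "fourier_coeff f k = (LINT z|circle_measure. z powi (- k) * rep_circle_L2 f z)"
proof -
  have "fourier_coeff f k = cinner (abs_circle_L2 (\<lambda>z. z powi k)) (abs_circle_L2 (rep_circle_L2 f))"
    by (simp add: fourier_coeff_def L2_monom_eq)
  also have "\<dots> = (LINT z|circle_measure. cnj (z powi k) * rep_circle_L2 f z)"
    by (rule cinner_abs_L2) (simp_all add: square_integrable_powi)
  also have "\<dots> = (LINT z|circle_measure. z powi (- k) * rep_circle_L2 f z)"
    by (rule Bochner_Integration.integral_cong) (simp_all add: cnj_powi_circle del: complex_cnj_power_int)
  finally show ?thesis .
qed

lemma fourier_uniqueness:
  assumes "\<And>k. fourier_coeff f k = 0"
  shows "f = 0"
proof -
  have "AE z in circle_measure. rep_circle_L2 f z = 0"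
  proof (rule fourier_uniqueness_L1)
    show "integrable circle_measure (rep_circle_L2 f)" by (rule L1_le_L2) simp
    show "(LINT z|circle_measure. z powi k * rep_circle_L2 f z) = 0" for k
      using assms[of "- k"] by (simp add: fourier_coeff_eq)
  qed
  then have "abs_circle_L2 (rep_circle_L2 f) = abs_circle_L2 (\<lambda>z. 0)"
    by (intro abs_L2_eqI) (simp_all add: square_integrable_const)
  then show ?thesis by (simp add: zero_circle_L2_def)
qed

lemma cinner_L2_monom: "cinner (L2_monom j) (L2_monom k) = (if j = k then 1 else 0)"
proof -
  have "cinner (L2_monom j) (L2_monom k) = (LINT z|circle_measure. cnj (z powi j) * z powi k)"
    unfolding L2_monom_eq by (rule cinner_abs_L2) (simp_all add: square_integrable_powi)
  also have "\<dots> = (LINT z|circle_measure. z powi (k - j))"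
  proof (rule Bochner_Integration.integral_cong)
    fix z assume "z \<in> space circle_measure"
    then have "z \<in> circle" "z \<noteq> 0" by auto
    then show "cnj (z powi j) * z powi k = z powi (k - j)"
      by (simp add: cnj_powi_circle power_int_diff power_int_minus field_simps del: complex_cnj_power_int)
  qed simp
  also have "\<dots> = (if j = k then 1 else 0)"
    using integral_powi_circle[of "k - j"] integral_const_circle[of 1] by simp
  finally show ?thesis .
qed

section \<open>Hardy space\<close>

definition hardy_monom :: "nat \<Rightarrow> hardy" where "hardy_monom n = Abs_hardy (L2_monom (int n))"

lemma Rep_hardy_monom: "Rep_hardy (hardy_monom n) = L2_monom (int n)"
  unfolding hardy_monom_def by (rule Abs_hardy_inverse) (auto simp: fourier_coeff_def cinner_L2_monom)

lemma cinner_hardy_monom: "cinner (hardy_monom n) f = fourier_coeff (Rep_hardy f) (int n)"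
  by (simp add: cinner_hardy.rep_eq Rep_hardy_monom fourier_coeff_def)

lemma hardy_eq_zeroI:
  assumes "\<And>n. cinner (hardy_monom n) f = 0" shows "f = 0"
proof -
  have "fourier_coeff (Rep_hardy f) k = 0" for k
  proof (cases "k < 0")
    case False
    then show ?thesis using assms[of "nat k"] by (simp add: cinner_hardy_monom)
  qed (use Rep_hardy[of f] in simp)
  then have "Rep_hardy f = 0" by (rule fourier_uniqueness)
  then show ?thesis by (simp add: Rep_hardy_inject[symmetric] zero_hardy.rep_eq)
qed

lemma cinner_hardy_monom_hardy_monom: "cinner (hardy_monom j) (hardy_monom k) = (if j = k then 1 else 0)"
  by (simp add: cinner_hardy_monom Rep_hardy_monom fourier_coeff_def cinner_L2_monom)

lemma orthonormal_basis_hardy: "orthonormal_basis (range hardy_monom)"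
  unfolding orthonormal_basis_def
proof (intro conjI allI impI ballI)
  fix e f assume "e \<in> range hardy_monom" "f \<in> range hardy_monom"
  then obtain j k where jk: "e = hardy_monom j" "f = hardy_monom k" by blast
  have "hardy_monom j = hardy_monom k \<longleftrightarrow> j = k"
    using cinner_hardy_monom_hardy_monom[of j k] cinner_hardy_monom_hardy_monom[of k k] by (auto split: if_splits)
  then show "cinner e f = (if e = f then 1 else 0)" by (simp add: jk cinner_hardy_monom_hardy_monom)
qed (auto intro: hardy_eq_zeroI)

lemma norm_Rep_hardy: "norm (Rep_hardy f) = norm f"
  by (simp add: norm_hardy.rep_eq)

text \<open>The Riesz representation theorem on the Hardy space produces the function that the
  definite description asks for.\<close>

lemma cinner_hardy_proj: "cinner h (hardy_proj f) = cinner (Rep_hardy h) f"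
proof -
  have b: "bounded_linear (\<lambda>h. cinner f (Rep_hardy h))"
  proof (rule bounded_linear_intro)
    show "norm (cinner f (Rep_hardy h)) \<le> norm h * norm f" for h
      using cinner_Cauchy_Schwarz[of f "Rep_hardy h"] by (simp add: norm_Rep_hardy mult.commute)
  qed (simp_all add: plus_hardy.rep_eq scaleR_hardy.rep_eq cinner_add_right cinner_scaleR_right scaleR_conv_of_real)
  obtain g where g: "\<And>h. cinner f (Rep_hardy h) = cinner g h"
    by (rule riesz_representation[OF orthonormal_basis_hardy b])
      (simp_all add: scaleC_hardy.rep_eq cinner_scaleC_right)
  have g': "cinner (Rep_hardy h) f = cinner h g" for h
    using g[of h] by (metis cinner_commute)
  have "hardy_proj f = g"
    unfolding hardy_proj_def
  proof (rule the_equality)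
    show "\<forall>h. cinner (Rep_hardy h) (f - Rep_hardy g) = 0"
      by (simp add: cinner_diff_right g' cinner_hardy.rep_eq)
    fix g2 assume "\<forall>h. cinner (Rep_hardy h) (f - Rep_hardy g2) = 0"
    then have "cinner h g2 = cinner h g" for h
      by (simp add: cinner_diff_right g' cinner_hardy.rep_eq)
    then show "g2 = g" by (rule cinner_ext)
  qed
  then show ?thesis by (simp add: g')
qed

section \<open>Multiplication operators\<close>

lemma L2_mult_abs:
  assumes q: "continuous_on circle q" and f: "square_integrable f"
  shows "L2_mult q (abs_circle_L2 f) = abs_circle_L2 (\<lambda>z. q z * f z)"
  unfolding L2_mult_def
proof (rule abs_L2_eqI)
  show "AE z in circle_measure. q z * rep_circle_L2 (abs_circle_L2 f) z = q z * f z"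
    using rep_abs_L2[OF f] by eventually_elim simp
qed (intro square_integrable_mult q f square_integrable_rep)+

lemma L2_mult_cong:
  assumes "\<And>z. z \<in> circle \<Longrightarrow> q z = r z" "continuous_on circle q" "continuous_on circle r"
  shows "L2_mult q f = L2_mult r f"
  unfolding L2_mult_def
  by (intro abs_L2_eqI square_integrable_mult assms square_integrable_rep AE_circleI) (simp add: assms(1))

lemma L2_mult_mult:
  assumes "continuous_on circle q" "continuous_on circle r"
  shows "L2_mult q (L2_mult r f) = L2_mult (\<lambda>z. q z * r z) f"
  unfolding L2_mult_def[of r] using assms
  by (simp add: L2_mult_abs square_integrable_mult) (simp add: L2_mult_def mult.assoc)

lemma L2_mult_add_symbol:
  assumes "continuous_on circle q" "continuous_on circle r"
  shows "L2_mult (\<lambda>z. q z + r z) f = L2_mult q f + L2_mult r f"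
  unfolding L2_mult_def using assms
  by (subst add_abs_L2) (auto intro: square_integrable_mult simp: distrib_right)

lemma L2_mult_const: "L2_mult (\<lambda>z. c) f = c *\<^sub>C f"
  unfolding L2_mult_def by (subst scaleC_abs_L2[symmetric]) simp_all

lemma L2_mult_add:
  assumes "continuous_on circle q"
  shows "L2_mult q (f + g) = L2_mult q f + L2_mult q g"
proof -
  have "L2_mult q (abs_circle_L2 (\<lambda>z. rep_circle_L2 f z + rep_circle_L2 g z)) = L2_mult q f + L2_mult q g"
    by (simp only: L2_mult_abs[OF assms square_integrable_add[OF square_integrable_rep square_integrable_rep]])
      (simp add: L2_mult_def add_abs_L2 square_integrable_mult assms distrib_left)
  then show ?thesis
    by (simp add: add_abs_L2[symmetric])
qed

lemma cinner_L2_mult: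
  assumes "continuous_on circle q"
  shows "cinner f (L2_mult q g) = cinner (L2_mult (\<lambda>z. cnj (q z)) f) g"
proof -
  have c: "continuous_on circle (\<lambda>z. cnj (q z))" by (intro continuous_intros assms)
  have "cinner f (L2_mult q g) = cinner (abs_circle_L2 (rep_circle_L2 f)) (L2_mult q g)" by simp
  also have "\<dots> = (LINT z|circle_measure. cnj (rep_circle_L2 f z) * (q z * rep_circle_L2 g z))"
    unfolding L2_mult_def by (rule cinner_abs_L2) (simp_all add: square_integrable_mult assms)
  also have "\<dots> = (LINT z|circle_measure. cnj (cnj (q z) * rep_circle_L2 f z) * rep_circle_L2 g z)"
    by (simp add: mult_ac)
  also have "\<dots> = cinner (L2_mult (\<lambda>z. cnj (q z)) f) (abs_circle_L2 (rep_circle_L2 g))"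
    unfolding L2_mult_def by (rule cinner_abs_L2[symmetric]) (simp_all add: square_integrable_mult c)
  finally show ?thesis by simp
qed

lemma norm_L2_mult:
  assumes q: "continuous_on circle q" and B: "\<And>z. z \<in> circle \<Longrightarrow> cmod (q z) \<le> B" "0 \<le> B"
  shows "norm (L2_mult q f) \<le> B * norm f"
proof -
  have "(norm (L2_mult q f))\<^sup>2 = (LINT z|circle_measure. (cmod (q z * rep_circle_L2 f z))\<^sup>2)"
    unfolding L2_mult_def by (rule norm_abs_L2) (simp add: square_integrable_mult q)
  also have "\<dots> \<le> (LINT z|circle_measure. B\<^sup>2 * (cmod (rep_circle_L2 f z))\<^sup>2)"
  proof (rule integral_mono_AE)
    show "integrable circle_measure (\<lambda>z. (cmod (q z * rep_circle_L2 f z))\<^sup>2)"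
      using square_integrable_mult[OF q square_integrable_rep[of f]] by (simp add: square_integrable_def)
    show "integrable circle_measure (\<lambda>z. B\<^sup>2 * (cmod (rep_circle_L2 f z))\<^sup>2)"
      using square_integrable_rep[of f] by (simp add: square_integrable_def)
    show "AE z in circle_measure. (cmod (q z * rep_circle_L2 f z))\<^sup>2 \<le> B\<^sup>2 * (cmod (rep_circle_L2 f z))\<^sup>2"
      using B by (intro AE_circleI) (auto simp: norm_mult power_mult_distrib intro!: mult_right_mono power_mono)
  qed
  also have "\<dots> = B\<^sup>2 * (norm (abs_circle_L2 (rep_circle_L2 f)))\<^sup>2"
    by (subst norm_abs_L2) simp_all
  finally have "(norm (L2_mult q f))\<^sup>2 \<le> (B * norm f)\<^sup>2" by (simp add: power_mult_distrib)
  then show ?thesis by (rule power2_le_imp_le) (simp add: B)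
qed

section \<open>Toeplitz operators\<close>

lemma bounded_clinear_op [simp]: "bounded_clinear (op_apply A)"
  using op_apply[of A] by simp

lemma op_apply_add [simp]: "op_apply A (x + y) = op_apply A x + op_apply A y"
  using bounded_clinear_add[OF bounded_clinear_op] .

lemma op_apply_scaleC [simp]: "op_apply A (c *\<^sub>C x) = c *\<^sub>C op_apply A x"
  using bounded_clinear_scaleC[OF bounded_clinear_op] .

lemma op_apply_zero_right [simp]: "op_apply A 0 = 0"
  using op_apply_scaleC[of A 0 0] by (simp del: op_apply_scaleC)

lemma op_apply_diff: "op_apply A (x - y) = op_apply A x - op_apply A y"
  using op_apply_add[of A "x - y" y] by (simp del: op_apply_add add: algebra_simps)

lemma op_apply_sum: "op_apply A (sum f I) = (\<Sum>i\<in>I. op_apply A (f i))"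
  by (induction I rule: infinite_finite_induct) auto

lemmas op_apply_simps = plus_hardy_op.rep_eq minus_hardy_op.rep_eq times_hardy_op.rep_eq
  one_hardy_op.rep_eq zero_hardy_op.rep_eq uminus_hardy_op.rep_eq

text \<open>All later statements about Toeplitz operators go through this weak form, which avoids
  the projection and the boundedness side conditions of the definition.\<close>

lemma cinner_toeplitz:
  assumes q: "continuous_on circle q"
  shows "cinner h (op_apply (toeplitz q) f) = cinner (Rep_hardy h) (L2_mult q (Rep_hardy f))"
proof -
  let ?T = "\<lambda>f. hardy_proj (L2_mult q (Rep_hardy f))"
  obtain B where B: "\<And>z. z \<in> circle \<Longrightarrow> cmod (q z) \<le> B" "B > 0"
    by (rule continuous_bounded_circle[OF q]) blast
  have scale: "?T (c *\<^sub>C f) = c *\<^sub>C ?T f" for c f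
  proof (rule cinner_ext)
    fix h
    have "L2_mult q (c *\<^sub>C Rep_hardy f) = c *\<^sub>C L2_mult q (Rep_hardy f)"
      unfolding L2_mult_const[symmetric] by (simp add: L2_mult_mult q mult.commute)
    then show "cinner h (?T (c *\<^sub>C f)) = cinner h (c *\<^sub>C ?T f)"
      by (simp add: cinner_hardy_proj scaleC_hardy.rep_eq cinner_scaleC_right)
  qed
  have "bounded_linear ?T"
  proof (rule bounded_linear_intro)
    show "?T (f + g) = ?T f + ?T g" for f g
      by (rule cinner_ext) (simp add: cinner_hardy_proj cinner_add_right plus_hardy.rep_eq L2_mult_add q)
    show "?T (r *\<^sub>R f) = r *\<^sub>R ?T f" for r f
      using scale[of "of_real r" f] by (simp add: scaleC_of_real)
    show "norm (?T f) \<le> norm f * B" for f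
    proof -
      have "(norm (?T f))\<^sup>2 = cmod (cinner (?T f) (?T f))"
        unfolding cinner_self norm_of_real by simp
      also have "\<dots> = cmod (cinner (Rep_hardy (?T f)) (L2_mult q (Rep_hardy f)))"
        by (subst cinner_hardy_proj) simp
      also have "\<dots> \<le> norm (?T f) * norm (L2_mult q (Rep_hardy f))"
        using cinner_Cauchy_Schwarz[of "Rep_hardy (?T f)"] by (simp only: norm_Rep_hardy)
      also have "\<dots> \<le> norm (?T f) * (B * norm f)"
        using norm_L2_mult[OF q B(1), of "Rep_hardy f"] B(2) by (intro mult_left_mono) (auto simp: norm_Rep_hardy)
      finally show ?thesis
        by (cases "norm (?T f) = 0") (use B in \<open>auto simp: power2_eq_square mult.commute\<close>)
    qed
  qed
  with scale have "bounded_clinear ?T" by (simp add: bounded_clinear_def)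
  then have "op_apply (toeplitz q) = ?T" by (simp add: toeplitz_def Hardy_op_inverse)
  then show ?thesis by (simp add: cinner_hardy_proj)
qed

lemma hardy_op_ext: "(\<And>h f. cinner h (op_apply A f) = cinner h (op_apply B f)) \<Longrightarrow> A = B"
  by (metis cinner_ext ext op_apply_inject)

lemma toeplitz_cong:
  assumes "\<And>z. z \<in> circle \<Longrightarrow> q z = r z" "continuous_on circle q"
  shows "toeplitz q = toeplitz r"
proof -
  have r: "continuous_on circle r" by (rule continuous_on_eq[OF assms(2,1)])
  have "L2_mult q f = L2_mult r f" for f
    by (rule L2_mult_cong[OF assms r])
  then show ?thesis
    by (intro hardy_op_ext) (simp add: cinner_toeplitz assms(2) r)
qed

lemma toeplitz_add:
  assumes "continuous_on circle q" "continuous_on circle r"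
  shows "toeplitz (\<lambda>z. q z + r z) = toeplitz q + toeplitz r"
  by (rule hardy_op_ext)
    (simp add: cinner_toeplitz assms continuous_on_add plus_hardy_op.rep_eq L2_mult_add_symbol cinner_add_right)

lemma toeplitz_const: "op_apply (toeplitz (\<lambda>z. c)) f = c *\<^sub>C f"
  by (rule cinner_ext) (simp add: cinner_toeplitz L2_mult_const cinner_scaleC_right cinner_hardy.rep_eq[symmetric])

lemma toeplitz_1: "toeplitz (\<lambda>z. 1) = 1"
  by (rule hardy_op_ext) (simp add: toeplitz_const one_hardy_op.rep_eq)

lemma toeplitz_0: "toeplitz (\<lambda>z. 0) = 0"
  by (rule hardy_op_ext) (simp add: toeplitz_const zero_hardy_op.rep_eq)

section \<open>Analytic symbols\<close>

lemma open_superset_cball: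
  assumes "open U" "cball (0::complex) 1 \<subseteq> U"
  obtains R where "R > 1" "ball 0 R \<subseteq> U"
proof -
  obtain e where e: "e > 0" "(\<Union>x\<in>cball 0 1. ball x e) \<subseteq> U"
    using compact_subset_open_imp_ball_epsilon_subset[OF compact_cball assms] by blast
  have "ball 0 (1 + e) \<subseteq> U"
  proof
    fix z :: complex assume z: "z \<in> ball 0 (1 + e)"
    show "z \<in> U"
    proof (cases "cmod z \<le> 1")
      case False
      have "z \<in> ball (z / cmod z) e"
      proof -
        have z0: "z \<noteq> 0" using False by auto
        then have "z / cmod z - z = of_real (1 / cmod z - 1) * z" by (simp add: field_simps)
        then have "dist (z / cmod z) z = \<bar>1 / cmod z - 1\<bar> * cmod z"
          by (simp only: dist_norm norm_mult norm_of_real)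
        also have "\<dots> = cmod z - 1" using False z0 by (simp add: abs_if field_simps)
        finally show ?thesis using z by simp
      qed
      moreover have "z / cmod z \<in> cball 0 1" using False by (simp add: norm_divide)
      ultimately show ?thesis using e by blast
    qed (use assms in auto)
  qed
  then show thesis using that[of "1 + e"] e(1) by auto
qed

lemma analytic_on_cball_imp_ball:
  assumes "g analytic_on cball 0 1"
  obtains R where "R > 1" "g holomorphic_on ball 0 R"
  using assms open_superset_cball holomorphic_on_subset unfolding analytic_on_holomorphic by metis

lemma analytic_cball_continuous_circle:
  "g analytic_on cball 0 1 \<Longrightarrow> continuous_on circle g"
  by (meson analytic_imp_holomorphic analytic_on_subset holomorphic_on_imp_continuous_on sphere_cball)

text \<open>Analyticity on the closed disk gives a radius of convergence larger than one, hence
  uniform convergence on the circle.\<close>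

lemma analytic_polynomial_approx:
  assumes "g analytic_on cball 0 1" "e > 0"
  obtains n c where "\<And>z. z \<in> circle \<Longrightarrow> cmod (g z - (\<Sum>i<n. c i * z ^ i)) < e"
proof -
  obtain R where R: "R > 1" "g holomorphic_on ball 0 R"
    by (rule analytic_on_cball_imp_ball[OF assms(1)])
  define c where "c n = (deriv ^^ n) g 0 / fact n" for n
  have s: "(\<lambda>n. c n * z ^ n) sums g z" if "z \<in> ball 0 R" for z
    using holomorphic_power_series[OF R(2) that] by (simp add: c_def)
  define \<rho> where "\<rho> = (1 + R) / 2"
  have \<rho>: "1 < \<rho>" "\<rho> < R" using R by (auto simp: \<rho>_def)
  have ge: "ereal (norm (complex_of_real \<rho>)) \<le> conv_radius c"
    using s[of "of_real \<rho>"] \<rho> by (intro conv_radius_geI) (auto intro: sums_summable)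
  have "ereal 1 < ereal (norm (complex_of_real \<rho>))" using \<rho> by simp
  from less_le_trans[OF this ge] have "ereal 1 < conv_radius c" .
  then have "uniform_limit (cball 0 1) (\<lambda>n x. \<Sum>i<n. c i * (x - 0) ^ i) (\<lambda>x. \<Sum>i. c i * (x - 0) ^ i) sequentially"
    by (intro powser_uniform_limit) simp
  then have "\<exists>N. \<forall>n\<ge>N. \<forall>x\<in>cball 0 1. dist (\<Sum>i<n. c i * (x - 0) ^ i) (\<Sum>i. c i * (x - 0) ^ i) < e"
    unfolding uniform_limit_iff eventually_sequentially using assms(2) by blast
  then obtain n where n: "\<And>x. x \<in> cball 0 1 \<Longrightarrow> dist (\<Sum>i<n. c i * (x - 0) ^ i) (\<Sum>i. c i * (x - 0) ^ i) < e"
    by blast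
  show thesis
  proof (rule that)
    fix z assume "z \<in> circle"
    then have "(\<Sum>i. c i * z ^ i) = g z" using s[of z] R(1) by (auto simp: sums_iff)
    then show "cmod (g z - (\<Sum>i<n. c i * z ^ i)) < e"
      using n[of z] \<open>z \<in> circle\<close> by (simp add: dist_norm norm_minus_commute)
  qed
qed

lemma cinner_L2_monom_mult_power:
  assumes "k < 0"
  shows "cinner (L2_monom k) (L2_mult (\<lambda>z. \<Sum>i<n. c i * z ^ i) (Rep_hardy f)) = 0"
proof (induction n)
  case 0
  then show ?case by (simp add: L2_mult_const)
next
  case (Suc n)
  have 1: "continuous_on circle (\<lambda>z. \<Sum>i<n. c i * z ^ i)" "continuous_on circle (\<lambda>z. c n * z ^ n)"
    by (intro continuous_intros)+
  have "cinner (L2_monom k) (L2_mult (\<lambda>z. c n * z ^ n) (Rep_hardy f)) =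
      cinner (L2_mult (\<lambda>z. cnj (c n * z ^ n)) (L2_monom k)) (Rep_hardy f)"
    by (rule cinner_L2_mult[OF 1(2)])
  also have "L2_mult (\<lambda>z. cnj (c n * z ^ n)) (L2_monom k) = cnj (c n) *\<^sub>C L2_monom (k - int n)"
  proof -
    have "L2_mult (\<lambda>z. cnj (c n * z ^ n)) (L2_monom k) = abs_circle_L2 (\<lambda>z. cnj (c n * z ^ n) * z powi k)"
      unfolding L2_monom_eq by (intro L2_mult_abs square_integrable_powi continuous_intros)
    also have "\<dots> = abs_circle_L2 (\<lambda>z. cnj (c n) * z powi (k - int n))"
    proof (intro abs_L2_eqI AE_circleI square_integrable_scale square_integrable_powi square_integrable_mult)
      fix z :: complex assume z: "z \<in> circle"
      then have "z \<noteq> 0" by auto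
      then show "cnj (c n * z ^ n) * z powi k = cnj (c n) * z powi (k - int n)"
        using z by (simp add: cnj_circle power_int_diff power_inverse field_simps)
    qed (intro continuous_intros)
    finally show ?thesis by (simp add: L2_monom_eq scaleC_abs_L2 square_integrable_powi)
  qed
  also have "cinner (cnj (c n) *\<^sub>C L2_monom (k - int n)) (Rep_hardy f) = 0"
    using Rep_hardy[of f] assms by (simp add: cinner_scaleC_left fourier_coeff_def)
  finally have "cinner (L2_monom k) (L2_mult (\<lambda>z. c n * z ^ n) (Rep_hardy f)) = 0" .
  then show ?case
    using Suc by (simp add: L2_mult_add_symbol[OF 1] cinner_add_right)
qed

text \<open>Multiplication by polynomials preserves the Hardy space, and polynomials approximate
  an analytic symbol uniformly on the circle.\<close>

lemma L2_mult_analytic_hardy: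
  assumes g: "g analytic_on cball 0 1" and k: "k < 0"
  shows "fourier_coeff (L2_mult g (Rep_hardy f)) k = 0"
proof -
  have cg: "continuous_on circle g" by (rule analytic_cball_continuous_circle[OF g])
  have nm: "norm (L2_monom k) = 1"
  proof -
    have "complex_of_real ((norm (L2_monom k))\<^sup>2) = of_real 1"
      using cinner_self[of "L2_monom k"] cinner_L2_monom[of k k] by simp
    then have "(norm (L2_monom k))\<^sup>2 = 1\<^sup>2" unfolding of_real_eq_iff by simp
    then show ?thesis by (rule power2_eq_imp_eq) auto
  qed
  have "cmod (fourier_coeff (L2_mult g (Rep_hardy f)) k) \<le> 0 + e" if e: "e > 0" for e
  proof -
    define e' where "e' = e / (norm f + 1)"
    have nf: "norm f + 1 > 0" using norm_ge_zero[of f] by linarith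
    then have e': "e' > 0" using e by (simp add: e'_def)
    obtain n c where nc: "\<And>z. z \<in> circle \<Longrightarrow> cmod (g z - (\<Sum>i<n. c i * z ^ i)) < e'"
      by (rule analytic_polynomial_approx[OF g e']) blast
    define p where "p z = (\<Sum>i<n. c i * z ^ i)" for z
    have cp: "continuous_on circle p" unfolding p_def by (intro continuous_intros)
    have cd: "continuous_on circle (\<lambda>z. g z - p z)" by (intro continuous_intros cg cp)
    have "L2_mult g (Rep_hardy f) = L2_mult (\<lambda>z. p z + (g z - p z)) (Rep_hardy f)" by simp
    also have "\<dots> = L2_mult p (Rep_hardy f) + L2_mult (\<lambda>z. g z - p z) (Rep_hardy f)"
      by (rule L2_mult_add_symbol[OF cp cd])
    finally have "fourier_coeff (L2_mult g (Rep_hardy f)) k = cinner (L2_monom k) (L2_mult (\<lambda>z. g z - p z) (Rep_hardy f))"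
      using cinner_L2_monom_mult_power[OF k, where n = n and c = c and f = f] by (simp add: fourier_coeff_def cinner_add_right p_def[abs_def])
    also have "cmod \<dots> \<le> norm (L2_monom k) * norm (L2_mult (\<lambda>z. g z - p z) (Rep_hardy f))"
      by (rule cinner_Cauchy_Schwarz)
    also have "\<dots> \<le> e' * norm f"
      using norm_L2_mult[OF cd, of e' "Rep_hardy f"] nc e' by (simp add: nm p_def norm_Rep_hardy less_imp_le)
    also have "\<dots> \<le> e" using nf e by (simp add: e'_def field_simps)
    finally show ?thesis by simp
  qed
  then have "cmod (fourier_coeff (L2_mult g (Rep_hardy f)) k) \<le> 0"
    by (rule field_le_epsilon)
  then show ?thesis by simp
qed

lemma Rep_toeplitz_analytic:
  assumes g: "g analytic_on cball 0 1"
  shows "Rep_hardy (op_apply (toeplitz g) f) = L2_mult g (Rep_hardy f)"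
proof -
  have cg: "continuous_on circle g" by (rule analytic_cball_continuous_circle[OF g])
  define u where "u = Abs_hardy (L2_mult g (Rep_hardy f))"
  have u: "Rep_hardy u = L2_mult g (Rep_hardy f)"
    unfolding u_def by (rule Abs_hardy_inverse) (simp add: L2_mult_analytic_hardy g)
  have "op_apply (toeplitz g) f = u"
    by (rule cinner_ext) (simp add: cinner_toeplitz cg u[symmetric] cinner_hardy.rep_eq[symmetric])
  then show ?thesis by (simp add: u)
qed

text \<open>An analytic right factor maps into the Hardy space, so the inner projection does
  nothing.\<close>

lemma toeplitz_mult_analytic:
  assumes q: "continuous_on circle q" and g: "g analytic_on cball 0 1"
  shows "toeplitz q * toeplitz g = toeplitz (\<lambda>z. q z * g z)"
proof (rule hardy_op_ext)
  fix h f
  have cg: "continuous_on circle g" by (rule analytic_cball_continuous_circle[OF g])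
  have "cinner h (op_apply (toeplitz q * toeplitz g) f) = cinner (Rep_hardy h) (L2_mult (\<lambda>z. q z * g z) (Rep_hardy f))"
    by (simp add: times_hardy_op.rep_eq cinner_toeplitz q Rep_toeplitz_analytic g L2_mult_mult cg)
  also have "\<dots> = cinner h (op_apply (toeplitz (\<lambda>z. q z * g z)) f)"
    by (simp add: cinner_toeplitz continuous_on_mult q cg)
  finally show "cinner h (op_apply (toeplitz q * toeplitz g) f) = cinner h (op_apply (toeplitz (\<lambda>z. q z * g z)) f)" .
qed

section \<open>Linear factors: left inverse and point evaluation\<close>

definition lin_op :: "complex \<Rightarrow> hardy_op" where "lin_op a = toeplitz (\<lambda>z. z - a)"

text \<open>For \<open>|a| < 1\<close> the operator \<^term>\<open>lin_op a\<close> is injective,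
  but its range, the functions vanishing at \<open>a\<close>, has codimension one; hence there is
  a left inverse and no right inverse.\<close>

definition lin_linv :: "complex \<Rightarrow> hardy_op" where "lin_linv a = toeplitz (\<lambda>z. inverse (z - a))"

lemma continuous_on_inverse_linear:
  assumes "a \<in> ball 0 1" shows "continuous_on circle (\<lambda>z. inverse (z - a))"
  by (intro continuous_intros) (use assms in auto)

lemma analytic_linear: "(\<lambda>z. z - a) analytic_on S"
  by (intro analytic_intros)

lemma lin_linv_lin_op: assumes a: "a \<in> ball 0 1" shows "lin_linv a * lin_op a = 1"
proof -
  have "lin_linv a * lin_op a = toeplitz (\<lambda>z. inverse (z - a) * (z - a))"
    unfolding lin_op_def lin_linv_def by (rule toeplitz_mult_analytic[OF continuous_on_inverse_linear[OF a] analytic_linear])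
  also have "\<dots> = toeplitz (\<lambda>z. 1)"
  proof (rule toeplitz_cong)
    fix z assume "z \<in> circle"
    then have "z - a \<noteq> 0" using a by auto
    then show "inverse (z - a) * (z - a) = 1" by (rule left_inverse)
  qed (intro continuous_intros continuous_on_inverse_linear[OF a])
  finally show ?thesis by (simp add: toeplitz_1)
qed

lemma shift_hardy_monom: "op_apply (lin_op 0) (hardy_monom n) = hardy_monom (Suc n)"
proof -
  have "Rep_hardy (op_apply (lin_op 0) (hardy_monom n)) = L2_mult (\<lambda>z. z - 0) (L2_monom (int n))"
    unfolding lin_op_def by (subst Rep_toeplitz_analytic[OF analytic_linear]) (simp add: Rep_hardy_monom)
  also have "\<dots> = abs_circle_L2 (\<lambda>z. (z - 0) * z powi int n)"
    unfolding L2_monom_eq by (intro L2_mult_abs square_integrable_powi continuous_intros)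
  also have "(\<lambda>z::complex. (z - 0) * z powi int n) = (\<lambda>z. z powi int (Suc n))"
    by (simp add: fun_eq_iff power_int_def nat_add_distrib)
  also have "abs_circle_L2 (\<lambda>z. z powi int (Suc n)) = Rep_hardy (hardy_monom (Suc n))"
    by (simp only: Rep_hardy_monom L2_monom_eq)
  finally show ?thesis by (simp add: Rep_hardy_inject)
qed

lemma cinner_hardy_monom_0_shift: "cinner (hardy_monom 0) (op_apply (lin_op 0) f) = 0"
proof -
  have c: "continuous_on circle (\<lambda>z::complex. z - 0)" by (intro continuous_intros)
  have "cinner (hardy_monom 0) (op_apply (lin_op 0) f) = cinner (L2_monom 0) (L2_mult (\<lambda>z. z - 0) (Rep_hardy f))"
    unfolding lin_op_def by (simp only: cinner_toeplitz[OF c] Rep_hardy_monom of_nat_0)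
  also have "\<dots> = cinner (L2_mult (\<lambda>z. cnj (z - 0)) (L2_monom 0)) (Rep_hardy f)"
    by (rule cinner_L2_mult[OF c])
  also have "L2_mult (\<lambda>z. cnj (z - 0)) (L2_monom 0) = L2_monom (-1)"
  proof -
    have "L2_mult (\<lambda>z. cnj (z - 0)) (L2_monom 0) = abs_circle_L2 (\<lambda>z. cnj (z - 0) * z powi 0)"
      unfolding L2_monom_eq by (intro L2_mult_abs square_integrable_powi continuous_intros)
    also have "\<dots> = abs_circle_L2 (\<lambda>z. z powi (-1))"
      by (intro abs_L2_eqI AE_circleI square_integrable_powi square_integrable_mult continuous_intros)
        (simp add: cnj_circle power_int_minus)
    finally show ?thesis by (simp only: L2_monom_eq)
  qed
  also have "cinner (L2_monom (-1)) (Rep_hardy f) = 0"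
    using Rep_hardy[of f] by (simp add: fourier_coeff_def)
  finally show ?thesis .
qed

text \<open>On the circle \<open>cnj (1/(z - a)) = z/(1 - cnj a * z)\<close>, so the adjoint of
  \<^term>\<open>lin_linv a\<close> is the product of the shift and an invertible analytic
  Toeplitz operator. This determines the kernel of \<^term>\<open>lin_linv a\<close>: it is the
  orthogonal complement of the range of the shift.\<close>

lemma cinner_lin_linv:
  assumes a: "a \<in> ball 0 1"
  obtains U where "\<And>h f. cinner h (op_apply (lin_linv a) f) = cinner (op_apply (lin_op 0) (op_apply U h)) f"
    "U * toeplitz (\<lambda>z. 1 - cnj a * z) = 1"
proof -
  define u where "u z = inverse (1 - cnj a * z)" for z
  have nz: "1 - cnj a * z \<noteq> 0" if "z \<in> cball 0 1" for z
  proof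
    assume "1 - cnj a * z = 0"
    then have "cmod a * cmod z = 1" by (metis complex_mod_cnj eq_iff_diff_eq_0 norm_mult norm_one)
    moreover have "cmod a * cmod z \<le> cmod a * 1" using that by (intro mult_left_mono) auto
    ultimately show False using a by simp
  qed
  have u: "u analytic_on cball 0 1"
    unfolding u_def by (intro analytic_intros) (use nz in auto)
  have cu: "continuous_on circle u" by (rule analytic_cball_continuous_circle[OF u])
  have cb: "continuous_on circle (\<lambda>z. inverse (z - a))" by (rule continuous_on_inverse_linear[OF a])
  have cz: "continuous_on circle (\<lambda>z::complex. z - 0)" by (intro continuous_intros)
  have l: "(\<lambda>z. 1 - cnj a * z) analytic_on cball 0 1" by (intro analytic_intros)
  show thesis
  proof (rule that[of "toeplitz u"])
    fix h f
    have "cinner h (op_apply (lin_linv a) f) = cinner (L2_mult (\<lambda>z. cnj (inverse (z - a))) (Rep_hardy h)) (Rep_hardy f)"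
      unfolding lin_linv_def by (simp add: cinner_toeplitz cb cinner_L2_mult)
    also have "L2_mult (\<lambda>z. cnj (inverse (z - a))) (Rep_hardy h) = L2_mult (\<lambda>z. (z - 0) * u z) (Rep_hardy h)"
    proof (rule L2_mult_cong)
      fix z assume z: "z \<in> circle"
      then have "z \<noteq> 0" by auto
      with z show "cnj (inverse (z - a)) = (z - 0) * u z"
        using nz[of z] by (simp add: cnj_circle u_def field_simps)
    qed (intro continuous_intros cb cu)+
    also have "\<dots> = L2_mult (\<lambda>z. z - 0) (L2_mult u (Rep_hardy h))"
      by (simp only: L2_mult_mult[OF cz cu])
    also have "\<dots> = Rep_hardy (op_apply (lin_op 0) (op_apply (toeplitz u) h))"
      unfolding lin_op_def by (simp only: Rep_toeplitz_analytic[OF analytic_linear] Rep_toeplitz_analytic[OF u])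
    finally show "cinner h (op_apply (lin_linv a) f) = cinner (op_apply (lin_op 0) (op_apply (toeplitz u) h)) f"
      by (simp only: cinner_hardy.rep_eq)
  next
    have "toeplitz u * toeplitz (\<lambda>z. 1 - cnj a * z) = toeplitz (\<lambda>z. u z * (1 - cnj a * z))"
      by (rule toeplitz_mult_analytic[OF cu l])
    also have "\<dots> = toeplitz (\<lambda>z. 1)"
      by (rule toeplitz_cong) (use nz in \<open>auto simp: u_def intro!: continuous_intros cu[unfolded u_def]\<close>)
    finally show "toeplitz u * toeplitz (\<lambda>z. 1 - cnj a * z) = 1" by (simp add: toeplitz_1)
  qed
qed

lemma lin_linv_hardy_monom_0:
  assumes a: "a \<in> ball 0 1" shows "op_apply (lin_linv a) (hardy_monom 0) = 0"
proof (rule cinner_ext)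
  fix h
  obtain U where U: "\<And>h f. cinner h (op_apply (lin_linv a) f) = cinner (op_apply (lin_op 0) (op_apply U h)) f"
    by (rule cinner_lin_linv[OF a]) blast
  have "cinner h (op_apply (lin_linv a) (hardy_monom 0)) = cnj (cinner (hardy_monom 0) (op_apply (lin_op 0) (op_apply U h)))"
    using U cinner_commute by metis
  then show "cinner h (op_apply (lin_linv a) (hardy_monom 0)) = cinner h 0" by (simp add: cinner_hardy_monom_0_shift)
qed

lemma lin_linv_kernel:
  assumes a: "a \<in> ball 0 1" and f: "op_apply (lin_linv a) f = 0"
  shows "f = cinner (hardy_monom 0) f *\<^sub>C hardy_monom 0"
proof -
  obtain U where U: "\<And>h f. cinner h (op_apply (lin_linv a) f) = cinner (op_apply (lin_op 0) (op_apply U h)) f"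
    "U * toeplitz (\<lambda>z. 1 - cnj a * z) = 1"
    by (rule cinner_lin_linv[OF a]) blast
  have "cinner (hardy_monom (Suc n)) f = 0" for n
  proof -
    define h where "h = op_apply (toeplitz (\<lambda>z. 1 - cnj a * z)) (hardy_monom n)"
    have "op_apply U h = hardy_monom n"
      using arg_cong[OF U(2), of "\<lambda>A. op_apply A (hardy_monom n)"] by (simp add: op_apply_simps h_def)
    then show ?thesis using U(1)[of h f] f by (simp add: shift_hardy_monom)
  qed
  then have "cinner (hardy_monom n) (f - cinner (hardy_monom 0) f *\<^sub>C hardy_monom 0) = 0" for n
    by (cases n) (simp_all add: cinner_diff_right cinner_scaleC_right cinner_hardy_monom_hardy_monom)
  then have "f - cinner (hardy_monom 0) f *\<^sub>C hardy_monom 0 = 0" by (rule hardy_eq_zeroI)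
  then show ?thesis by simp
qed

text \<open>For \<open>|a| < 1\<close> this is the projection onto the constants along the
  functions vanishing at \<open>a\<close>, that is, \<open>f \<mapsto> f(a)\<close>.\<close>

definition eval_proj :: "complex \<Rightarrow> hardy_op" where "eval_proj a = 1 - lin_op a * lin_linv a"

lemma eval_proj_lin_op: assumes "a \<in> ball 0 1" shows "eval_proj a * lin_op a = 0"
  unfolding eval_proj_def by (simp add: algebra_simps mult.assoc lin_linv_lin_op[OF assms])

lemma lin_linv_eval_proj: assumes "a \<in> ball 0 1" shows "lin_linv a * eval_proj a = 0"
  unfolding eval_proj_def by (simp add: algebra_simps mult.assoc[symmetric] lin_linv_lin_op[OF assms])

lemma eval_proj_hardy_monom_0: assumes "a \<in> ball 0 1" shows "op_apply (eval_proj a) (hardy_monom 0) = hardy_monom 0"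
  by (simp add: eval_proj_def op_apply_simps lin_linv_hardy_monom_0[OF assms])

lemma analytic_divide_root:
  assumes g: "g analytic_on cball 0 1" and a: "a \<in> ball 0 1" "g a = 0"
  obtains q where "q analytic_on cball 0 1" "\<And>z. g z = (z - a) * q z"
proof -
  obtain S where S: "open S" "cball 0 1 \<subseteq> S" "g holomorphic_on S"
    using g by (auto simp: analytic_on_holomorphic)
  have "a \<in> interior S" using S a by (auto simp: interior_open)
  from pole_lemma[OF S(3) this]
  have "(\<lambda>z. if z = a then deriv g a else (g z - g a) / (z - a)) holomorphic_on S" .
  then have "(\<lambda>z. if z = a then deriv g a else (g z - g a) / (z - a)) analytic_on cball 0 1"
    using S by (auto simp: analytic_on_holomorphic)
  then show thesis by (rule that) (simp add: a)
qed

text \<open>The vector \<open>k\<close> is the reproducing kernel at \<open>a\<close>. The range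
  of the projection lies in the kernel of \<^term>\<open>lin_linv a\<close>, which consists of the
  constants, and the projection kills multiples of \<open>z - a\<close>; writing \<open>g = g(a) +
  (z - a) q\<close> identifies it as evaluation at \<open>a\<close>.\<close>

lemma eval_proj_kernel:
  assumes a: "a \<in> ball 0 1"
  obtains k where "\<And>f. op_apply (eval_proj a) f = cinner k f *\<^sub>C hardy_monom 0"
    "\<And>g. g analytic_on cball 0 1 \<Longrightarrow> cinner k (op_apply (toeplitz g) (hardy_monom 0)) = g a"
    "\<And>f. cinner k (op_apply (lin_op a) f) = 0"
proof -
  have b: "bounded_linear (\<lambda>f. cinner (hardy_monom 0) (op_apply (eval_proj a) f))"
    by (intro bounded_linear_compose[OF bounded_linear_cinner_right])
      (use bounded_clinear_op[of "eval_proj a"] in \<open>simp add: bounded_clinear_def\<close>)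
  obtain k where k: "\<And>f. cinner (hardy_monom 0) (op_apply (eval_proj a) f) = cinner k f"
    by (rule riesz_representation[OF orthonormal_basis_hardy b]) (simp_all add: cinner_scaleC_right)
  have P: "op_apply (eval_proj a) f = cinner k f *\<^sub>C hardy_monom 0" for f
  proof -
    have "op_apply (lin_linv a) (op_apply (eval_proj a) f) = 0"
      using arg_cong[OF lin_linv_eval_proj[OF a], of "\<lambda>A. op_apply A f"] by (simp add: op_apply_simps)
    from lin_linv_kernel[OF a this] show ?thesis by (simp add: k)
  qed
  have kA: "cinner k (op_apply (lin_op a) f) = 0" for f
    using arg_cong[OF eval_proj_lin_op[OF a], of "\<lambda>A. op_apply A f"] k[of "op_apply (lin_op a) f"]
    by (simp add: op_apply_simps)
  have k0: "cinner k (hardy_monom 0) = 1"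
    using k[of "hardy_monom 0"] by (simp add: eval_proj_hardy_monom_0[OF a] cinner_hardy_monom_hardy_monom)
  show thesis
  proof (rule that[OF P _ kA])
    fix g assume g: "g analytic_on cball 0 1"
    have "(\<lambda>z. g z - g a) analytic_on cball 0 1" by (intro analytic_intros g)
    then obtain q where q: "q analytic_on cball 0 1" and gq: "\<And>z. g z - g a = (z - a) * q z"
      using analytic_divide_root[of "\<lambda>z. g z - g a" a] a by auto
    have "toeplitz g = toeplitz (\<lambda>z. g a + (z - a) * q z)"
    proof (rule toeplitz_cong)
      show "g z = g a + (z - a) * q z" if "z \<in> circle" for z
        by (simp add: gq[symmetric])
    qed (rule analytic_cball_continuous_circle[OF g])
    also have "\<dots> = toeplitz (\<lambda>z. g a) + toeplitz (\<lambda>z. (z - a) * q z)"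
      by (intro toeplitz_add continuous_intros analytic_cball_continuous_circle[OF q])
    also have "toeplitz (\<lambda>z. (z - a) * q z) = lin_op a * toeplitz q"
      unfolding lin_op_def by (rule toeplitz_mult_analytic[symmetric]) (intro continuous_intros q)+
    finally show "cinner k (op_apply (toeplitz g) (hardy_monom 0)) = g a"
      by (simp add: op_apply_simps toeplitz_const cinner_add_right cinner_scaleC_right k0 kA)
  qed
qed

section \<open>Trace class operators on the Hardy space\<close>

lemma trace_class_rank_one: "trace_class (\<lambda>f. cinner k f *\<^sub>C e)"
  unfolding trace_class_def
proof (intro exI conjI allI)
  show "summable (\<lambda>n::nat. norm (if n = 0 then e else 0) * norm (if n = 0 then k else 0))"
    by (rule summable_finite[of "{0}"]) auto
  fix v
  show "(\<lambda>n::nat. cinner (if n = 0 then k else 0) v *\<^sub>C (if n = 0 then e else 0)) sums (cinner k v *\<^sub>C e)"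
    using sums_finite[of "{0::nat}" "\<lambda>n. cinner (if n = 0 then k else 0) v *\<^sub>C (if n = 0 then e else 0)"] by simp
qed

definition trace_class_op :: "hardy_op \<Rightarrow> bool" where "trace_class_op L \<longleftrightarrow> trace_class (op_apply L)"

lemma trace_class_op_add: "trace_class_op K \<Longrightarrow> trace_class_op L \<Longrightarrow> trace_class_op (K + L)"
  unfolding trace_class_op_def plus_hardy_op.rep_eq by (rule trace_class_add)

lemma trace_class_op_mult_left: "trace_class_op L \<Longrightarrow> trace_class_op (A * L)"
  unfolding trace_class_op_def times_hardy_op.rep_eq by (rule trace_class_compose_left) simp_all

lemma trace_class_op_mult_right: "trace_class_op L \<Longrightarrow> trace_class_op (L * A)"
  unfolding trace_class_op_def times_hardy_op.rep_eq by (rule trace_class_compose_right[OF orthonormal_basis_hardy]) simp_all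

lemma trace_class_op_0: "trace_class_op 0"
  using trace_class_rank_one[of "0::hardy" 0] by (simp add: trace_class_op_def zero_hardy_op.rep_eq scaleC_zero_right)

lemma trace_class_op_minus: "trace_class_op L \<Longrightarrow> trace_class_op (- L)"
  using trace_class_op_mult_left[of L "-1"] by simp

lemma trace_class_op_diff: "trace_class_op K \<Longrightarrow> trace_class_op L \<Longrightarrow> trace_class_op (K - L)"
  using trace_class_op_add[of K "- L"] trace_class_op_minus[of L] by simp

lemma trace_class_op_sum: "(\<And>i. i \<in> I \<Longrightarrow> trace_class_op (L i)) \<Longrightarrow> trace_class_op (sum L I)"
  by (induction I rule: infinite_finite_induct) (auto simp: trace_class_op_0 trace_class_op_add)

lemma trace_class_op_eval_proj: assumes a: "a \<in> ball 0 1" shows "trace_class_op (eval_proj a)"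
proof -
  obtain k where "\<And>f. op_apply (eval_proj a) f = cinner k f *\<^sub>C hardy_monom 0"
    by (rule eval_proj_kernel[OF a]) blast
  then have "op_apply (eval_proj a) = (\<lambda>f. cinner k f *\<^sub>C hardy_monom 0)" by (simp add: fun_eq_iff)
  then show ?thesis by (simp add: trace_class_op_def trace_class_rank_one)
qed

text \<open>Induction on the linear factors that clear the poles of \<open>r\<close>; with none
  left, the right factor is analytic and the difference vanishes. Multiplying \<open>r\<close> by
  \<open>z - a\<close> multiplies the difference \<open>K\<close> by \<^term>\<open>lin_op
  a\<close> on the right, and \<open>K\<close> is recovered from that up to an operator of rank
  one.\<close>

lemma toeplitz_mult_trace_class:
  assumes q: "continuous_on circle q"
  shows "continuous_on circle r \<Longrightarrow> g analytic_on cball 0 1 \<Longrightarrow> set l \<subseteq> ball 0 1 \<Longrightarrow>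
    (\<And>z. z \<in> circle \<Longrightarrow> r z * (\<Prod>a\<leftarrow>l. z - a) = g z) \<Longrightarrow>
    trace_class_op (toeplitz q * toeplitz r - toeplitz (\<lambda>z. q z * r z))"
proof (induction l arbitrary: r)
  case Nil
  have "toeplitz r = toeplitz g" by (rule toeplitz_cong) (use Nil in auto)
  moreover have "toeplitz (\<lambda>z. q z * r z) = toeplitz (\<lambda>z. q z * g z)"
    by (rule toeplitz_cong) (use Nil q in \<open>auto intro!: continuous_intros\<close>)
  ultimately show ?case by (simp add: toeplitz_mult_analytic q Nil trace_class_op_0)
next
  case (Cons a l)
  have a: "a \<in> ball 0 1" using Cons.prems by simp
  define r' where "r' z = r z * (z - a)" for z
  have r': "continuous_on circle r'" unfolding r'_def by (intro continuous_intros Cons.prems)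
  have IH: "trace_class_op (toeplitz q * toeplitz r' - toeplitz (\<lambda>z. q z * r' z))"
    by (rule Cons.IH[OF r' Cons.prems(2)]) (use Cons.prems in \<open>auto simp: r'_def mult.assoc\<close>)
  define K where "K = toeplitz q * toeplitz r - toeplitz (\<lambda>z. q z * r z)"
  have 1: "toeplitz r * lin_op a = toeplitz r'"
    unfolding lin_op_def r'_def by (rule toeplitz_mult_analytic[OF Cons.prems(1) analytic_linear])
  have qr: "continuous_on circle (\<lambda>z. q z * r z)" by (intro continuous_intros q Cons.prems)
  have 2: "toeplitz (\<lambda>z. q z * r z) * lin_op a = toeplitz (\<lambda>z. q z * r' z)"
    unfolding lin_op_def r'_def toeplitz_mult_analytic[OF qr analytic_linear] by (simp add: mult.assoc)
  \<comment> \<open>Since \<open>1 = A B + p\<close>.\<close>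
  have "K = K * lin_op a * lin_linv a + K * eval_proj a"
    by (simp add: eval_proj_def algebra_simps mult.assoc)
  also have "K * lin_op a = toeplitz q * toeplitz r' - toeplitz (\<lambda>z. q z * r' z)"
    by (simp add: K_def left_diff_distrib mult.assoc 1 2)
  finally have "K = (toeplitz q * toeplitz r' - toeplitz (\<lambda>z. q z * r' z)) * lin_linv a + K * eval_proj a" .
  then have "trace_class_op K" using trace_class_op_add[OF trace_class_op_mult_right[OF IH] trace_class_op_mult_left[OF trace_class_op_eval_proj[OF a]]] by metis
  then show ?case by (simp add: K_def)
qed

no_notation fps_nth (infixl "$" 75)

section \<open>Matrices of operators\<close>

lemmas cvec_eq_iff = Finite_Cartesian_Product.vec_eq_iff

lemma matrix_apply_mult: "matrix_apply (R ** S) x = matrix_apply R (matrix_apply S x)"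
proof -
  have "(\<Sum>j\<in>UNIV. op_apply (\<Sum>k\<in>UNIV. R $ i $ k * S $ k $ j) (x $ j)) =
      (\<Sum>k\<in>UNIV. op_apply (R $ i $ k) (\<Sum>j\<in>UNIV. op_apply (S $ k $ j) (x $ j)))" for i
  proof -
    have s: "op_apply (\<Sum>k\<in>K. f k) v = (\<Sum>k\<in>K. op_apply (f k) v)" for K and f :: "'b \<Rightarrow> hardy_op" and v
      by (induction K rule: infinite_finite_induct) (auto simp: op_apply_simps)
    show ?thesis
      unfolding s op_apply_sum times_hardy_op.rep_eq by (rule sum.swap)
  qed
  then show ?thesis
    by (simp add: matrix_apply_def matrix_matrix_mult_def cvec_eq_iff)
qed

abbreviation idm :: "hardy_op ^ 3 ^ 3" where "idm \<equiv> Finite_Cartesian_Product.mat 1"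

lemma matrix_apply_1: "matrix_apply idm x = x"
  by (simp add: matrix_apply_def Finite_Cartesian_Product.mat_def cvec_eq_iff if_distrib[of op_apply] if_distribR op_apply_simps cong: if_cong)

lemma matrix_apply_diff: "matrix_apply (R - S) x = matrix_apply R x - matrix_apply S x"
  by (simp add: matrix_apply_def cvec_eq_iff op_apply_simps sum_subtractf)

lemma cinner_axis: "cinner (axis i e) (x :: 'a::complex_inner ^ 'n) = cinner e (x $ i)"
proof -
  have "cinner (axis i e) x = (\<Sum>j\<in>UNIV. if j = i then cinner e (x $ i) else 0)"
    unfolding cinner_vec_def by (intro sum.cong refl) (auto simp: axis_def)
  then show ?thesis by simp
qed

lemma axis_nth_if: "axis i x $ k = (if k = i then x else 0)"
  by (simp add: axis_def)

lemma norm_axis_eq: "norm (axis i x :: 'a::complex_inner ^ 'n::finite) = norm x"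
proof -
  have "complex_of_real ((norm (axis i x :: 'a ^ 'n))\<^sup>2) = of_real ((norm x)\<^sup>2)"
    unfolding cinner_self[symmetric] cinner_axis by (simp add: axis_def)
  then have "(norm (axis i x :: 'a ^ 'n))\<^sup>2 = (norm x)\<^sup>2" unfolding of_real_eq_iff .
  then show ?thesis by (rule power2_eq_imp_eq) auto
qed

lemma bounded_linear_axis: "bounded_linear (axis i :: 'a::complex_inner \<Rightarrow> 'a ^ 'n::finite)"
  by (rule bounded_linear_intro[where K = 1]) (auto simp: axis_def cvec_eq_iff norm_axis_eq[unfolded axis_def])

text \<open>Splitting a matrix into its entries reduces boundedness and the trace class property
  to single operators.\<close>

lemma matrix_apply_eq_sum_axis:
  "matrix_apply (M :: hardy_op ^ 'n ^ 'n::finite) v = (\<Sum>i\<in>UNIV. \<Sum>j\<in>UNIV. axis i (op_apply (M $ i $ j) (v $ j)))"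
proof -
  have "(\<Sum>i\<in>UNIV. \<Sum>j\<in>UNIV. axis i (op_apply (M $ i $ j) (v $ j)) :: hardy ^ 'n) $ k = (\<Sum>i\<in>UNIV. if i = k then \<Sum>j\<in>UNIV. op_apply (M $ k $ j) (v $ j) else 0)" for k
    unfolding sum_component by (intro sum.cong refl) (auto simp: axis_def)
  then show ?thesis by (simp add: matrix_apply_def cvec_eq_iff)
qed

lemma bounded_clinear_matrix_apply: "bounded_clinear (matrix_apply R)"
  unfolding bounded_clinear_def
proof (intro conjI)
  show "bounded_linear (matrix_apply R)"
    unfolding matrix_apply_eq_sum_axis[abs_def]
    by (intro bounded_linear_sum bounded_linear_compose[OF bounded_linear_axis] bounded_linear_compose[OF _ bounded_linear_vec_nth])
      (use bounded_clinear_op in \<open>auto simp: bounded_clinear_def\<close>)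
  show "\<forall>c x. matrix_apply R (c *\<^sub>C x) = c *\<^sub>C matrix_apply R x"
    by (simp add: matrix_apply_def cvec_eq_iff scaleC_vec_def scaleC_sum_right)
qed

lemma orthonormal_basis_vec:
  assumes E: "orthonormal_basis (E :: 'a::complex_inner set)"
  shows "orthonormal_basis {axis i e | (i :: 'n::finite) e. e \<in> E}"
  unfolding orthonormal_basis_def
proof (intro conjI ballI allI impI)
  fix u v :: "'a ^ 'n" assume "u \<in> {axis i e | i e. e \<in> E}" "v \<in> {axis i e | i e. e \<in> E}"
  then obtain i e j f where uv: "u = axis i e" "v = axis j f" "e \<in> E" "f \<in> E" by blast
  have E1: "cinner e f = (if e = f then 1 else 0)" if "e \<in> E" "f \<in> E" for e f
    using E that unfolding orthonormal_basis_def by blast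
  have "e \<noteq> 0" using E1[OF uv(3,3)] by auto
  then have eq: "u = v \<longleftrightarrow> i = j \<and> e = f" by (auto simp: uv axis_eq_axis)
  have "cinner u v = cinner e (v $ i)" by (simp add: uv cinner_axis)
  also have "\<dots> = (if u = v then 1 else 0)"
    using E1[OF uv(3,4)] unfolding eq by (auto simp: uv axis_def)
  finally show "cinner u v = (if u = v then 1 else 0)" .
next
  fix x :: "'a ^ 'n" assume x: "\<forall>e\<in>{axis i e | i e. e \<in> E}. cinner e x = 0"
  have "x $ i = 0" for i
  proof -
    have "\<forall>e\<in>E. cinner e (x $ i) = 0" using x cinner_axis by (metis (mono_tags, lifting) mem_Collect_eq)
    then show ?thesis using E unfolding orthonormal_basis_def by blast
  qed
  then show "x = 0" by (simp add: cvec_eq_iff)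
qed

definition hardy3_basis :: "(hardy ^ 3) set" where "hardy3_basis = {axis i e | i e. e \<in> range hardy_monom}"

lemma orthonormal_basis_hardy3: "orthonormal_basis hardy3_basis"
  unfolding hardy3_basis_def by (rule orthonormal_basis_vec[OF orthonormal_basis_hardy])

definition trace_class_mat :: "hardy_op ^ 3 ^ 3 \<Rightarrow> bool" where "trace_class_mat M \<longleftrightarrow> (\<forall>i j. trace_class_op (M $ i $ j))"

lemma trace_class_axis:
  assumes "trace_class A"
  shows "trace_class (\<lambda>v :: 'a::complex_inner ^ 'n::finite. axis i (A (v $ j)))"
proof -
  from assms obtain x y where s: "summable (\<lambda>n. norm (x n) * norm (y n))"
    and A: "\<And>v. (\<lambda>n. cinner (y n) v *\<^sub>C x n) sums A v"
    unfolding trace_class_def by blast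
  have "(\<lambda>n. cinner (axis j (y n)) v *\<^sub>C axis i (x n)) sums axis i (A (v $ j))" for v :: "'a ^ 'n"
  proof -
    have "axis i (c *\<^sub>C w) = c *\<^sub>C (axis i w :: 'a ^ 'n)" for c w
      by (simp add: axis_def cvec_eq_iff scaleC_vec_def scaleC_zero_right)
    then show ?thesis
      using bounded_linear.sums[OF bounded_linear_axis[of i] A[of "v $ j"]] by (simp add: cinner_axis)
  qed
  moreover have "summable (\<lambda>n. norm (axis i (x n) :: 'a ^ 'n) * norm (axis j (y n) :: 'a ^ 'n))"
    using s by (simp add: norm_axis_eq)
  ultimately show ?thesis
    unfolding trace_class_def
    by (intro exI[of _ "\<lambda>n. axis i (x n)"] exI[of _ "\<lambda>n. axis j (y n)"]) blast
qed

lemma trace_class_0: "trace_class (\<lambda>v. 0)"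
  unfolding trace_class_def
  by (intro exI[of _ "\<lambda>n. 0"]) (simp add: scaleC_zero_right)

lemma trace_class_sum:
  "finite I \<Longrightarrow> (\<And>i. i \<in> I \<Longrightarrow> trace_class (A i)) \<Longrightarrow> trace_class (\<lambda>v. \<Sum>i\<in>I. A i v)"
  by (induction I rule: finite_induct) (auto simp: trace_class_0 trace_class_add)

lemma trace_class_matrix_apply: "trace_class_mat M \<Longrightarrow> trace_class (matrix_apply M)"
proof -
  assume M: "trace_class_mat M"
  have "trace_class (\<lambda>v :: hardy ^ 3. \<Sum>i\<in>UNIV. \<Sum>j\<in>UNIV. axis i (op_apply (M $ i $ j) (v $ j)) :: hardy ^ 3)"
    using M by (intro trace_class_sum trace_class_axis) (auto simp: trace_class_mat_def trace_class_op_def)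
  then show ?thesis by (simp only: matrix_apply_eq_sum_axis[symmetric])
qed

lemma trace_class_mat_add: "trace_class_mat M \<Longrightarrow> trace_class_mat N \<Longrightarrow> trace_class_mat (M + N)"
  by (simp add: trace_class_mat_def trace_class_op_add)

lemma trace_class_mat_diff: "trace_class_mat M \<Longrightarrow> trace_class_mat N \<Longrightarrow> trace_class_mat (M - N)"
  by (simp add: trace_class_mat_def trace_class_op_diff)

lemma trace_class_mat_mult_left: "trace_class_mat M \<Longrightarrow> trace_class_mat (A ** M)"
  by (simp add: trace_class_mat_def matrix_matrix_mult_def trace_class_op_sum trace_class_op_mult_left)

lemma trace_class_mat_mult_right: "trace_class_mat M \<Longrightarrow> trace_class_mat (M ** A)"
  by (simp add: trace_class_mat_def matrix_matrix_mult_def trace_class_op_sum trace_class_op_mult_right)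

lemma trace_class_mat_0: "trace_class_mat 0"
  by (simp add: trace_class_mat_def trace_class_op_0)

lemma matrix_diff_ldistrib: "A ** (B - C) = A ** B - A ** (C :: 'a::ring_1 ^ 'n ^ 'm)"
  by (simp add: matrix_matrix_mult_def cvec_eq_iff right_diff_distrib sum_subtractf)

lemma matrix_diff_rdistrib: "(B - C) ** A = B ** A - C ** (A :: 'a::ring_1 ^ 'n ^ 'm)"
  by (simp add: matrix_matrix_mult_def cvec_eq_iff left_diff_distrib sum_subtractf)

definition mdet :: "hardy_op ^ 3 ^ 3 \<Rightarrow> complex" where "mdet M = fredholm_det (matrix_apply M)"

lemma trace_class_matrix_apply_minus: "trace_class_mat (M - idm) \<Longrightarrow> trace_class (\<lambda>v. matrix_apply M v - v)"
  using trace_class_matrix_apply[of "M - idm"] by (simp add: matrix_apply_diff[abs_def] matrix_apply_1)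

lemma mdet_mult:
  assumes "trace_class_mat (M - idm)" "trace_class_mat (N - idm)"
  shows "mdet (M ** N) = mdet M * mdet N" "trace_class_mat (M ** N - idm)"
proof -
  show "mdet (M ** N) = mdet M * mdet N"
    unfolding mdet_def
    using fredholm_det_mult[OF orthonormal_basis_hardy3 bounded_clinear_matrix_apply[of M]
        trace_class_matrix_apply_minus[OF assms(1)] trace_class_matrix_apply_minus[OF assms(2)]]
    by (simp add: matrix_apply_mult[abs_def])
  have e: "M ** (N - idm) + (M - idm) = M ** N - idm" by (simp add: matrix_diff_ldistrib)
  show "trace_class_mat (M ** N - idm)"
    using trace_class_mat_add[OF trace_class_mat_mult_left[OF assms(2), of M] assms(1)] by (simp only: e)
qed

lemma mdet_conj:
  assumes M: "trace_class_mat (M - idm)" and "G ** H = idm" "H ** G = idm"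
  shows "mdet (G ** M ** H) = mdet M" "trace_class_mat (G ** M ** H - idm)"
proof -
  have HG: "matrix_apply H (matrix_apply G v) = v" "matrix_apply G (matrix_apply H v) = v" for v
    using assms(2,3) by (simp_all add: matrix_apply_mult[symmetric] matrix_apply_1)
  show "mdet (G ** M ** H) = mdet M"
    unfolding mdet_def
    using fredholm_det_conj(1)[OF orthonormal_basis_hardy3 bounded_clinear_matrix_apply[of G]
        bounded_clinear_matrix_apply[of H] HG trace_class_matrix_apply_minus[OF M]]
    by (simp add: matrix_apply_mult[abs_def])
  have "G ** M ** H - idm = G ** (M - idm) ** H"
    by (simp add: matrix_diff_ldistrib matrix_diff_rdistrib assms(2))
  then show "trace_class_mat (G ** M ** H - idm)" using M by (simp add: trace_class_mat_mult_left trace_class_mat_mult_right)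
qed

lemma mdet_1: "mdet idm = 1"
  using fredholm_det_rank_two[OF orthonormal_basis_hardy3, where T = "matrix_apply idm" and a = 0 and b = 0 and p = 0 and q = 0]
  by (simp add: matrix_apply_1 mdet_def)

section \<open>Commutators\<close>

text \<open>Inverses are carried along explicitly, since the inverses of the lifts used here are
  given by formulas.\<close>

definition inv_pair :: "hardy_op ^ 3 ^ 3 \<Rightarrow> hardy_op ^ 3 ^ 3 \<Rightarrow> bool" where
  "inv_pair R R' \<longleftrightarrow> R ** R' = idm \<and> R' ** R = idm"

lemma inv_pair_cancel:
  assumes "inv_pair R R'"
  shows "R ** R' = idm" "R' ** R = idm" "R ** (R' ** X) = X" "R' ** (R ** X) = X"
  using assms by (simp_all add: inv_pair_def matrix_mul_assoc)

lemma matrix_inv_eq: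
  assumes "inv_pair R R'" shows "matrix_inv R = R'"
proof -
  have "R ** matrix_inv R = idm \<and> matrix_inv R ** R = idm"
    unfolding matrix_inv_def by (rule someI[of "\<lambda>A'. R ** A' = idm \<and> A' ** R = idm" R']) (use assms in \<open>simp add: inv_pair_def\<close>)
  then have "R' ** (R ** matrix_inv R) = R'" by simp
  then show ?thesis by (simp add: inv_pair_cancel[OF assms])
qed

lemma trace_class_mat_commutator:
  assumes "inv_pair R R'" "inv_pair S S'" "trace_class_mat (R ** S - S ** R)"
  shows "trace_class_mat (R ** S ** R' ** S' - idm)"
proof -
  have "R ** S ** R' ** S' - idm = (R ** S - S ** R) ** (R' ** S')"
    unfolding matrix_diff_rdistrib
    by (simp add: matrix_mul_assoc[symmetric] inv_pair_cancel[OF assms(1)] inv_pair_cancel[OF assms(2)])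
  then show ?thesis using trace_class_mat_mult_right[OF assms(3)] by simp
qed

text \<open>The two commutators are inverse to each other.\<close>

lemma mdet_commutator_swap:
  assumes R: "inv_pair R R'" and S: "inv_pair S S'" and c: "trace_class_mat (R ** S - S ** R)"
  shows "mdet (R ** S ** R' ** S') * mdet (S ** R ** S' ** R') = 1"
proof -
  have c': "trace_class_mat (S ** R - R ** S)" using trace_class_mat_diff[OF trace_class_mat_0 c] by simp
  have "mdet (R ** S ** R' ** S') * mdet (S ** R ** S' ** R') =
      mdet ((R ** S ** R' ** S') ** (S ** R ** S' ** R'))"
    by (rule mdet_mult(1)[symmetric]; rule trace_class_mat_commutator) (use R S c c' in auto)
  also have "(R ** S ** R' ** S') ** (S ** R ** S' ** R') = idm"
    by (simp add: matrix_mul_assoc[symmetric] inv_pair_cancel[OF R] inv_pair_cancel[OF S])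
  finally show ?thesis by (simp add: mdet_1)
qed

text \<open>The identity \<open>[R Q, S] = (R [Q, S] R\<inverse>) [R, S]\<close>.\<close>

lemma mdet_commutator_mult:
  assumes R1: "inv_pair R1 R1'" and R2: "inv_pair R2 R2'" and S: "inv_pair S S'"
    and c: "trace_class_mat (R1 ** S - S ** R1)" "trace_class_mat (R2 ** S - S ** R2)"
  shows "mdet ((R1 ** R2) ** S ** (R2' ** R1') ** S') = mdet (R1 ** S ** R1' ** S') * mdet (R2 ** S ** R2' ** S')"
proof -
  have t: "trace_class_mat (R1 ** S ** R1' ** S' - idm)" "trace_class_mat (R2 ** S ** R2' ** S' - idm)"
    by (rule trace_class_mat_commutator; fact)+
  have "(R1 ** R2) ** S ** (R2' ** R1') ** S' = (R1 ** (R2 ** S ** R2' ** S') ** R1') ** (R1 ** S ** R1' ** S')"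
    by (simp add: matrix_mul_assoc[symmetric] inv_pair_cancel[OF R1] inv_pair_cancel[OF S])
  then show ?thesis
    using mdet_mult(1)[OF mdet_conj(2)[OF t(2) inv_pair_cancel(1,2)[OF R1]] t(1)]
      mdet_conj(1)[OF t(2) inv_pair_cancel(1,2)[OF R1]] by simp
qed

text \<open>Write \<open>Q = R K\<close> with \<open>K\<close> in identity plus trace class. The
  commutator \<open>[K, S]\<close> is the product of \<open>K\<close> and a conjugate of the
  inverse of \<open>K\<close>, both of which have determinants, so its determinant is one.\<close>

lemma mdet_commutator_perturb_left:
  assumes R: "inv_pair R R'" and Q: "inv_pair Q Q'" and S: "inv_pair S S'"
    and c: "trace_class_mat (R ** S - S ** R)" and d: "trace_class_mat (Q - R)"
  shows "mdet (Q ** S ** Q' ** S') = mdet (R ** S ** R' ** S')"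
proof -
  \<comment> \<open>The factor by which the two lifts differ.\<close>
  define K where "K = R' ** Q"
  define K' where "K' = Q' ** R"
  have K: "inv_pair K K'"
    by (simp add: inv_pair_def K_def K'_def matrix_mul_assoc[symmetric] inv_pair_cancel[OF R] inv_pair_cancel[OF Q])
  have "K - idm = R' ** (Q - R)"
    by (simp add: K_def matrix_diff_ldistrib inv_pair_cancel[OF R])
  then have tK: "trace_class_mat (K - idm)" using trace_class_mat_mult_left[OF d] by simp
  have "K' - idm = Q' ** (0 - (Q - R))"
    by (simp add: K'_def matrix_diff_ldistrib inv_pair_cancel[OF Q])
  then have tK': "trace_class_mat (K' - idm)" using trace_class_mat_mult_left[OF trace_class_mat_diff[OF trace_class_mat_0 d]] by simp
  have cK: "trace_class_mat (K ** S - S ** K)"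
  proof -
    have "K ** S - S ** K = (K - idm) ** S - S ** (K - idm)"
      by (simp add: matrix_diff_ldistrib matrix_diff_rdistrib)
    then show ?thesis using tK by (simp add: trace_class_mat_diff trace_class_mat_mult_left trace_class_mat_mult_right)
  qed
  have "K ** S ** K' ** S' = K ** (S ** K' ** S')" by (simp add: matrix_mul_assoc)
  then have "mdet (K ** S ** K' ** S') = mdet K * mdet K'"
    using mdet_mult(1)[OF tK mdet_conj(2)[OF tK' inv_pair_cancel(1,2)[OF S]]] mdet_conj(1)[OF tK' inv_pair_cancel(1,2)[OF S]] by simp
  also have "\<dots> = mdet (K ** K')" by (rule mdet_mult(1)[OF tK tK', symmetric])
  also have "\<dots> = 1" by (simp add: inv_pair_cancel[OF K] mdet_1)
  finally have 1: "mdet (K ** S ** K' ** S') = 1" .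
  have "R ** K = Q" "K' ** R' = Q'"
    by (simp_all add: K_def K'_def matrix_mul_assoc[symmetric] inv_pair_cancel[OF R])
  then show ?thesis
    using mdet_commutator_mult[OF R K S c cK] 1 by simp
qed

lemma mdet_commutator_perturb_right:
  assumes R: "inv_pair R R'" and Q: "inv_pair Q Q'" and S: "inv_pair S S'"
    and c: "trace_class_mat (R ** S - S ** R)" and d: "trace_class_mat (Q - S)"
  shows "mdet (R ** Q ** R' ** Q') = mdet (R ** S ** R' ** S')"
proof -
  have c': "trace_class_mat (S ** R - R ** S)" using trace_class_mat_diff[OF trace_class_mat_0 c] by simp
  have "R ** Q - Q ** R = R ** (Q - S) - (Q - S) ** R + (R ** S - S ** R)"
    by (simp add: matrix_diff_ldistrib matrix_diff_rdistrib)
  then have cQ: "trace_class_mat (R ** Q - Q ** R)"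
    using c d by (simp add: trace_class_mat_add trace_class_mat_diff trace_class_mat_mult_left trace_class_mat_mult_right)
  have "mdet (Q ** R ** Q' ** R') = mdet (S ** R ** S' ** R')"
    by (rule mdet_commutator_perturb_left[OF S Q R c' d])
  then show ?thesis
    using mdet_commutator_swap[OF R Q cQ] mdet_commutator_swap[OF R S c]
    by (metis mult_cancel_right mult_zero_right zero_neq_one)
qed

text \<open>Exchanging the two entries of a commutator inverts its determinant, so this follows
  from multiplicativity on the left.\<close>

lemma mdet_commutator_mult_right:
  assumes R: "inv_pair R R'" and S: "inv_pair S S'" and Q: "inv_pair Q Q'"
    and c: "trace_class_mat (R ** S - S ** R)" "trace_class_mat (R ** Q - Q ** R)"
  shows "mdet (R ** (S ** Q) ** R' ** (Q' ** S')) = mdet (R ** S ** R' ** S') * mdet (R ** Q ** R' ** Q')"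
proof -
  have c': "trace_class_mat (S ** R - R ** S)" "trace_class_mat (Q ** R - R ** Q)"
    using trace_class_mat_diff[OF trace_class_mat_0 c(1)] trace_class_mat_diff[OF trace_class_mat_0 c(2)] by simp_all
  have i: "inv_pair (S ** Q) (Q' ** S')"
    by (simp add: inv_pair_def matrix_mul_assoc[symmetric] inv_pair_cancel[OF S] inv_pair_cancel[OF Q])
  have "R ** (S ** Q) - (S ** Q) ** R = (R ** S - S ** R) ** Q + S ** (R ** Q - Q ** R)"
    by (simp add: matrix_diff_ldistrib matrix_diff_rdistrib matrix_mul_assoc)
  then have cc: "trace_class_mat (R ** (S ** Q) - (S ** Q) ** R)"
    using c by (simp add: trace_class_mat_add trace_class_mat_mult_left trace_class_mat_mult_right)
  have "mdet (R ** (S ** Q) ** R' ** (Q' ** S')) * (mdet (S ** R ** S' ** R') * mdet (Q ** R ** Q' ** R')) = 1"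
    using mdet_commutator_swap[OF R i cc] mdet_commutator_mult[OF S Q R c'] by simp
  moreover have "mdet (R ** S ** R' ** S') * mdet (S ** R ** S' ** R') = 1" "mdet (R ** Q ** R' ** Q') * mdet (Q ** R ** Q' ** R') = 1"
    by (intro mdet_commutator_swap R S Q c)+
  moreover have "x = u * v" if "x * (d * e) = 1" "u * d = 1" "v * e = 1" for x u v d e :: complex
  proof -
    have "x = x * ((u * d) * (v * e))" using that by simp
    also have "\<dots> = (x * (d * e)) * (u * v)" by (simp only: mult_ac)
    finally show ?thesis using that by simp
  qed
  ultimately show ?thesis by blast
qed

section \<open>Orders and leading coefficients\<close>

text \<open>Order \<open>n\<close> and leading coefficient \<open>c\<close> of the Laurent
  expansion at \<open>z\<close>, expressed by a limit: in this form products and inverses are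
  immediate and no singularity theory is needed to verify it for given functions.\<close>

definition has_order :: "(complex \<Rightarrow> complex) \<Rightarrow> complex \<Rightarrow> int \<Rightarrow> complex \<Rightarrow> bool" where
  "has_order F z n c \<longleftrightarrow> c \<noteq> 0 \<and> ((\<lambda>w. F w * (w - z) powi (- n)) \<longlongrightarrow> c) (at z)"

lemma has_order_mult:
  assumes "has_order F z m c" "has_order G z n d"
  shows "has_order (\<lambda>w. F w * G w) z (m + n) (c * d)"
proof -
  have "((\<lambda>w. (F w * (w - z) powi (- m)) * (G w * (w - z) powi (- n))) \<longlongrightarrow> c * d) (at z)"
    using assms by (intro tendsto_mult) (auto simp: has_order_def)
  then have "((\<lambda>w. F w * G w * (w - z) powi (- (m + n))) \<longlongrightarrow> c * d) (at z)"
  proof (rule Lim_transform_eventually)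
    show "\<forall>\<^sub>F w in at z. (F w * (w - z) powi (- m)) * (G w * (w - z) powi (- n)) = F w * G w * (w - z) powi (- (m + n))"
      unfolding eventually_at_filter
    proof (intro always_eventually allI impI)
      fix w assume "w \<noteq> z"
      then have "(w - z) powi (- (m + n)) = (w - z) powi (- m) * (w - z) powi (- n)"
        using power_int_add[of "w - z" "- m" "- n"] by simp
      then show "(F w * (w - z) powi (- m)) * (G w * (w - z) powi (- n)) = F w * G w * (w - z) powi (- (m + n))"
        by (simp only: mult_ac)
    qed
  qed
  then show ?thesis using assms by (simp add: has_order_def)
qed

lemma has_order_inverse:
  assumes "has_order F z m c"
  shows "has_order (\<lambda>w. inverse (F w)) z (- m) (inverse c)"
proof -
  have "((\<lambda>w. inverse (F w * (w - z) powi (- m))) \<longlongrightarrow> inverse c) (at z)"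
    using assms by (intro tendsto_inverse) (auto simp: has_order_def)
  then show ?thesis
    using assms by (simp add: has_order_def power_int_minus)
qed

lemma has_order_continuous:
  assumes "isCont F z" "F z \<noteq> 0"
  shows "has_order F z 0 (F z)"
  using assms by (simp add: has_order_def isCont_def)

lemma has_order_linear: "has_order (\<lambda>w. w - a) a 1 1"
proof -
  have "((\<lambda>w. 1) \<longlongrightarrow> (1::complex)) (at a)" by simp
  then have "((\<lambda>w. (w - a) * (w - a) powi (- 1)) \<longlongrightarrow> 1) (at a)"
  proof (rule Lim_transform_eventually)
    show "\<forall>\<^sub>F w in at a. 1 = (w - a) * (w - a) powi (- 1)"
      unfolding eventually_at_filter by (rule always_eventually) (auto simp: power_int_minus)
  qed
  then show ?thesis by (simp add: has_order_def)
qed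

lemma has_order_cong:
  assumes "\<forall>\<^sub>F w in at z. F w = G w" "has_order F z n c"
  shows "has_order G z n c"
proof -
  have "((\<lambda>w. G w * (w - z) powi (- n)) \<longlongrightarrow> c) (at z)"
  proof (rule Lim_transform_eventually)
    show "((\<lambda>w. F w * (w - z) powi (- n)) \<longlongrightarrow> c) (at z)" using assms(2) by (simp add: has_order_def)
    show "\<forall>\<^sub>F w in at z. F w * (w - z) powi (- n) = G w * (w - z) powi (- n)"
      using assms(1) by eventually_elim simp
  qed
  then show ?thesis using assms(2) by (simp add: has_order_def)
qed

text \<open>Applied in both directions, this gives uniqueness of the order.\<close>

lemma has_order_le:
  assumes "has_order F z m c" "has_order F z n d"
  shows "n \<le> m"
proof (rule ccontr)
  assume "\<not> n \<le> m"
  then obtain k where k: "n - m = int k" "k > 0" by (metis diff_gt_0_iff_gt not_le zero_less_imp_eq_int)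
  have "((\<lambda>w. (F w * (w - z) powi (- n)) * (w - z) ^ k) \<longlongrightarrow> d * (z - z) ^ k) (at z)"
    using assms(2) unfolding has_order_def by (intro tendsto_intros) auto
  then have "((\<lambda>w. F w * (w - z) powi (- m)) \<longlongrightarrow> d * (z - z) ^ k) (at z)"
  proof (rule Lim_transform_eventually)
    have "- n + int k = - m" using k by simp
    then have "(w - z) powi (- n) * (w - z) ^ k = (w - z) powi (- m)" if "w \<noteq> z" for w
      using power_int_add[of "w - z" "- n" "int k"] that by simp
    then show "\<forall>\<^sub>F w in at z. F w * (w - z) powi (- n) * (w - z) ^ k = F w * (w - z) powi (- m)"
      unfolding eventually_at_filter by (intro always_eventually) (auto simp: mult.assoc)
  qed
  then have "d * (z - z) ^ k = c"
    using assms(1) unfolding has_order_def by (intro tendsto_unique[of "at z"]) auto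
  then show False using assms(1) k by (simp add: has_order_def power_0_left)
qed

lemma has_order_frequently:
  assumes "has_order F z n c" shows "\<exists>\<^sub>F w in at z. F w \<noteq> 0"
proof (rule ccontr)
  assume "\<not> (\<exists>\<^sub>F w in at z. F w \<noteq> 0)"
  then have "\<forall>\<^sub>F w in at z. F w = 0" by (simp add: not_frequently)
  then have "\<forall>\<^sub>F w in at z. 0 = F w * (w - z) powi (- n)" by eventually_elim simp
  then have "((\<lambda>w. F w * (w - z) powi (- n)) \<longlongrightarrow> 0) (at z)"
    by (rule Lim_transform_eventually[OF tendsto_const])
  then have "c = 0" using assms unfolding has_order_def by (intro tendsto_unique[of "at z"]) auto
  then show False using assms by (simp add: has_order_def)
qed

text \<open>The leading coefficient is the value at \<open>z\<close> of the zero-free part of the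
  local factorization.\<close>

lemma meromorphic_has_order_zorder:
  assumes "F meromorphic_on {z}" "\<exists>\<^sub>F w in at z. F w \<noteq> 0"
  shows "\<exists>c. has_order F z (zorder F z) c"
proof -
  have "isolated_singularity_at F z" "not_essential F z"
    using assms(1) by (auto simp: meromorphic_at_iff)
  from zorder_exist[OF this assms(2)] obtain r where
    g: "zor_poly F z z \<noteq> 0" "r > 0" "zor_poly F z holomorphic_on cball z r"
      "\<And>w. w \<in> cball z r - {z} \<Longrightarrow> F w = zor_poly F z w * (w - z) powi zorder F z"
    by blast
  have "isCont (zor_poly F z) z"
    using holomorphic_on_imp_continuous_on[OF g(3)] g(2)
    by (auto intro: continuous_on_interior)
  then have "(zor_poly F z \<longlongrightarrow> zor_poly F z z) (at z)" by (simp add: isCont_def)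
  then have "((\<lambda>w. F w * (w - z) powi (- zorder F z)) \<longlongrightarrow> zor_poly F z z) (at z)"
  proof (rule Lim_transform_eventually)
    have "\<forall>\<^sub>F w in at z. w \<in> cball z r - {z}"
      using eventually_at_in_open[of "ball z r" z] g(2) by (auto elim: eventually_mono)
    then show "\<forall>\<^sub>F w in at z. zor_poly F z w = F w * (w - z) powi (- zorder F z)"
    proof eventually_elim
      case (elim w)
      then show ?case by (simp add: g(4) power_int_minus field_simps)
    qed
  qed
  with g(1) show ?thesis by (auto simp: has_order_def)
qed

lemma zorder_eq_of_has_order:
  assumes "F meromorphic_on {z}" "has_order F z n c"
  shows "zorder F z = n"
  using meromorphic_has_order_zorder[OF assms(1) has_order_frequently[OF assms(2)]] assms(2) has_order_le
  by (metis antisym)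

definition tame_value :: "int \<Rightarrow> complex \<Rightarrow> int \<Rightarrow> complex \<Rightarrow> complex" where
  "tame_value m c n d = (-1) powi (m * n) * (d powi m / c powi n)"

definition tame_at :: "(complex \<Rightarrow> complex) \<Rightarrow> (complex \<Rightarrow> complex) \<Rightarrow> complex \<Rightarrow> complex" where
  "tame_at F G z = (let m = zorder F z; n = zorder G z
      in Lim (at z) (\<lambda>w. (-1) powi (m * n) * (G w powi m / F w powi n)))"

text \<open>The powers of \<open>w - z\<close> in numerator and denominator cancel, so only the
  leading coefficients contribute to the limit.\<close>

lemma tame_at_eq:
  assumes F: "F meromorphic_on {z}" "has_order F z m c" and G: "G meromorphic_on {z}" "has_order G z n d"
  shows "tame_at F G z = tame_value m c n d"
proof -
  have cd: "c \<noteq> 0" "d \<noteq> 0" using F G by (auto simp: has_order_def)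
  have "((\<lambda>w. (-1) powi (m * n) * ((G w * (w - z) powi (- n)) powi m / (F w * (w - z) powi (- m)) powi n)) \<longlongrightarrow> tame_value m c n d) (at z)"
    unfolding tame_value_def using F(2) G(2) cd by (intro tendsto_intros) (auto simp: has_order_def)
  then have "((\<lambda>w. (-1) powi (m * n) * (G w powi m / F w powi n)) \<longlongrightarrow> tame_value m c n d) (at z)"
  proof (rule Lim_transform_eventually)
    have "(g * x powi (- n)) powi m / (f * x powi (- m)) powi n = g powi m / f powi n" if "x \<noteq> 0" for f g x :: complex
    proof -
      have "(x powi (- n)) powi m = (x powi (- m)) powi n"
        by (simp add: power_int_mult[symmetric] mult.commute)
      then show ?thesis using that by (simp add: power_int_mult_distrib)
    qed
    then show "\<forall>\<^sub>F w in at z. (-1) powi (m * n) * ((G w * (w - z) powi (- n)) powi m / (F w * (w - z) powi (- m)) powi n) =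
        (-1) powi (m * n) * (G w powi m / F w powi n)"
      unfolding eventually_at_filter by (intro always_eventually) auto
  qed
  then show ?thesis
    by (simp add: tame_at_def Let_def zorder_eq_of_has_order[OF F] zorder_eq_of_has_order[OF G] tendsto_Lim)
qed

lemma neg_one_powi_add: "(-1 :: complex) powi (a + b) = (-1) powi a * (-1) powi b"
  by (rule power_int_add) simp

lemma tame_value_mult_left: "c \<noteq> 0 \<Longrightarrow> c' \<noteq> 0 \<Longrightarrow> d \<noteq> 0 \<Longrightarrow> tame_value (m + m') (c * c') n d = tame_value m c n d * tame_value m' c' n d"
  by (simp add: tame_value_def distrib_right neg_one_powi_add power_int_add power_int_mult_distrib)

lemma tame_value_mult_right: "c \<noteq> 0 \<Longrightarrow> d \<noteq> 0 \<Longrightarrow> d' \<noteq> 0 \<Longrightarrow> tame_value m c (n + n') (d * d') = tame_value m c n d * tame_value m c n' d'"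
  by (simp add: tame_value_def distrib_left neg_one_powi_add power_int_add power_int_mult_distrib)

lemma has_order_hol:
  assumes "h analytic_on cball 0 1" "\<And>z. z \<in> cball 0 1 \<Longrightarrow> h z \<noteq> 0" "z \<in> ball 0 1"
  shows "has_order h z 0 (h z)"
proof (rule has_order_continuous)
  show "isCont h z" using assms(1,3)
    by (meson analytic_at_imp_isCont analytic_on_analytic_at ball_subset_cball subsetD)
qed (use assms in auto)

lemma has_order_lin_other: "z \<noteq> a \<Longrightarrow> has_order (\<lambda>w. w - a) z 0 (z - a)"
  by (rule has_order_continuous) (auto intro!: continuous_intros)

section \<open>Products of linear factors and zero-free functions\<close>

text \<open>These are actual functions on the plane and not classes modulo equality on the circle;
  where an inverted factor vanishes, the value is zero by convention, which is harmless because
  only punctured germs and values on the circle matter.\<close>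

inductive factorable :: "(complex \<Rightarrow> complex) \<Rightarrow> bool" where
  hol: "h analytic_on cball 0 1 \<Longrightarrow> (\<And>z. z \<in> cball 0 1 \<Longrightarrow> h z \<noteq> 0) \<Longrightarrow> factorable h"
| lin: "a \<in> ball 0 1 \<Longrightarrow> factorable (\<lambda>z. z - a)"
| mult: "factorable F \<Longrightarrow> factorable G \<Longrightarrow> factorable (\<lambda>z. F z * G z)"
| inv: "factorable F \<Longrightarrow> factorable (\<lambda>z. inverse (F z))"

lemma factorable_circle:
  assumes "factorable F"
  shows "F analytic_on circle \<and> (\<forall>z\<in>circle. F z \<noteq> 0)"
  using assms
proof induction
  case (hol h)
  then show ?case using analytic_on_subset[OF hol(1), of circle] by auto
next
  case (lin a)
  then show ?case by (auto intro!: analytic_intros)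
qed (auto intro!: analytic_intros)

lemma factorable_one: "factorable (\<lambda>z. 1)"
  by (rule factorable.hol) (auto intro: analytic_intros)

lemma factorable_meromorphic: "factorable F \<Longrightarrow> F meromorphic_on cball 0 1"
proof (induction rule: factorable.induct)
  case (hol h)
  then show ?case by (intro analytic_on_imp_meromorphic_on)
qed (intro meromorphic_intros; assumption)+

lemma factorable_meromorphic_at: "factorable F \<Longrightarrow> z \<in> ball 0 1 \<Longrightarrow> F meromorphic_on {z}"
  by (rule meromorphic_on_subset[OF factorable_meromorphic]) auto

text \<open>Finiteness of the set of zeros and poles is needed for the product of tame symbols to
  be multiplicative.\<close>

lemma factorable_order:
  assumes "factorable F"
  shows "(\<forall>z\<in>ball 0 1. \<exists>n c. has_order F z n c) \<and> finite {z \<in> ball 0 1. \<forall>c. \<not> has_order F z 0 c}"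
  using assms
proof induction
  case (hol h)
  have h: "has_order h z 0 (h z)" if "z \<in> ball 0 1" for z
    using hol that by (rule has_order_hol)
  then have "{z \<in> ball 0 1. \<forall>c. \<not> has_order h z 0 c} = {}" by blast
  with h show ?case by (metis finite.emptyI)
next
  case (lin a)
  have h: "has_order (\<lambda>z. z - a) z 0 (z - a)" if "z \<noteq> a" for z
    using that by (rule has_order_lin_other)
  then have "{z \<in> ball 0 1. \<forall>c. \<not> has_order (\<lambda>z. z - a) z 0 c} \<subseteq> {a}" by blast
  then have "finite {z \<in> ball 0 1. \<forall>c. \<not> has_order (\<lambda>z. z - a) z 0 c}" by (rule finite_subset) simp
  with h has_order_linear show ?case by metis
next
  case (mult F G)
  have "{z \<in> ball 0 1. \<forall>c. \<not> has_order (\<lambda>z. F z * G z) z 0 c} \<subseteq>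
      {z \<in> ball 0 1. \<forall>c. \<not> has_order F z 0 c} \<union> {z \<in> ball 0 1. \<forall>c. \<not> has_order G z 0 c}"
    using has_order_mult[of F _ 0 _ G 0] by auto
  moreover have "finite ({z \<in> ball 0 1. \<forall>c. \<not> has_order F z 0 c} \<union> {z \<in> ball 0 1. \<forall>c. \<not> has_order G z 0 c})"
    using mult.IH by blast
  ultimately have "finite {z \<in> ball 0 1. \<forall>c. \<not> has_order (\<lambda>z. F z * G z) z 0 c}" by (rule finite_subset)
  moreover have "\<forall>z\<in>ball 0 1. \<exists>n c. has_order (\<lambda>z. F z * G z) z n c"
    using mult.IH has_order_mult by meson
  ultimately show ?case by blast
next
  case (inv F)
  have "{z \<in> ball 0 1. \<forall>c. \<not> has_order (\<lambda>z. inverse (F z)) z 0 c} \<subseteq> {z \<in> ball 0 1. \<forall>c. \<not> has_order F z 0 c}"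
    using has_order_inverse[of F _ 0] by auto
  then have "finite {z \<in> ball 0 1. \<forall>c. \<not> has_order (\<lambda>z. inverse (F z)) z 0 c}"
    using inv.IH finite_subset by blast
  moreover have "\<forall>z\<in>ball 0 1. \<exists>n c. has_order (\<lambda>z. inverse (F z)) z n c"
    using inv.IH has_order_inverse by meson
  ultimately show ?case by blast
qed

section \<open>Multiplicativity of the tame product\<close>

text \<open>The same expression as in \<^const>\<open>tame_pi\<close>, but for an explicit
  extension instead of the chosen one.\<close>

definition tame_prod :: "(complex \<Rightarrow> complex) \<Rightarrow> (complex \<Rightarrow> complex) \<Rightarrow> complex" where
  "tame_prod F G = (\<Prod>z\<in>{z \<in> ball 0 1. tame_at F G z \<noteq> 1}. inverse (tame_at F G z))"

lemma finite_tame_support: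
  assumes "factorable F" "factorable G"
  shows "finite {z \<in> ball 0 1. tame_at F G z \<noteq> 1}"
proof (rule finite_subset)
  show "{z \<in> ball 0 1. tame_at F G z \<noteq> 1} \<subseteq>
      {z \<in> ball 0 1. \<forall>c. \<not> has_order F z 0 c} \<union> {z \<in> ball 0 1. \<forall>c. \<not> has_order G z 0 c}"
  proof (rule subsetI, rule ccontr)
    fix z assume z: "z \<in> {z \<in> ball 0 1. tame_at F G z \<noteq> 1}"
      "z \<notin> {z \<in> ball 0 1. \<forall>c. \<not> has_order F z 0 c} \<union> {z \<in> ball 0 1. \<forall>c. \<not> has_order G z 0 c}"
    then have zb: "z \<in> ball 0 1" by blast
    from z obtain c d where "has_order F z 0 c" "has_order G z 0 d" by blast
    then have "tame_at F G z = tame_value 0 c 0 d"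
      using assms zb by (intro tame_at_eq factorable_meromorphic_at)
    with z(1) show False by (simp add: tame_value_def)
  qed
  show "finite ({z \<in> ball 0 1. \<forall>c. \<not> has_order F z 0 c} \<union> {z \<in> ball 0 1. \<forall>c. \<not> has_order G z 0 c})"
    using factorable_order assms by blast
qed

lemma tame_prod_superset:
  assumes "finite S" "S \<subseteq> ball 0 1" "\<And>z. z \<in> ball 0 1 \<Longrightarrow> z \<notin> S \<Longrightarrow> tame_at F G z = 1"
  shows "tame_prod F G = (\<Prod>z\<in>S. inverse (tame_at F G z))"
  unfolding tame_prod_def by (rule prod.mono_neutral_left) (use assms in auto)

lemma tame_prod_eq_mult:
  assumes t: "\<And>z. z \<in> ball 0 1 \<Longrightarrow> tame_at F G z = tame_at F1 G1 z * tame_at F2 G2 z"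
    and f: "finite {z \<in> ball 0 1. tame_at F1 G1 z \<noteq> 1}" "finite {z \<in> ball 0 1. tame_at F2 G2 z \<noteq> 1}"
  shows "tame_prod F G = tame_prod F1 G1 * tame_prod F2 G2"
proof -
  define S where "S = {z \<in> ball 0 1. tame_at F1 G1 z \<noteq> 1} \<union> {z \<in> ball 0 1. tame_at F2 G2 z \<noteq> 1}"
  have S: "finite S" "S \<subseteq> ball 0 1" using f by (auto simp: S_def)
  have "tame_prod F G = (\<Prod>z\<in>S. inverse (tame_at F G z))"
    by (rule tame_prod_superset[OF S]) (auto simp: S_def t)
  also have "\<dots> = (\<Prod>z\<in>S. inverse (tame_at F1 G1 z) * inverse (tame_at F2 G2 z))"
    using S by (intro prod.cong refl) (auto simp: t)
  also have "\<dots> = tame_prod F1 G1 * tame_prod F2 G2"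
    unfolding prod.distrib
    by (intro arg_cong2[where f = "(*)"] tame_prod_superset[OF S, symmetric]) (auto simp: S_def)
  finally show ?thesis .
qed

lemma tame_prod_mult_left:
  assumes "factorable F" "factorable F'" "factorable G"
  shows "tame_prod (\<lambda>z. F z * F' z) G = tame_prod F G * tame_prod F' G"
proof (rule tame_prod_eq_mult)
  fix z :: complex assume z: "z \<in> ball 0 1"
  obtain m c where F: "has_order F z m c" using factorable_order[OF assms(1)] z by blast
  obtain m' c' where F': "has_order F' z m' c'" using factorable_order[OF assms(2)] z by blast
  obtain n d where G: "has_order G z n d" using factorable_order[OF assms(3)] z by blast
  have nz: "c \<noteq> 0" "c' \<noteq> 0" "d \<noteq> 0" using F F' G by (auto simp: has_order_def)
  note m = factorable_meromorphic_at[OF _ z]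
  have "tame_at (\<lambda>z. F z * F' z) G z = tame_value (m + m') (c * c') n d"
    by (rule tame_at_eq[OF m[OF factorable.mult[OF assms(1,2)]] has_order_mult[OF F F'] m[OF assms(3)] G])
  also have "\<dots> = tame_at F G z * tame_at F' G z"
    by (simp only: tame_value_mult_left[OF nz] tame_at_eq[OF m[OF assms(1)] F m[OF assms(3)] G]
        tame_at_eq[OF m[OF assms(2)] F' m[OF assms(3)] G])
  finally show "tame_at (\<lambda>z. F z * F' z) G z = tame_at F G z * tame_at F' G z" .
qed (intro finite_tame_support assms)+

lemma tame_prod_mult_right:
  assumes "factorable F" "factorable G" "factorable G'"
  shows "tame_prod F (\<lambda>z. G z * G' z) = tame_prod F G * tame_prod F G'"
proof (rule tame_prod_eq_mult)
  fix z :: complex assume z: "z \<in> ball 0 1"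
  obtain m c where F: "has_order F z m c" using factorable_order[OF assms(1)] z by blast
  obtain n d where G: "has_order G z n d" using factorable_order[OF assms(2)] z by blast
  obtain n' d' where G': "has_order G' z n' d'" using factorable_order[OF assms(3)] z by blast
  have nz: "c \<noteq> 0" "d \<noteq> 0" "d' \<noteq> 0" using F G' G by (auto simp: has_order_def)
  note m = factorable_meromorphic_at[OF _ z]
  have "tame_at F (\<lambda>z. G z * G' z) z = tame_value m c (n + n') (d * d')"
    by (rule tame_at_eq[OF m[OF assms(1)] F m[OF factorable.mult[OF assms(2,3)]] has_order_mult[OF G G']])
  also have "\<dots> = tame_at F G z * tame_at F G' z"
    by (simp only: tame_value_mult_right[OF nz] tame_at_eq[OF m[OF assms(1)] F m[OF assms(2)] G]
        tame_at_eq[OF m[OF assms(1)] F m[OF assms(3)] G'])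
  finally show "tame_at F (\<lambda>z. G z * G' z) z = tame_at F G z * tame_at F G' z" .
qed (intro finite_tame_support assms)+

text \<open>In the form of a product, this also says that the values are nonzero.\<close>

lemma tame_prod_inverse:
  assumes F: "factorable F" and G: "factorable G"
  shows "tame_prod (\<lambda>z. inverse (F z)) G * tame_prod F G = 1"
    and "tame_prod F (\<lambda>z. inverse (G z)) * tame_prod F G = 1"
proof -
  have h1: "has_order (\<lambda>w. inverse (F w) * F w) z 0 1" if F: "has_order F z n c" for F z n c
  proof -
    have "c \<noteq> 0" using F by (simp add: has_order_def)
    then show ?thesis using has_order_mult[OF has_order_inverse[OF F] F] by simp
  qed
  have t0: "tame_prod K L = 1" if "\<And>z. z \<in> ball 0 1 \<Longrightarrow> tame_at K L z = 1" for K L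
    using that unfolding tame_prod_def by (intro prod.neutral) auto
  have "tame_at (\<lambda>w. inverse (F w) * F w) G z = 1" if z: "z \<in> ball 0 1" for z
  proof -
    obtain m c where Fo: "has_order F z m c" using factorable_order[OF F] z by blast
    obtain n d where Go: "has_order G z n d" using factorable_order[OF G] z by blast
    show ?thesis
      using tame_at_eq[OF factorable_meromorphic_at[OF factorable.mult[OF factorable.inv[OF F] F] z] h1[OF Fo] factorable_meromorphic_at[OF G z] Go]
      by (simp add: tame_value_def)
  qed
  then have "tame_prod (\<lambda>w. inverse (F w) * F w) G = 1" by (rule t0)
  then show "tame_prod (\<lambda>z. inverse (F z)) G * tame_prod F G = 1"
    using tame_prod_mult_left[OF factorable.inv[OF F] F G] by simp
  have "tame_at F (\<lambda>w. inverse (G w) * G w) z = 1" if z: "z \<in> ball 0 1" for z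
  proof -
    obtain m c where Fo: "has_order F z m c" using factorable_order[OF F] z by blast
    obtain n d where Go: "has_order G z n d" using factorable_order[OF G] z by blast
    show ?thesis
      using tame_at_eq[OF factorable_meromorphic_at[OF F z] Fo factorable_meromorphic_at[OF factorable.mult[OF factorable.inv[OF G] G] z] h1[OF Go]]
      by (simp add: tame_value_def)
  qed
  then have "tame_prod F (\<lambda>w. inverse (G w) * G w) = 1" by (rule t0)
  then show "tame_prod F (\<lambda>z. inverse (G z)) * tame_prod F G = 1"
    using tame_prod_mult_right[OF F factorable.inv[OF G] G] by simp
qed

section \<open>The tame product of generators\<close>

lemma tame_prod_hol_hol:
  assumes h: "h analytic_on cball 0 1" "\<And>z. z \<in> cball 0 1 \<Longrightarrow> h z \<noteq> 0"
    and k: "k analytic_on cball 0 1" "\<And>z. z \<in> cball 0 1 \<Longrightarrow> k z \<noteq> 0"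
  shows "tame_prod h k = 1"
proof -
  have g: "factorable h" "factorable k" by (rule factorable.hol, fact h, fact h, rule factorable.hol, fact k, fact k)
  have "tame_at h k z = 1" if z: "z \<in> ball 0 1" for z
    using tame_at_eq[OF factorable_meromorphic_at[OF g(1) z] has_order_hol[OF h z] factorable_meromorphic_at[OF g(2) z] has_order_hol[OF k z]]
    by (simp add: tame_value_def)
  then show ?thesis unfolding tame_prod_def by (intro prod.neutral) auto
qed

lemma tame_prod_hol_lin:
  assumes h: "h analytic_on cball 0 1" "\<And>z. z \<in> cball 0 1 \<Longrightarrow> h z \<noteq> 0" and b: "b \<in> ball 0 1"
  shows "tame_prod h (\<lambda>z. z - b) = h b"
proof -
  have "factorable h" by (rule factorable.hol) (fact h)+
  note m = factorable_meromorphic_at[OF this] and l = factorable_meromorphic_at[OF factorable.lin[OF b]]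
  have "tame_at h (\<lambda>z. z - b) z = 1" if z: "z \<in> ball 0 1" "z \<notin> {b}" for z
    using tame_at_eq[OF m[OF z(1)] has_order_hol[OF h z(1)] l[OF z(1)] has_order_lin_other] z(2) by (simp add: tame_value_def)
  then have "tame_prod h (\<lambda>z. z - b) = (\<Prod>z\<in>{b}. inverse (tame_at h (\<lambda>z. z - b) z))"
    using b by (intro tame_prod_superset) auto
  then show ?thesis
    using tame_at_eq[OF m[OF b] has_order_hol[OF h b] l[OF b] has_order_linear] by (simp add: tame_value_def)
qed

lemma tame_prod_lin_hol:
  assumes h: "h analytic_on cball 0 1" "\<And>z. z \<in> cball 0 1 \<Longrightarrow> h z \<noteq> 0" and b: "b \<in> ball 0 1"
  shows "tame_prod (\<lambda>z. z - b) h = inverse (h b)"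
proof -
  have "factorable h" by (rule factorable.hol) (fact h)+
  note m = factorable_meromorphic_at[OF this] and l = factorable_meromorphic_at[OF factorable.lin[OF b]]
  have "tame_at (\<lambda>z. z - b) h z = 1" if z: "z \<in> ball 0 1" "z \<notin> {b}" for z
    using tame_at_eq[OF l[OF z(1)] has_order_lin_other m[OF z(1)] has_order_hol[OF h z(1)]] z(2) by (simp add: tame_value_def)
  then have "tame_prod (\<lambda>z. z - b) h = (\<Prod>z\<in>{b}. inverse (tame_at (\<lambda>z. z - b) h z))"
    using b by (intro tame_prod_superset) auto
  then show ?thesis
    using tame_at_eq[OF l[OF b] has_order_linear m[OF b] has_order_hol[OF h b]] by (simp add: tame_value_def)
qed

text \<open>For \<open>a \<noteq> b\<close> the factors at the two points are \<open>1/(a -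
  b)\<close> and \<open>b - a\<close>; for \<open>a = b\<close> the sign in the tame symbol takes
  over.\<close>

lemma tame_prod_lin_lin:
  assumes a: "a \<in> ball 0 1" and b: "b \<in> ball 0 1"
  shows "tame_prod (\<lambda>z. z - a) (\<lambda>z. z - b) = -1"
proof -
  note la = factorable_meromorphic_at[OF factorable.lin[OF a]] and lb = factorable_meromorphic_at[OF factorable.lin[OF b]]
  have "tame_at (\<lambda>z. z - a) (\<lambda>z. z - b) z = 1" if z: "z \<in> ball 0 1" "z \<notin> {a, b}" for z
    using tame_at_eq[OF la[OF z(1)] has_order_lin_other lb[OF z(1)] has_order_lin_other] z(2) by (simp add: tame_value_def)
  then have p: "tame_prod (\<lambda>z. z - a) (\<lambda>z. z - b) = (\<Prod>z\<in>{a, b}. inverse (tame_at (\<lambda>z. z - a) (\<lambda>z. z - b) z))"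
    using a b by (intro tame_prod_superset) auto
  show ?thesis
  proof (cases "a = b")
    case True
    have "tame_at (\<lambda>z. z - a) (\<lambda>z. z - b) a = -1"
      using tame_at_eq[OF la[OF a] has_order_linear la[OF a] has_order_linear] by (simp add: tame_value_def True)
    then show ?thesis using p True by simp
  next
    case False
    have "tame_at (\<lambda>z. z - a) (\<lambda>z. z - b) a = a - b"
      using tame_at_eq[OF la[OF a] has_order_linear lb[OF a] has_order_lin_other[OF False]] by (simp add: tame_value_def)
    moreover have "tame_at (\<lambda>z. z - a) (\<lambda>z. z - b) b = inverse (b - a)"
      using tame_at_eq[OF la[OF b] has_order_lin_other[of b a] lb[OF b] has_order_linear] False by (simp add: tame_value_def inverse_eq_divide)
    ultimately have "tame_prod (\<lambda>z. z - a) (\<lambda>z. z - b) = inverse (a - b) * (b - a)"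
      using p False by simp
    also have "\<dots> = -1" using False by (simp add: field_simps)
    finally show ?thesis .
  qed
qed

section \<open>Meromorphic extensions\<close>

lemma islimpt_circle: "(1::complex) islimpt circle"
proof -
  have "1 \<in> circle" by simp
  moreover have "connected circle" by (rule connected_sphere) simp
  moreover have "circle \<noteq> {x}" for x :: complex
  proof
    assume "circle = {x}"
    moreover have "(1::complex) \<in> circle" "(-1::complex) \<in> circle" by auto
    ultimately show False by force
  qed
  ultimately show ?thesis by (metis connected_imp_perfect)
qed

text \<open>Identity theorem: on a disk a meromorphic function is either zero off a sparse set or
  nonzero off a sparse set, and the second is impossible for the difference, whose zeros
  accumulate at \<open>1\<close>.\<close>

lemma meromorphic_eq_of_eq_on_circle:
  assumes F: "open U" "cball 0 1 \<subseteq> U" "F meromorphic_on U"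
    and G: "open V" "cball 0 1 \<subseteq> V" "G meromorphic_on V"
    and eq: "\<And>z. z \<in> circle \<Longrightarrow> F z = G z" and z: "z \<in> cball 0 1"
  shows "\<forall>\<^sub>F w in at z. F w = G w"
proof -
  obtain R where R: "R > 1" "ball 0 R \<subseteq> U \<inter> V"
    using open_superset_cball[of "U \<inter> V"] F G by auto
  define D where "D w = F w - G w" for w
  have D: "D meromorphic_on ball 0 R"
    unfolding D_def[abs_def]
    by (intro meromorphic_intros meromorphic_on_subset[OF F(3)] meromorphic_on_subset[OF G(3)]) (use R in auto)
  from meromorphic_imp_constant_or_avoid[OF D, of 0] have "eventually (\<lambda>z. D z = 0) (cosparse (ball 0 R))"
  proof (rule disjE)
    assume "eventually (\<lambda>z. D z \<noteq> 0) (cosparse (ball 0 R))"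
    then have "eventually (\<lambda>z. D z \<noteq> 0) (at 1)"
      using R(1) by (auto simp: eventually_cosparse_open_eq)
    then have "eventually (\<lambda>z. z \<notin> circle) (at 1)"
      by eventually_elim (use eq in \<open>auto simp: D_def\<close>)
    then show ?thesis
      using islimpt_circle unfolding islimpt_iff_eventually by simp
  qed auto
  then have "eventually (\<lambda>w. D w = 0) (at z)"
    using R(1) z by (auto simp: eventually_cosparse_open_eq)
  then show ?thesis by eventually_elim (simp add: D_def)
qed

lemma factorable_is_merom_ext:
  assumes "factorable F" "\<And>z. z \<in> circle \<Longrightarrow> F z = \<phi> z"
  shows "is_merom_ext \<phi> F"
proof -
  obtain U where "open U" "cball 0 1 \<subseteq> U" "F meromorphic_on U"
    using meromorphic_on_open_nhd[OF factorable_meromorphic[OF assms(1)]] by blast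
  then show ?thesis
    unfolding is_merom_ext_def using factorable_circle[OF assms(1)] assms(2) by auto
qed

lemma tame_pi_eq_tame_prod:
  assumes F: "factorable F" "\<And>z. z \<in> circle \<Longrightarrow> F z = \<phi> z" and G: "factorable G" "\<And>z. z \<in> circle \<Longrightarrow> G z = \<psi> z"
  shows "tame_pi \<phi> \<psi> = tame_prod F G"
proof -
  have ext: "\<forall>\<^sub>F w in at z. F w = merom_ext \<phi> w" "merom_ext \<phi> meromorphic_on {z}"
    if F: "factorable F" "\<And>z. z \<in> circle \<Longrightarrow> F z = \<phi> z" and z: "z \<in> ball 0 1" for F \<phi> z
  proof -
    have "is_merom_ext \<phi> (merom_ext \<phi>)"
      unfolding merom_ext_def by (rule someI[of _ F]) (rule factorable_is_merom_ext[OF F])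
    then obtain U where U: "open U" "cball 0 1 \<subseteq> U" "merom_ext \<phi> meromorphic_on U"
      "\<And>z. z \<in> circle \<Longrightarrow> merom_ext \<phi> z = \<phi> z"
      by (auto simp: is_merom_ext_def)
    obtain V where V: "open V" "cball 0 1 \<subseteq> V" "F meromorphic_on V"
      using meromorphic_on_open_nhd[OF factorable_meromorphic[OF F(1)]] by blast
    show "\<forall>\<^sub>F w in at z. F w = merom_ext \<phi> w"
      by (rule meromorphic_eq_of_eq_on_circle[OF V U(1-3)]) (use F U z in auto)
    show "merom_ext \<phi> meromorphic_on {z}"
      by (rule meromorphic_on_subset[OF U(3)]) (use U z in auto)
  qed
  have "tame_symbol \<phi> \<psi> z = tame_at F G z" if z: "z \<in> ball 0 1" for z
  proof -
    obtain m c where Fo: "has_order F z m c" using factorable_order[OF F(1)] z by blast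
    obtain n d where Go: "has_order G z n d" using factorable_order[OF G(1)] z by blast
    have "tame_symbol \<phi> \<psi> z = tame_at (merom_ext \<phi>) (merom_ext \<psi>) z"
      by (simp add: tame_symbol_def tame_at_def)
    also have "\<dots> = tame_value m c n d"
      by (intro tame_at_eq ext[OF F z] ext[OF G z] has_order_cong[OF ext(1)[OF F z] Fo] has_order_cong[OF ext(1)[OF G z] Go])
    also have "\<dots> = tame_at F G z"
      by (rule tame_at_eq[OF factorable_meromorphic_at[OF F(1) z] Fo factorable_meromorphic_at[OF G(1) z] Go, symmetric])
    finally show ?thesis .
  qed
  then show ?thesis
    unfolding tame_pi_def tame_prod_def by (intro prod.cong) auto
qed

section \<open>Clearing poles\<close>

lemma prod_linear_list:
  fixes N :: "complex \<Rightarrow> nat"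
  assumes "finite S"
  obtains l where "set l \<subseteq> S" "\<And>z. (\<Prod>a\<leftarrow>l. z - a) = (\<Prod>p\<in>S. (z - p) ^ N p)"
proof -
  have "\<exists>l. set l \<subseteq> S \<and> (\<forall>z. (\<Prod>a\<leftarrow>l. z - a) = (\<Prod>p\<in>S. (z - p) ^ N p))"
    using assms
  proof induction
    case (insert p S)
    then obtain l where "set l \<subseteq> S" "\<And>z. (\<Prod>a\<leftarrow>l. z - a) = (\<Prod>p\<in>S. (z - p) ^ N p)" by blast
    then show ?case
      using insert.hyps by (intro exI[of _ "replicate (N p) p @ l"]) auto
  qed simp
  then show thesis using that by blast
qed

text \<open>A finite limit after multiplication by a power, rather than an order, also covers
  functions that vanish near \<open>p\<close>.\<close>

lemma meromorphic_times_power_limit: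
  assumes "F meromorphic_on {p}"
  obtains N c where "((\<lambda>w. F w * (w - p) ^ N) \<longlongrightarrow> c) (at p)"
proof (cases "\<exists>\<^sub>F w in at p. F w \<noteq> 0")
  case True
  then obtain c where c: "has_order F p (zorder F p) c"
    using meromorphic_has_order_zorder[OF assms] by blast
  define n where "n = zorder F p"
  define N where "N = nat (- n)"
  define M where "M = nat n"
  have nM: "n = int M - int N" by (simp add: N_def M_def)
  have "((\<lambda>w. (F w * (w - p) powi (- n)) * (w - p) ^ M) \<longlongrightarrow> c * (p - p) ^ M) (at p)"
    using c unfolding has_order_def n_def by (intro tendsto_intros) auto
  then have "((\<lambda>w. F w * (w - p) ^ N) \<longlongrightarrow> c * (p - p) ^ M) (at p)"
  proof (rule Lim_transform_eventually)
    show "\<forall>\<^sub>F w in at p. F w * (w - p) powi (- n) * (w - p) ^ M = F w * (w - p) ^ N"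
      unfolding eventually_at_filter
    proof (intro always_eventually allI impI)
      fix w assume "w \<noteq> p"
      then have "(w - p) powi (- n) * (w - p) ^ M = (w - p) ^ N"
        using power_int_add[of "w - p" "- n" "int M"] nM by simp
      then show "F w * (w - p) powi (- n) * (w - p) ^ M = F w * (w - p) ^ N" by (simp add: mult.assoc)
    qed
  qed
  then show thesis by (rule that)
next
  case False
  then have "\<forall>\<^sub>F w in at p. 0 = F w * (w - p) ^ 0" by (auto simp: not_frequently elim: eventually_mono)
  then have "((\<lambda>w. F w * (w - p) ^ 0) \<longlongrightarrow> 0) (at p)"
    by (rule Lim_transform_eventually[OF tendsto_const])
  then show thesis by (rule that)
qed

text \<open>By compactness there are finitely many singularities in the closed disk, none on the
  circle. After multiplication by suitable powers of linear factors they become removable.\<close>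

lemma Cmu_clear_poles:
  assumes "\<phi> \<in> Cmu"
  obtains l g where "set l \<subseteq> ball 0 1" "g analytic_on cball 0 1"
    "\<And>z. z \<in> circle \<Longrightarrow> \<phi> z * (\<Prod>a\<leftarrow>l. z - a) = g z"
proof -
  obtain F U where F: "open U" "cball 0 1 \<subseteq> U" "F meromorphic_on U" "F analytic_on circle"
    "\<And>z. z \<in> circle \<Longrightarrow> F z = \<phi> z"
    using assms by (auto simp: Cmu_def is_merom_ext_def)
  define S where "S = {w \<in> cball 0 1. \<not> F analytic_on {w}}"
  have Fc: "F meromorphic_on cball 0 1" by (rule meromorphic_on_subset[OF F(3,2)])
  have "S sparse_in cball 0 1"
    unfolding S_def by (rule meromorphic_on_imp_sparse_singularities'[OF Fc])
  then have "finite (cball 0 1 \<inter> S)"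
    by (intro sparse_in_compact_finite) auto
  moreover have "cball 0 1 \<inter> S = S" by (auto simp: S_def)
  ultimately have fS: "finite S" by simp
  have Sb: "S \<subseteq> ball 0 1"
  proof
    fix w assume w: "w \<in> S"
    then have "w \<notin> circle" using F(4) analytic_on_subset[of F circle "{w}"] by (auto simp: S_def)
    with w show "w \<in> ball 0 1" by (auto simp: S_def)
  qed
  have "\<forall>p\<in>S. \<exists>N c. ((\<lambda>w. F w * (w - p) ^ N) \<longlongrightarrow> c) (at p)"
  proof
    fix p assume "p \<in> S"
    then have "F meromorphic_on {p}" by (intro meromorphic_on_subset[OF Fc]) (auto simp: S_def)
    from meromorphic_times_power_limit[OF this] show "\<exists>N c. ((\<lambda>w. F w * (w - p) ^ N) \<longlongrightarrow> c) (at p)" by blast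
  qed
  then obtain N where N: "\<And>p. p \<in> S \<Longrightarrow> \<exists>c. ((\<lambda>w. F w * (w - p) ^ N p) \<longlongrightarrow> c) (at p)" by metis
  define H where "H w = F w * (\<Prod>p\<in>S. (w - p) ^ N p)" for w
  have Hm: "H meromorphic_on cball 0 1"
    unfolding H_def[abs_def] by (intro meromorphic_intros Fc)
  have Hlim: "\<exists>c. (H \<longlongrightarrow> c) (at z)" if z: "z \<in> cball 0 1" for z
  proof (cases "z \<in> S")
    case True
    then obtain c where c: "((\<lambda>w. F w * (w - z) ^ N z) \<longlongrightarrow> c) (at z)" using N by blast
    have "((\<lambda>w. (F w * (w - z) ^ N z) * (\<Prod>p\<in>S - {z}. (w - p) ^ N p)) \<longlongrightarrow> c * (\<Prod>p\<in>S - {z}. (z - p) ^ N p)) (at z)"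
      by (intro tendsto_intros c)
    moreover have "H = (\<lambda>w. (F w * (w - z) ^ N z) * (\<Prod>p\<in>S - {z}. (w - p) ^ N p))"
      unfolding H_def[abs_def] using True fS by (simp add: prod.remove[of S z] mult.assoc)
    ultimately show ?thesis by auto
  next
    case False
    then have "isCont F z" using z by (auto simp: S_def intro: analytic_at_imp_isCont)
    then have "isCont H z" unfolding H_def[abs_def] by (intro continuous_intros)
    then show ?thesis by (auto simp: isCont_def)
  qed
  have g: "remove_sings H analytic_on cball 0 1"
    unfolding analytic_on_analytic_at[of _ "cball 0 1"]
  proof
    fix z :: complex assume z: "z \<in> cball 0 1"
    obtain c where "(H \<longlongrightarrow> c) (at z)" using Hlim[OF z] by blast
    moreover have "isolated_singularity_at H z"
      using meromorphic_on_subset[OF Hm, of "{z}"] z by (simp add: meromorphic_at_iff)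
    ultimately show "remove_sings H analytic_on {z}" by (intro remove_sings_analytic_at)
  qed
  obtain l where l: "set l \<subseteq> S" "\<And>z. (\<Prod>a\<leftarrow>l. z - a) = (\<Prod>p\<in>S. (z - p) ^ N p)"
    by (rule prod_linear_list[OF fS, where N = N]) blast
  show thesis
  proof (rule that[of l "remove_sings H"])
    show "set l \<subseteq> ball 0 1" using l Sb by blast
    fix z assume z: "z \<in> circle"
    have "F analytic_on {z}" by (rule analytic_on_subset[OF F(4)]) (use z in auto)
    then have "H analytic_on {z}" unfolding H_def[abs_def] by (intro analytic_intros)
    then have "remove_sings H z = H z" by (rule remove_sings_at_analytic)
    then show "\<phi> z * (\<Prod>a\<leftarrow>l. z - a) = remove_sings H z"
      by (simp only: H_def l(2) F(5)[OF z])
  qed (fact g)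
qed

section \<open>Factorization of units\<close>

lemma analytic_eq_of_eq_on_circle:
  assumes f: "f analytic_on cball 0 1" and g: "g analytic_on cball 0 1"
    and eq: "\<And>z. z \<in> circle \<Longrightarrow> f z = g z" and z: "z \<in> cball 0 1"
  shows "f z = g z"
proof -
  obtain U where U: "open U" "cball 0 1 \<subseteq> U" "f holomorphic_on U" using f by (auto simp: analytic_on_holomorphic)
  obtain V where V: "open V" "cball 0 1 \<subseteq> V" "g holomorphic_on V" using g by (auto simp: analytic_on_holomorphic)
  have m: "f meromorphic_on U" "g meromorphic_on V"
    using U V by (auto intro!: analytic_on_imp_meromorphic_on simp: analytic_on_open)
  have "\<forall>\<^sub>F w in at z. f w = g w"
    by (rule meromorphic_eq_of_eq_on_circle[OF U(1,2) m(1) V(1,2) m(2) eq z])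
  then have e: "\<forall>\<^sub>F w in at z. g w = f w" by eventually_elim simp
  have c: "isCont f z" "isCont g z"
    using f g z by (meson analytic_at_imp_isCont analytic_on_analytic_at)+
  have "(f \<longlongrightarrow> g z) (at z)"
    using Lim_transform_eventually[OF _ e] c(2) unfolding isCont_def by blast
  moreover have "(f \<longlongrightarrow> f z) (at z)" using c by (simp add: isCont_def)
  ultimately show ?thesis by (rule tendsto_unique[OF at_neq_bot, symmetric])
qed

text \<open>Each root of the product is a root of \<open>f\<close> or of \<open>g\<close>.
  Dividing it out of the one in which it occurs, one ends with \<open>f g = 1\<close>, where
  \<open>f\<close> is zero-free.\<close>

lemma factorable_divisor:
  assumes "set l \<subseteq> ball 0 1" "f analytic_on cball 0 1" "g analytic_on cball 0 1"
    "\<And>z. z \<in> cball 0 1 \<Longrightarrow> f z * g z = (\<Prod>a\<leftarrow>l. z - a)"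
  shows "\<exists>F. factorable F \<and> (\<forall>z\<in>cball 0 1. F z = f z)"
  using assms
proof (induction l arbitrary: f g)
  case Nil
  then have "factorable f" by (intro factorable.hol) force+
  then show ?case by blast
next
  case (Cons a l)
  have a: "a \<in> ball 0 1" using Cons.prems by simp
  have cancel: "u z = v z"
    if "u analytic_on cball 0 1" "v analytic_on cball 0 1" "\<And>z. z \<in> cball 0 1 \<Longrightarrow> (z - a) * u z = (z - a) * v z"
      "z \<in> cball 0 1" for u v z
  proof (rule analytic_eq_of_eq_on_circle[OF that(1,2) _ that(4)])
    fix z assume "z \<in> circle"
    then show "u z = v z" using that(3)[of z] a by auto
  qed
  have prod_analytic: "(\<lambda>z. \<Prod>a\<leftarrow>l. z - a) analytic_on cball 0 1"
    by (induction l) (auto intro!: analytic_intros)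
  have "f a * g a = 0" using Cons.prems(4)[of a] a by simp
  then consider "f a = 0" | "g a = 0" by auto
  then show ?case
  proof cases
    case 1
    obtain q where q: "q analytic_on cball 0 1" "\<And>z. f z = (z - a) * q z"
      by (rule analytic_divide_root[OF Cons.prems(2) a 1]) blast
    have "q z * g z = (\<Prod>a\<leftarrow>l. z - a)" if "z \<in> cball 0 1" for z
      by (rule cancel[OF _ prod_analytic _ that]) (use Cons.prems q in \<open>auto intro!: analytic_intros simp: mult.assoc[symmetric]\<close>)
    then obtain F where F: "factorable F" "\<forall>z\<in>cball 0 1. F z = q z"
      using Cons.IH[OF _ q(1) Cons.prems(3)] Cons.prems(1) by auto
    then show ?thesis
      using factorable.mult[OF factorable.lin[OF a] F(1)] q(2) by (intro exI[of _ "\<lambda>z. (z - a) * F z"]) auto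
  next
    case 2
    obtain q where q: "q analytic_on cball 0 1" "\<And>z. g z = (z - a) * q z"
      by (rule analytic_divide_root[OF Cons.prems(3) a 2]) blast
    have "f z * q z = (\<Prod>a\<leftarrow>l. z - a)" if "z \<in> cball 0 1" for z
      by (rule cancel[OF _ prod_analytic _ that]) (use Cons.prems q in \<open>auto intro!: analytic_intros simp: mult.left_commute\<close>)
    then show ?thesis
      using Cons.IH[OF _ Cons.prems(2) q(1)] Cons.prems(1) by auto
  qed
qed

text \<open>Clearing the poles of \<open>\<phi>\<close> yields an analytic \<open>g1\<close>. It
  has no zeros on the circle, so its inverse is again in \<^const>\<open>Cmu\<close>, and clearing
  the poles of that exhibits \<open>g1\<close> as a divisor of a product of linear factors. Thus
  its zeros are found without counting them.\<close>

lemma Cmu_unit_factorable: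
  assumes "\<phi> \<in> Cmu_units"
  obtains F where "factorable F" "\<And>z. z \<in> circle \<Longrightarrow> F z = \<phi> z"
proof -
  have \<phi>: "\<phi> \<in> Cmu" using assms by (simp add: Cmu_units_def)
  have nz: "\<phi> z \<noteq> 0" if z: "z \<in> circle" for z
  proof -
    obtain F where "is_merom_ext \<phi> F" using \<phi> by (auto simp: Cmu_def)
    then have "is_merom_ext \<phi> (merom_ext \<phi>)" unfolding merom_ext_def by (rule someI[of "is_merom_ext \<phi>"])
    then show ?thesis using assms z by (auto simp: Cmu_units_def is_merom_ext_def)
  qed
  obtain l1 g1 where 1: "set l1 \<subseteq> ball 0 1" "g1 analytic_on cball 0 1"
    "\<And>z. z \<in> circle \<Longrightarrow> \<phi> z * (\<Prod>a\<leftarrow>l1. z - a) = g1 z"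
    by (rule Cmu_clear_poles[OF \<phi>]) blast
  have pnz: "(\<Prod>a\<leftarrow>l. z - a) \<noteq> 0" if "set l \<subseteq> ball 0 1" "z \<in> circle" for l and z :: complex
    using that by (auto simp: prod_list_zero_iff)
  have g1nz: "g1 z \<noteq> 0" if "z \<in> circle" for z
    using 1(3)[OF that] nz[OF that] pnz[OF 1(1) that] by auto
  have "(\<lambda>z. inverse (g1 z)) \<in> Cmu"
  proof -
    obtain U where U: "open U" "cball 0 1 \<subseteq> U" "g1 holomorphic_on U" using 1(2) by (auto simp: analytic_on_holomorphic)
    have "is_merom_ext (\<lambda>z. inverse (g1 z)) (\<lambda>z. inverse (g1 z))"
      unfolding is_merom_ext_def
    proof (intro conjI exI[of _ U])
      show "(\<lambda>z. inverse (g1 z)) meromorphic_on U"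
        using U by (intro meromorphic_intros analytic_on_imp_meromorphic_on) (simp add: analytic_on_open)
      show "(\<lambda>z. inverse (g1 z)) analytic_on circle"
        using g1nz analytic_on_subset[OF 1(2), of circle] by (intro analytic_intros) auto
    qed (use U in auto)
    then show ?thesis by (auto simp: Cmu_def)
  qed
  then obtain l2 g2 where 2: "set l2 \<subseteq> ball 0 1" "g2 analytic_on cball 0 1"
    "\<And>z. z \<in> circle \<Longrightarrow> inverse (g1 z) * (\<Prod>a\<leftarrow>l2. z - a) = g2 z"
    by (rule Cmu_clear_poles) blast
  have prod_analytic: "(\<lambda>z. \<Prod>a\<leftarrow>l. z - a) analytic_on cball 0 1" for l :: "complex list"
    by (induction l) (auto intro!: analytic_intros)
  have "g1 z * g2 z = (\<Prod>a\<leftarrow>l2. z - a)" if "z \<in> cball 0 1" for z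
  proof (rule analytic_eq_of_eq_on_circle[OF _ prod_analytic _ that])
    show "(\<lambda>z. g1 z * g2 z) analytic_on cball 0 1" by (intro analytic_intros 1 2)
    show "g1 z * g2 z = (\<Prod>a\<leftarrow>l2. z - a)" if "z \<in> circle" for z
      using 2(3)[OF that, symmetric] g1nz[OF that] by simp
  qed
  then obtain G where G: "factorable G" "\<forall>z\<in>cball 0 1. G z = g1 z"
    using factorable_divisor[OF 2(1) 1(2) 2(2)] by blast
  have gl: "factorable (\<lambda>z. \<Prod>a\<leftarrow>l. z - a)" if "set l \<subseteq> ball 0 1" for l
    using that
  proof (induction l)
    case Nil
    show ?case by (rule factorable.hol) (auto intro: analytic_intros)
  next
    case (Cons a l)
    then show ?case using factorable.mult[OF factorable.lin[of a] Cons.IH] by simp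
  qed
  show thesis
  proof (rule that)
    show "factorable (\<lambda>z. G z * inverse (\<Prod>a\<leftarrow>l1. z - a))"
      by (intro factorable.mult factorable.inv G gl 1)
    show "G z * inverse (\<Prod>a\<leftarrow>l1. z - a) = \<phi> z" if "z \<in> circle" for z
      using 1(3)[OF that, symmetric] pnz[OF 1(1) that] G(2) that by simp
  qed
qed

lemma factorable_Cmu: "factorable F \<Longrightarrow> F \<in> Cmu"
  using factorable_is_merom_ext[of F F] by (auto simp: Cmu_def)

lemma zero_Cmu: "(\<lambda>z. 0) \<in> Cmu"
proof -
  have "is_merom_ext (\<lambda>z. 0) (\<lambda>z. 0)"
    unfolding is_merom_ext_def by (intro conjI exI[of _ UNIV]) auto
  then show ?thesis by (auto simp: Cmu_def)
qed

lemma Cmu_continuous: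
  assumes "\<phi> \<in> Cmu" shows "continuous_on circle \<phi>"
proof -
  obtain F where F: "F analytic_on circle" "\<And>z. z \<in> circle \<Longrightarrow> F z = \<phi> z"
    using assms by (auto simp: Cmu_def is_merom_ext_def)
  show ?thesis
    by (rule continuous_on_eq[OF holomorphic_on_imp_continuous_on[OF analytic_imp_holomorphic[OF F(1)]] F(2)])
qed

lemma Cmu_toeplitz_mult_trace_class:
  assumes "\<phi> \<in> Cmu" "\<psi> \<in> Cmu"
  shows "trace_class_op (toeplitz \<phi> * toeplitz \<psi> - toeplitz (\<lambda>z. \<phi> z * \<psi> z))"
proof -
  obtain l g where "set l \<subseteq> ball 0 1" "g analytic_on cball 0 1"
    "\<And>z. z \<in> circle \<Longrightarrow> \<psi> z * (\<Prod>a\<leftarrow>l. z - a) = g z"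
    by (rule Cmu_clear_poles[OF assms(2)]) blast
  then show ?thesis
    using toeplitz_mult_trace_class[OF Cmu_continuous[OF assms(1)] Cmu_continuous[OF assms(2)]] by blast
qed

section \<open>Lifts\<close>

definition diag_toeplitz :: "(3 \<Rightarrow> complex \<Rightarrow> complex) \<Rightarrow> hardy_op ^ 3 ^ 3" where
  "diag_toeplitz f = (\<chi> i j. if i = j then toeplitz (f i) else 0)"

text \<open>Only diagonal symbols occur, so symbols are families of three functions. The condition
  that they belong to \<^const>\<open>Cmu\<close> is kept separate.\<close>

definition lifts :: "hardy_op ^ 3 ^ 3 \<Rightarrow> (3 \<Rightarrow> complex \<Rightarrow> complex) \<Rightarrow> bool" where
  "lifts R f \<longleftrightarrow> trace_class_mat (R - diag_toeplitz f)"

lemma diag_toeplitz_mult_trace_class: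
  assumes "\<And>i. f i \<in> Cmu" "\<And>i. g i \<in> Cmu"
  shows "trace_class_mat (diag_toeplitz f ** diag_toeplitz g - diag_toeplitz (\<lambda>i z. f i z * g i z))"
proof -
  have "(diag_toeplitz f ** diag_toeplitz g) $ i $ j = (if i = j then toeplitz (f i) * toeplitz (g i) else 0)" for i j
  proof -
    have "(diag_toeplitz f ** diag_toeplitz g) $ i $ j = (\<Sum>k\<in>UNIV. diag_toeplitz f $ i $ k * diag_toeplitz g $ k $ j)"
      by (simp add: matrix_matrix_mult_def)
    also have "\<dots> = (\<Sum>k\<in>UNIV. if k = i then (if i = j then toeplitz (f i) * toeplitz (g i) else 0) else 0)"
      by (intro sum.cong refl) (auto simp: diag_toeplitz_def)
    finally have "(diag_toeplitz f ** diag_toeplitz g) $ i $ j = \<dots>" .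
    then show ?thesis by simp
  qed
  then have "(diag_toeplitz f ** diag_toeplitz g - diag_toeplitz (\<lambda>i z. f i z * g i z)) $ i $ j =
      (if i = j then toeplitz (f i) * toeplitz (g i) - toeplitz (\<lambda>z. f i z * g i z) else 0)" for i j
    by (simp add: diag_toeplitz_def)
  then show ?thesis
    using Cmu_toeplitz_mult_trace_class[OF assms] by (simp add: trace_class_mat_def trace_class_op_0)
qed

lemma lifts_mult:
  assumes R: "lifts R f" and S: "lifts S g" and "\<And>i. f i \<in> Cmu" "\<And>i. g i \<in> Cmu"
  shows "lifts (R ** S) (\<lambda>i z. f i z * g i z)"
proof -
  have e: "R ** (S - diag_toeplitz g) + (R - diag_toeplitz f) ** diag_toeplitz g + (diag_toeplitz f ** diag_toeplitz g - diag_toeplitz (\<lambda>i z. f i z * g i z)) =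
      R ** S - diag_toeplitz (\<lambda>i z. f i z * g i z)"
    by (simp add: matrix_diff_ldistrib matrix_diff_rdistrib)
  have "trace_class_mat (R ** (S - diag_toeplitz g) + (R - diag_toeplitz f) ** diag_toeplitz g + (diag_toeplitz f ** diag_toeplitz g - diag_toeplitz (\<lambda>i z. f i z * g i z)))"
    using assms unfolding lifts_def by (intro trace_class_mat_add trace_class_mat_mult_left trace_class_mat_mult_right diag_toeplitz_mult_trace_class)
  then show ?thesis by (simp only: e lifts_def)
qed

lemma lifts_commute:
  assumes "lifts R f" "lifts S g" "\<And>i. f i \<in> Cmu" "\<And>i. g i \<in> Cmu"
  shows "trace_class_mat (R ** S - S ** R)"
proof -
  have 1: "trace_class_mat (R ** S - diag_toeplitz (\<lambda>i z. f i z * g i z))"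
    using lifts_mult[OF assms] by (simp add: lifts_def)
  have 2: "trace_class_mat (S ** R - diag_toeplitz (\<lambda>i z. f i z * g i z))"
    using lifts_mult[OF assms(2,1,4,3)] by (simp add: lifts_def mult.commute)
  from trace_class_mat_diff[OF 1 2] show ?thesis by simp
qed

lemma lifts_diff: "lifts R f \<Longrightarrow> lifts Q f \<Longrightarrow> trace_class_mat (Q - R)"
  using trace_class_mat_diff[of "Q - diag_toeplitz f" "R - diag_toeplitz f"] by (simp add: lifts_def)

lemma diag3_nth:
  "diag3 (f 1) (f 2) (f 3) $ i $ j = (if i = j then f i else (\<lambda>z. 0))"
  using exhaust_3[of i] by (auto simp: diag3_def)

lemma lifts_iff_has_symbol_matrix:
  assumes "\<And>i. f i \<in> Cmu"
  shows "has_symbol_matrix R (diag3 (f 1) (f 2) (f 3)) \<longleftrightarrow> lifts R f"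
proof -
  have "has_symbol A \<phi> \<longleftrightarrow> trace_class_op (A - toeplitz \<phi>)" if "\<phi> \<in> Cmu" for A \<phi>
  proof -
    have "A = toeplitz \<phi> + L \<longleftrightarrow> L = A - toeplitz \<phi>" for L by (auto simp: algebra_simps)
    then show ?thesis using that by (simp add: has_symbol_def trace_class_op_def)
  qed
  then have "has_symbol (R $ i $ j) (diag3 (f 1) (f 2) (f 3) $ i $ j) \<longleftrightarrow> trace_class_op ((R - diag_toeplitz f) $ i $ j)" for i j
    using assms zero_Cmu by (simp add: diag3_nth diag_toeplitz_def toeplitz_0)
  then show ?thesis by (simp add: has_symbol_matrix_def lifts_def trace_class_mat_def)
qed

lemma lifts_Tmu:
  assumes "\<And>i. f i \<in> Cmu" "lifts R f" shows "R $ i $ j \<in> Tmu"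
proof -
  have "trace_class_op (R $ i $ j - diag_toeplitz f $ i $ j)" using assms(2) by (simp add: lifts_def trace_class_mat_def)
  moreover have "R $ i $ j = diag_toeplitz f $ i $ j + (R $ i $ j - diag_toeplitz f $ i $ j)" by simp
  moreover obtain \<phi> where "\<phi> \<in> Cmu" "diag_toeplitz f $ i $ j = toeplitz \<phi>"
  proof (cases "i = j")
    case True
    then show thesis using that[OF assms(1)[of i]] by (simp add: diag_toeplitz_def)
  next
    case False
    then show thesis using that[OF zero_Cmu] by (simp add: diag_toeplitz_def toeplitz_0)
  qed
  ultimately show ?thesis
    unfolding Tmu_def trace_class_op_def
    by (intro CollectI exI[of _ \<phi>] exI[of _ "R $ i $ j - diag_toeplitz f $ i $ j"]) auto
qed

text \<open>The diagonal matrix with \<open>\<phi>\<close> in place \<open>1\<close> and its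
  inverse in place \<open>j\<close>: with \<open>j = 2\<close> and \<open>j = 3\<close> this
  covers both matrices whose lifts define \<^const>\<open>delta\<close>.\<close>

definition symbol_diag :: "3 \<Rightarrow> (complex \<Rightarrow> complex) \<Rightarrow> 3 \<Rightarrow> complex \<Rightarrow> complex" where
  "symbol_diag j \<phi> i = (if i = 1 then \<phi> else if i = j then (\<lambda>z. inverse (\<phi> z)) else (\<lambda>z. 1))"

definition lift_pair :: "3 \<Rightarrow> (complex \<Rightarrow> complex) \<Rightarrow> hardy_op ^ 3 ^ 3 \<Rightarrow> hardy_op ^ 3 ^ 3 \<Rightarrow> bool" where
  "lift_pair j \<phi> R R' \<longleftrightarrow> inv_pair R R' \<and> lifts R (symbol_diag j \<phi>) \<and> lifts R' (symbol_diag j (\<lambda>z. inverse (\<phi> z)))"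

lemma symbol_diag_Cmu: "factorable F \<Longrightarrow> symbol_diag j F i \<in> Cmu"
  by (auto simp: symbol_diag_def intro: factorable_Cmu factorable.inv factorable_one)

lemma lift_pair_mult:
  assumes F: "factorable F" "lift_pair j F R R'" and G: "factorable G" "lift_pair j G S S'"
  shows "lift_pair j (\<lambda>z. F z * G z) (R ** S) (S' ** R')"
proof -
  have inv: "inv_pair R R'" "inv_pair S S'" using F G by (simp_all add: lift_pair_def)
  have "inv_pair (R ** S) (S' ** R')"
    by (simp add: inv_pair_def matrix_mul_assoc[symmetric] inv_pair_cancel[OF inv(1)] inv_pair_cancel[OF inv(2)])
  moreover have "lifts (R ** S) (symbol_diag j (\<lambda>z. F z * G z))"
  proof -
    have "lifts (R ** S) (\<lambda>i z. symbol_diag j F i z * symbol_diag j G i z)"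
      using F G by (intro lifts_mult symbol_diag_Cmu) (auto simp: lift_pair_def)
    also have "(\<lambda>i z. symbol_diag j F i z * symbol_diag j G i z) = symbol_diag j (\<lambda>z. F z * G z)"
      by (auto simp: symbol_diag_def fun_eq_iff)
    finally show ?thesis .
  qed
  moreover have "lifts (S' ** R') (symbol_diag j (\<lambda>z. inverse (F z * G z)))"
  proof -
    have "lifts (S' ** R') (\<lambda>i z. symbol_diag j (\<lambda>z. inverse (G z)) i z * symbol_diag j (\<lambda>z. inverse (F z)) i z)"
      using F G by (intro lifts_mult symbol_diag_Cmu factorable.inv) (auto simp: lift_pair_def)
    also have "(\<lambda>i z. symbol_diag j (\<lambda>z. inverse (G z)) i z * symbol_diag j (\<lambda>z. inverse (F z)) i z) = symbol_diag j (\<lambda>z. inverse (F z * G z))"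
      by (auto simp: symbol_diag_def fun_eq_iff)
    finally show ?thesis .
  qed
  ultimately show ?thesis by (simp add: lift_pair_def)
qed

lemma lift_pair_inverse: "lift_pair j F R R' \<Longrightarrow> lift_pair j (\<lambda>z. inverse (F z)) R' R"
  by (auto simp: lift_pair_def inv_pair_def)

section \<open>Lifts built from a left inverse\<close>

text \<open>The identity outside rows and columns \<open>1\<close> and \<open>j\<close>, where it
  is the block matrix with rows \<open>(A, p)\<close> and \<open>(0, B)\<close>.\<close>

definition elem_lift :: "3 \<Rightarrow> hardy_op \<Rightarrow> hardy_op \<Rightarrow> hardy_op \<Rightarrow> hardy_op ^ 3 ^ 3" where
  "elem_lift j A B p = (\<chi> i k. if i = 1 \<and> k = 1 then A else if i = 1 \<and> k = j then p
     else if i = j \<and> k = j then B else if i = k then 1 else 0)"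

definition elem_lift_inv :: "3 \<Rightarrow> hardy_op \<Rightarrow> hardy_op \<Rightarrow> hardy_op \<Rightarrow> hardy_op ^ 3 ^ 3" where
  "elem_lift_inv j A B p = (\<chi> i k. if i = 1 \<and> k = 1 then B else if i = j \<and> k = 1 then p
     else if i = j \<and> k = j then A else if i = k then 1 else 0)"

definition toeplitz_left_inv :: "(complex \<Rightarrow> complex) \<Rightarrow> hardy_op \<Rightarrow> hardy_op \<Rightarrow> hardy_op \<Rightarrow> bool" where
  "toeplitz_left_inv F A B p \<longleftrightarrow> A = toeplitz F \<and> B = toeplitz (\<lambda>z. inverse (F z)) \<and> B * A = 1 \<and> p = 1 - A * B \<and> trace_class_op p"

lemma left_inv_algebra:
  assumes "B * A = (1::hardy_op)" "p = 1 - A * B"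
  shows "p * p = p" "p * A = 0" "B * p = 0" "A * B + p = 1" "p + A * B = 1"
proof -
  show "p * A = 0" unfolding assms(2) by (simp add: algebra_simps mult.assoc assms(1))
  show "B * p = 0" unfolding assms(2) by (simp add: algebra_simps mult.assoc[symmetric] assms(1))
  then show "p * p = p" by (subst (1) assms(2)) (simp add: left_diff_distrib mult.assoc)
  show "A * B + p = 1" "p + A * B = 1" by (simp_all add: assms(2))
qed

lemma lift_pair_elem_lift:
  assumes e: "toeplitz_left_inv F A B p" and j: "j = 2 \<or> j = 3"
  shows "lift_pair j F (elem_lift j A B p) (elem_lift_inv j A B p)"
proof -
  have e': "A = toeplitz F" "B = toeplitz (\<lambda>z. inverse (F z))" "B * A = 1" "p = 1 - A * B" "trace_class_op p"
    using e unfolding toeplitz_left_inv_def by blast+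
  note alg = left_inv_algebra[OF e'(3,4)] e'(3)
  have "inv_pair (elem_lift j A B p) (elem_lift_inv j A B p)"
    using j unfolding inv_pair_def
    by (elim disjE) (simp_all add: elem_lift_def elem_lift_inv_def cvec_eq_iff matrix_matrix_mult_def sum_3 forall_3 Finite_Cartesian_Product.mat_def alg)
  moreover have "lifts (elem_lift j A B p) (symbol_diag j F)"
    using j unfolding lifts_def trace_class_mat_def
    by (elim disjE) (simp_all add: elem_lift_def diag_toeplitz_def symbol_diag_def forall_3 e'(1,2,5) toeplitz_1 trace_class_op_0)
  moreover have "lifts (elem_lift_inv j A B p) (symbol_diag j (\<lambda>z. inverse (F z)))"
    using j unfolding lifts_def trace_class_mat_def
    by (elim disjE) (simp_all add: elem_lift_inv_def diag_toeplitz_def symbol_diag_def forall_3 e'(1,2,5) toeplitz_1 trace_class_op_0)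
  ultimately show ?thesis by (simp add: lift_pair_def)
qed

text \<open>The products of the two lifts and of their inverses are computed first, using that
  \<open>p\<close> and \<open>p'\<close> are idempotents with \<open>p A = 0\<close> and \<open>B
  p = 0\<close>. Commutation of \<open>A\<close> and \<open>A'\<close> is used to bring \<open>A
  B\<close> and \<open>A' B'\<close> together in the upper left corner.\<close>

lemma commutator_elem_lift:
  assumes "toeplitz_left_inv F A B p" "toeplitz_left_inv G A' B' p'" "A * A' = A' * A"
  shows "elem_lift 2 A B p ** elem_lift 3 A' B' p' ** elem_lift_inv 2 A B p ** elem_lift_inv 3 A' B' p' =
    (\<chi> i j. if i = j then (if i = 1 then 1 + ((A - 1) * p' + (1 - A') * p * B') else 1) else 0)"
proof -
  have BA: "B * A = 1" "p = 1 - A * B" and BA': "B' * A' = 1" "p' = 1 - A' * B'"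
    using assms(1,2) unfolding toeplitz_left_inv_def by blast+
  note alg = left_inv_algebra[OF BA] BA(1) and alg' = left_inv_algebra[OF BA'] BA'(1)
  have RS: "elem_lift 2 A B p ** elem_lift 3 A' B' p' = (\<chi> i j.
      if i = 1 then (if j = 1 then A * A' else if j = 2 then p else A * p') else
      if i = 2 then (if j = 2 then B else 0) else (if j = 3 then B' else 0))"
    by (simp add: elem_lift_def cvec_eq_iff matrix_matrix_mult_def sum_3 forall_3)
  have RS': "elem_lift_inv 2 A B p ** elem_lift_inv 3 A' B' p' = (\<chi> i j.
      if i = 1 then (if j = 1 then B * B' else 0) else
      if i = 2 then (if j = 1 then p * B' else if j = 2 then A else 0) else (if j = 1 then p' else if j = 3 then A' else 0))"
    by (simp add: elem_lift_inv_def cvec_eq_iff matrix_matrix_mult_def sum_3 forall_3)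
  have "A * A' * (B * B') = A' * (A * B) * B'" by (simp add: assms(3) mult.assoc)
  also have "A * B = 1 - p" by (simp add: BA(2))
  also have "A' * (1 - p) * B' = A' * B' - A' * p * B'" by (simp add: right_diff_distrib left_diff_distrib)
  also have "A' * B' = 1 - p'" by (simp add: BA'(2))
  finally have h1: "A * A' * (B * B') = 1 - p' - A' * p * B'" .
  have h2: "p * (p * B') = p * B'" by (simp add: mult.assoc[symmetric] alg(1))
  have h3: "A * p' * p' = A * p'" by (simp add: mult.assoc alg'(1))
  have 11: "A * A' * (B * B') + p * (p * B') + A * p' * p' = 1 + ((A - 1) * p' + (1 - A') * p * B')"
    unfolding h1 h2 h3 by (simp add: left_diff_distrib)
  have z1: "B * (p * B') = 0" by (simp add: mult.assoc[symmetric] alg(3))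
  have z2: "A * p' * A' = 0" by (simp add: mult.assoc alg'(2))
  have "elem_lift 2 A B p ** elem_lift 3 A' B' p' ** elem_lift_inv 2 A B p ** elem_lift_inv 3 A' B' p' =
      (elem_lift 2 A B p ** elem_lift 3 A' B' p') ** (elem_lift_inv 2 A B p ** elem_lift_inv 3 A' B' p')"
    by (simp add: matrix_mul_assoc)
  also have "\<dots> = (\<chi> i j. if i = j then (if i = 1 then 1 + ((A - 1) * p' + (1 - A') * p * B') else 1) else 0)"
    unfolding RS RS' by (simp add: cvec_eq_iff matrix_matrix_mult_def sum_3 forall_3 alg alg' z1 z2 11)
  finally show ?thesis .
qed

text \<open>Both \<open>p\<close> and \<open>p'\<close> have range in the constants, which makes
  the corner a perturbation of rank at most two. Moving \<open>B'\<close> to its adjoint brings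
  the perturbation into the form required for the two by two determinant.\<close>

lemma mdet_commutator_elem_lift:
  assumes e: "toeplitz_left_inv F A B p" "toeplitz_left_inv G A' B' p'" "A * A' = A' * A"
    and k: "\<And>f. op_apply p f = cinner k f *\<^sub>C hardy_monom 0" and k': "\<And>f. op_apply p' f = cinner k' f *\<^sub>C hardy_monom 0"
  defines "\<alpha> \<equiv> op_apply (A - 1) (hardy_monom 0)" and "\<beta> \<equiv> op_apply (1 - A') (hardy_monom 0)"
  shows "mdet (elem_lift 2 A B p ** elem_lift 3 A' B' p' ** elem_lift_inv 2 A B p ** elem_lift_inv 3 A' B' p') =
    (1 + cinner k' \<alpha>) * (1 + cinner k (op_apply B' \<beta>)) - cinner k' \<beta> * cinner k (op_apply B' \<alpha>)"
proof -
  obtain B'' where B'': "\<And>x y. cinner y (op_apply B' x) = cinner (B'' y) x"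
    by (rule adjoint_exists[OF orthonormal_basis_hardy bounded_clinear_op[of B']]) blast
  define X where "X = (A - 1) * p' + (1 - A') * p * B'"
  define M :: "hardy_op ^ 3 ^ 3" where "M = (\<chi> i j. if i = j then (if i = 1 then 1 + X else 1) else 0)"
  have X: "op_apply X f = cinner k' f *\<^sub>C \<alpha> + cinner (B'' k) f *\<^sub>C \<beta>" for f
    by (simp add: X_def op_apply_simps k k' \<alpha>_def \<beta>_def B''[symmetric] scaleC_diff_right)
  have "matrix_apply M v = v + cinner (axis 1 k') v *\<^sub>C axis 1 \<alpha> + cinner (axis 1 (B'' k)) v *\<^sub>C axis 1 \<beta>" for v
    by (simp add: matrix_apply_def M_def cvec_eq_iff sum_3 forall_3 op_apply_simps X cinner_axis scaleC_vec_def axis_nth_if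
        scaleC_zero_right)
  from fredholm_det_rank_two[OF orthonormal_basis_hardy3 this]
  have "mdet M = (1 + cinner k' \<alpha>) * (1 + cinner (B'' k) \<beta>) - cinner k' \<beta> * cinner (B'' k) \<alpha>"
    by (simp add: mdet_def cinner_axis axis_nth_if)
  then show ?thesis
    unfolding commutator_elem_lift[OF e] X_def[symmetric] by (simp add: M_def B'')
qed

section \<open>The determinant of the commutator\<close>

text \<open>Quantifying over all lifts costs nothing, as \<open>det_eq_tameI\<close> shows, and it
  makes the property usable for whichever lifts arise in products.\<close>

definition det_eq_tame :: "(complex \<Rightarrow> complex) \<Rightarrow> (complex \<Rightarrow> complex) \<Rightarrow> bool" where
  "det_eq_tame F G \<longleftrightarrow> (\<forall>R R' S S'. lift_pair 2 F R R' \<longrightarrow> lift_pair 3 G S S' \<longrightarrow>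
     mdet (R ** S ** R' ** S') = tame_prod F G)"

lemma lift_pair_commute:
  assumes "factorable F" "factorable G" "lift_pair i F R R'" "lift_pair j G S S'"
  shows "trace_class_mat (R ** S - S ** R)"
  by (rule lifts_commute[of R "symbol_diag i F" S "symbol_diag j G"]) (use assms in \<open>auto simp: lift_pair_def symbol_diag_Cmu\<close>)

lemma det_eq_tameI:
  assumes F: "factorable F" "lift_pair 2 F R R'" and G: "factorable G" "lift_pair 3 G S S'"
    and d: "mdet (R ** S ** R' ** S') = tame_prod F G"
  shows "det_eq_tame F G"
  unfolding det_eq_tame_def
proof (intro allI impI)
  fix Q Q' P P' assume Q: "lift_pair 2 F Q Q'" and P: "lift_pair 3 G P P'"
  have inv: "inv_pair R R'" "inv_pair S S'" "inv_pair Q Q'" "inv_pair P P'"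
    using F G Q P by (simp_all add: lift_pair_def)
  have dQ: "trace_class_mat (Q - R)" "trace_class_mat (P - S)"
    using F G Q P lifts_diff by (auto simp: lift_pair_def)
  have "mdet (Q ** P ** Q' ** P') = mdet (Q ** S ** Q' ** S')"
    by (rule mdet_commutator_perturb_right[OF inv(3,4,2) lift_pair_commute[OF F(1) G(1) Q G(2)] dQ(2)])
  also have "\<dots> = mdet (R ** S ** R' ** S')"
    by (rule mdet_commutator_perturb_left[OF inv(1,3,2) lift_pair_commute[OF F(1) G(1) F(2) G(2)] dQ(1)])
  finally show "mdet (Q ** P ** Q' ** P') = tame_prod F G" using d by simp
qed

text \<open>A zero-free analytic symbol gives an invertible operator, so the defect
  \<open>p\<close> is zero.\<close>

lemma toeplitz_left_inv_hol:
  assumes h: "h analytic_on cball 0 1" "\<And>z. z \<in> cball 0 1 \<Longrightarrow> h z \<noteq> 0"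
  shows "toeplitz_left_inv h (toeplitz h) (toeplitz (\<lambda>z. inverse (h z))) 0"
proof -
  have c: "continuous_on circle h" by (rule analytic_cball_continuous_circle[OF h(1)])
  have i: "(\<lambda>z. inverse (h z)) analytic_on cball 0 1" by (intro analytic_intros h)
  have ci: "continuous_on circle (\<lambda>z. inverse (h z))" by (rule analytic_cball_continuous_circle[OF i])
  have nz: "h z \<noteq> 0" if "z \<in> circle" for z using h(2)[of z] that by simp
  have "toeplitz (\<lambda>z. inverse (h z)) * toeplitz h = toeplitz (\<lambda>z. 1)"
    unfolding toeplitz_mult_analytic[OF ci h(1)]
    by (rule toeplitz_cong) (use nz in \<open>auto intro!: continuous_intros c\<close>)
  moreover have "toeplitz h * toeplitz (\<lambda>z. inverse (h z)) = toeplitz (\<lambda>z. 1)"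
    unfolding toeplitz_mult_analytic[OF c i]
    by (rule toeplitz_cong) (use nz in \<open>auto intro!: continuous_intros c\<close>)
  ultimately show ?thesis by (simp add: toeplitz_left_inv_def toeplitz_1 trace_class_op_0)
qed

lemma toeplitz_left_inv_lin:
  assumes a: "a \<in> ball 0 1"
  shows "toeplitz_left_inv (\<lambda>z. z - a) (lin_op a) (lin_linv a) (eval_proj a)"
  using lin_linv_lin_op[OF a] trace_class_op_eval_proj[OF a] by (simp add: toeplitz_left_inv_def lin_op_def lin_linv_def eval_proj_def)

lemma lift_pair_exists:
  assumes "factorable F" and j: "j = 2 \<or> j = 3"
  shows "\<exists>R R'. lift_pair j F R R'"
  using assms(1)
proof induction
  case (hol h)
  then show ?case using lift_pair_elem_lift[OF toeplitz_left_inv_hol j] by blast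
next
  case (lin a)
  then show ?case using lift_pair_elem_lift[OF toeplitz_left_inv_lin j] by blast
next
  case (mult F G)
  then show ?case using lift_pair_mult by blast
next
  case (inv F)
  then show ?case using lift_pair_inverse by blast
qed

lemma det_eq_tame_elem_lift:
  assumes "factorable F" "factorable G" "toeplitz_left_inv F A B p" "toeplitz_left_inv G A' B' p'" "A * A' = A' * A"
    and k: "\<And>f. op_apply p f = cinner k f *\<^sub>C hardy_monom 0" and k': "\<And>f. op_apply p' f = cinner k' f *\<^sub>C hardy_monom 0"
    and d: "(1 + cinner k' (op_apply (A - 1) (hardy_monom 0))) * (1 + cinner k (op_apply B' (op_apply (1 - A') (hardy_monom 0)))) -
      cinner k' (op_apply (1 - A') (hardy_monom 0)) * cinner k (op_apply B' (op_apply (A - 1) (hardy_monom 0))) = tame_prod F G"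
  shows "det_eq_tame F G"
proof (rule det_eq_tameI[OF assms(1) lift_pair_elem_lift[OF assms(3)] assms(2) lift_pair_elem_lift[OF assms(4)]])
  show "mdet (elem_lift 2 A B p ** elem_lift 3 A' B' p' ** elem_lift_inv 2 A B p ** elem_lift_inv 3 A' B' p') = tame_prod F G"
    by (simp only: mdet_commutator_elem_lift[OF assms(3-5) k k'] d)
qed auto

lemma toeplitz_analytic_commute:
  assumes "f analytic_on cball 0 1" "g analytic_on cball 0 1"
  shows "toeplitz f * toeplitz g = toeplitz g * toeplitz f"
  by (simp add: toeplitz_mult_analytic assms analytic_cball_continuous_circle mult.commute)

lemma op_zero_kernel: "op_apply 0 f = cinner 0 f *\<^sub>C hardy_monom 0"
  by (simp add: op_apply_simps)

lemma det_eq_tame_hol_hol: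
  assumes h: "h analytic_on cball 0 1" "\<And>z. z \<in> cball 0 1 \<Longrightarrow> h z \<noteq> 0"
    and k: "k analytic_on cball 0 1" "\<And>z. z \<in> cball 0 1 \<Longrightarrow> k z \<noteq> 0"
  shows "det_eq_tame h k"
proof -
  have g: "factorable h" "factorable k" by (rule factorable.hol, fact h, fact h, rule factorable.hol, fact k, fact k)
  have tp: "tame_prod h k = 1" by (rule tame_prod_hol_hol; fact)
  show ?thesis
    by (rule det_eq_tame_elem_lift[OF g toeplitz_left_inv_hol[OF h] toeplitz_left_inv_hol[OF k] toeplitz_analytic_commute[OF h(1) k(1)] op_zero_kernel op_zero_kernel])
      (simp_all add: tp)
qed

text \<open>Here \<open>p = 0\<close>, and the determinant is \<open>1 + (h(b) -
  1)\<close>.\<close>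

lemma det_eq_tame_hol_lin:
  assumes h: "h analytic_on cball 0 1" "\<And>z. z \<in> cball 0 1 \<Longrightarrow> h z \<noteq> 0" and b: "b \<in> ball 0 1"
  shows "det_eq_tame h (\<lambda>z. z - b)"
proof -
  have g: "factorable h" by (rule factorable.hol) (fact h)+
  obtain k where k: "\<And>f. op_apply (eval_proj b) f = cinner k f *\<^sub>C hardy_monom 0"
    "\<And>g. g analytic_on cball 0 1 \<Longrightarrow> cinner k (op_apply (toeplitz g) (hardy_monom 0)) = g b"
    by (rule eval_proj_kernel[OF b]) blast
  have k1: "cinner k (hardy_monom 0) = 1"
    using k(2)[of "\<lambda>z. 1"] by (simp add: toeplitz_1 op_apply_simps analytic_on_const)
  have tp: "tame_prod h (\<lambda>z. z - b) = h b" by (rule tame_prod_hol_lin; fact)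
  have c: "toeplitz h * lin_op b = lin_op b * toeplitz h"
    unfolding lin_op_def by (rule toeplitz_analytic_commute[OF h(1) analytic_linear])
  show ?thesis
    by (rule det_eq_tame_elem_lift[OF g factorable.lin[OF b] toeplitz_left_inv_hol[OF h] toeplitz_left_inv_lin[OF b] c op_zero_kernel k(1)])
      (simp_all add: tp op_apply_simps cinner_diff_right k(2)[OF h(1)] k1)
qed

text \<open>Here \<open>p' = 0\<close>, and the determinant is \<open>1\<close> plus the value of
  \<open>(1/h) (1 - h)\<close> at \<open>b\<close>.\<close>

lemma det_eq_tame_lin_hol:
  assumes h: "h analytic_on cball 0 1" "\<And>z. z \<in> cball 0 1 \<Longrightarrow> h z \<noteq> 0" and b: "b \<in> ball 0 1"
  shows "det_eq_tame (\<lambda>z. z - b) h"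
proof -
  have g: "factorable h" by (rule factorable.hol) (fact h)+
  have ih: "(\<lambda>z. inverse (h z)) analytic_on cball 0 1" by (intro analytic_intros h)
  obtain k where k: "\<And>f. op_apply (eval_proj b) f = cinner k f *\<^sub>C hardy_monom 0"
    "\<And>g. g analytic_on cball 0 1 \<Longrightarrow> cinner k (op_apply (toeplitz g) (hardy_monom 0)) = g b"
    by (rule eval_proj_kernel[OF b]) blast
  have k1: "cinner k (hardy_monom 0) = 1"
    using k(2)[of "\<lambda>z. 1"] by (simp add: toeplitz_1 op_apply_simps analytic_on_const)
  have tp: "tame_prod (\<lambda>z. z - b) h = inverse (h b)" by (rule tame_prod_lin_hol; fact)
  have c: "lin_op b * toeplitz h = toeplitz h * lin_op b"
    unfolding lin_op_def by (rule toeplitz_analytic_commute[OF analytic_linear h(1)])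
  have "toeplitz (\<lambda>z. inverse (h z)) * toeplitz h = 1"
    using toeplitz_left_inv_hol[OF h] by (simp add: toeplitz_left_inv_def)
  then have BA: "op_apply (toeplitz (\<lambda>z. inverse (h z))) (op_apply (toeplitz h) f) = f" for f
    by (metis one_hardy_op.rep_eq times_hardy_op.rep_eq)
  show ?thesis
    by (rule det_eq_tame_elem_lift[OF factorable.lin[OF b] g toeplitz_left_inv_lin[OF b] toeplitz_left_inv_hol[OF h] c k(1) op_zero_kernel])
      (simp_all add: tp op_apply_simps op_apply_diff cinner_diff_right BA k(2) k1 ih)
qed

text \<open>The second diagonal entry vanishes, because \<open>B'\<close> kills the constants and
  inverts \<open>A'\<close>. Both off-diagonal entries are \<open>1\<close>, the second because
  \<open>A - A'\<close> is a constant.\<close>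

lemma det_eq_tame_lin_lin:
  assumes a: "a \<in> ball 0 1" and b: "b \<in> ball 0 1"
  shows "det_eq_tame (\<lambda>z. z - a) (\<lambda>z. z - b)"
proof -
  obtain k where k: "\<And>f. op_apply (eval_proj a) f = cinner k f *\<^sub>C hardy_monom 0"
    "\<And>g. g analytic_on cball 0 1 \<Longrightarrow> cinner k (op_apply (toeplitz g) (hardy_monom 0)) = g a"
    by (rule eval_proj_kernel[OF a]) blast
  obtain k' where k': "\<And>f. op_apply (eval_proj b) f = cinner k' f *\<^sub>C hardy_monom 0"
    "\<And>g. g analytic_on cball 0 1 \<Longrightarrow> cinner k' (op_apply (toeplitz g) (hardy_monom 0)) = g b"
    by (rule eval_proj_kernel[OF b]) blast
  have k1: "cinner k (hardy_monom 0) = 1" "cinner k' (hardy_monom 0) = 1"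
    using k(2)[of "\<lambda>z. 1"] k'(2)[of "\<lambda>z. 1"] by (simp_all add: toeplitz_1 op_apply_simps analytic_on_const)
  have kA: "cinner k' (op_apply (lin_op c) (hardy_monom 0)) = b - c" for c
    unfolding lin_op_def by (rule k'(2)[OF analytic_linear])
  have c: "lin_op a * lin_op b = lin_op b * lin_op a"
    unfolding lin_op_def by (rule toeplitz_analytic_commute[OF analytic_linear analytic_linear])
  have BA: "op_apply (lin_linv b) (op_apply (lin_op b) f) = f" for f
    using lin_linv_lin_op[OF b] by (metis one_hardy_op.rep_eq times_hardy_op.rep_eq)
  have Aa: "op_apply (lin_op a) f = op_apply (lin_op b) f + (b - a) *\<^sub>C f" for f
  proof -
    have "lin_op a = toeplitz (\<lambda>z. (z - b) + (b - a))" by (simp add: lin_op_def)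
    also have "\<dots> = lin_op b + toeplitz (\<lambda>z. b - a)"
      unfolding lin_op_def by (intro toeplitz_add continuous_intros)
    finally show ?thesis by (simp add: plus_hardy_op.rep_eq toeplitz_const)
  qed
  have Ba: "op_apply (lin_linv b) (op_apply (lin_op a) (hardy_monom 0)) = hardy_monom 0"
    by (simp add: Aa BA lin_linv_hardy_monom_0[OF b] scaleC_zero_right)
  show ?thesis
    by (rule det_eq_tame_elem_lift[OF factorable.lin[OF a] factorable.lin[OF b] toeplitz_left_inv_lin[OF a] toeplitz_left_inv_lin[OF b] c k(1) k'(1)])
      (simp add: tame_prod_lin_lin[OF a b] op_apply_simps op_apply_diff cinner_diff_right cinner_minus_right BA Ba lin_linv_hardy_monom_0[OF b] kA k1)
qed

section \<open>Multiplicativity in both arguments\<close>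

lemma det_eq_tame_mult_left:
  assumes g: "factorable F" "factorable F'" "factorable G" and d: "det_eq_tame F G" "det_eq_tame F' G"
  shows "det_eq_tame (\<lambda>z. F z * F' z) G"
proof -
  obtain R R' where R: "lift_pair 2 F R R'" using lift_pair_exists[OF g(1)] by blast
  obtain Q Q' where Q: "lift_pair 2 F' Q Q'" using lift_pair_exists[OF g(2)] by blast
  obtain S S' where S: "lift_pair 3 G S S'" using lift_pair_exists[OF g(3)] by blast
  have inv: "inv_pair R R'" "inv_pair Q Q'" "inv_pair S S'" using R Q S by (simp_all add: lift_pair_def)
  have "mdet ((R ** Q) ** S ** (Q' ** R') ** S') = mdet (R ** S ** R' ** S') * mdet (Q ** S ** Q' ** S')"
    by (rule mdet_commutator_mult[OF inv lift_pair_commute[OF g(1,3) R S] lift_pair_commute[OF g(2,3) Q S]])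
  also have "\<dots> = tame_prod (\<lambda>z. F z * F' z) G"
    using d R Q S by (simp add: det_eq_tame_def tame_prod_mult_left[OF g])
  finally show ?thesis
    by (intro det_eq_tameI[OF factorable.mult[OF g(1,2)] lift_pair_mult[OF g(1) R g(2) Q] g(3) S])
qed

lemma det_eq_tame_inverse_left:
  assumes g: "factorable F" "factorable G" and d: "det_eq_tame F G"
  shows "det_eq_tame (\<lambda>z. inverse (F z)) G"
proof -
  obtain R R' where R: "lift_pair 2 F R R'" using lift_pair_exists[OF g(1)] by blast
  obtain S S' where S: "lift_pair 3 G S S'" using lift_pair_exists[OF g(2)] by blast
  note R' = lift_pair_inverse[OF R]
  have inv: "inv_pair R R'" "inv_pair R' R" "inv_pair S S'" using R R' S by (simp_all add: lift_pair_def)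
  have "mdet ((R' ** R) ** S ** (R' ** R) ** S') = mdet (R' ** S ** R ** S') * mdet (R ** S ** R' ** S')"
    by (rule mdet_commutator_mult[OF inv(2,1,3) lift_pair_commute[OF factorable.inv[OF g(1)] g(2) R' S] lift_pair_commute[OF g(1,2) R S]])
  then have "mdet (R' ** S ** R ** S') * tame_prod F G = 1"
    using d R S by (simp add: det_eq_tame_def inv_pair_cancel[OF inv(1)] inv_pair_cancel[OF inv(3)] mdet_1)
  then have "mdet (R' ** S ** R ** S') = tame_prod (\<lambda>z. inverse (F z)) G"
    using tame_prod_inverse(1)[OF g] by (metis mult_cancel_right mult_zero_right zero_neq_one)
  then show ?thesis
    by (intro det_eq_tameI[OF factorable.inv[OF g(1)] R' g(2) S])
qed

lemma det_eq_tame_mult_right: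
  assumes g: "factorable F" "factorable G" "factorable G'" and d: "det_eq_tame F G" "det_eq_tame F G'"
  shows "det_eq_tame F (\<lambda>z. G z * G' z)"
proof -
  obtain R R' where R: "lift_pair 2 F R R'" using lift_pair_exists[OF g(1)] by blast
  obtain S S' where S: "lift_pair 3 G S S'" using lift_pair_exists[OF g(2)] by blast
  obtain Q Q' where Q: "lift_pair 3 G' Q Q'" using lift_pair_exists[OF g(3)] by blast
  have inv: "inv_pair R R'" "inv_pair S S'" "inv_pair Q Q'" using R Q S by (simp_all add: lift_pair_def)
  have "mdet (R ** (S ** Q) ** R' ** (Q' ** S')) = mdet (R ** S ** R' ** S') * mdet (R ** Q ** R' ** Q')"
    by (rule mdet_commutator_mult_right[OF inv lift_pair_commute[OF g(1,2) R S] lift_pair_commute[OF g(1,3) R Q]])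
  also have "\<dots> = tame_prod F (\<lambda>z. G z * G' z)"
    using d R Q S by (simp add: det_eq_tame_def tame_prod_mult_right[OF g])
  finally show ?thesis
    by (intro det_eq_tameI[OF g(1) R factorable.mult[OF g(2,3)] lift_pair_mult[OF g(2) S g(3) Q]])
qed

lemma det_eq_tame_inverse_right:
  assumes g: "factorable F" "factorable G" and d: "det_eq_tame F G"
  shows "det_eq_tame F (\<lambda>z. inverse (G z))"
proof -
  obtain R R' where R: "lift_pair 2 F R R'" using lift_pair_exists[OF g(1)] by blast
  obtain S S' where S: "lift_pair 3 G S S'" using lift_pair_exists[OF g(2)] by blast
  note S' = lift_pair_inverse[OF S]
  have inv: "inv_pair R R'" "inv_pair S S'" "inv_pair S' S" using R S S' by (simp_all add: lift_pair_def)
  have "mdet (R ** (S' ** S) ** R' ** (S' ** S)) = mdet (R ** S' ** R' ** S) * mdet (R ** S ** R' ** S')"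
    by (rule mdet_commutator_mult_right[OF inv(1,3,2) lift_pair_commute[OF g(1) factorable.inv[OF g(2)] R S'] lift_pair_commute[OF g R S]])
  then have "mdet (R ** S' ** R' ** S) * tame_prod F G = 1"
    using d R S by (simp add: det_eq_tame_def inv_pair_cancel[OF inv(1)] inv_pair_cancel[OF inv(2)] mdet_1)
  then have "mdet (R ** S' ** R' ** S) = tame_prod F (\<lambda>z. inverse (G z))"
    using tame_prod_inverse(2)[OF g] by (metis mult_cancel_right mult_zero_right zero_neq_one)
  then show ?thesis
    by (intro det_eq_tameI[OF g(1) R factorable.inv[OF g(2)] S'])
qed

lemma det_eq_tame_factorable:
  assumes F: "factorable F" and G: "factorable G"
  shows "det_eq_tame F G"
  using F
proof induction
  case (hol h)
  note h = hol
  have gh: "factorable h" by (rule factorable.hol) (fact h)+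
  from G show ?case
  proof induction
    case (hol k)
    then show ?case by (intro det_eq_tame_hol_hol h)
  next
    case (lin b)
    then show ?case by (intro det_eq_tame_hol_lin h)
  next
    case (mult G G')
    then show ?case by (intro det_eq_tame_mult_right gh)
  next
    case (inv G)
    then show ?case by (intro det_eq_tame_inverse_right gh)
  qed
next
  case (lin a)
  note a = lin
  from G show ?case
  proof induction
    case (hol k)
    then show ?case by (intro det_eq_tame_lin_hol a)
  next
    case (lin b)
    then show ?case by (intro det_eq_tame_lin_lin a)
  next
    case (mult G G')
    then show ?case by (intro det_eq_tame_mult_right factorable.lin a)
  next
    case (inv G)
    then show ?case by (intro det_eq_tame_inverse_right factorable.lin a)
  qed
next
  case (mult F F')
  then show ?case by (intro det_eq_tame_mult_left G)
next
  case (inv F)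
  then show ?case by (intro det_eq_tame_inverse_left G)
qed

text \<open>The definite description does not specify the symbols of the inverses of the lifts
  \<open>R\<close> and \<open>S\<close>; hence the lifts are compared with the explicit lifts by
  the perturbation lemmas directly.\<close>

lemma delta_eq_tame_prod:
  fixes \<phi> \<psi> :: "complex \<Rightarrow> complex"
  assumes F: "factorable F" "\<And>z. z \<in> circle \<Longrightarrow> F z = \<phi> z" and G: "factorable G" "\<And>z. z \<in> circle \<Longrightarrow> G z = \<psi> z"
  shows "delta \<phi> \<psi> = tame_prod F G"
proof -
  have dg: "lifts R (symbol_diag j \<phi>) \<longleftrightarrow> lifts R (symbol_diag j F)" "symbol_diag j \<phi> i \<in> Cmu"
    if F: "factorable F" "\<And>z. z \<in> circle \<Longrightarrow> F z = \<phi> z" for R j i F \<phi>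
  proof -
    have eq: "symbol_diag j F i z = symbol_diag j \<phi> i z" if "z \<in> circle" for i z using F(2)[OF that] by (simp add: symbol_diag_def)
    have "toeplitz (symbol_diag j \<phi> i) = toeplitz (symbol_diag j F i)" for i
      by (rule toeplitz_cong[symmetric, OF eq Cmu_continuous[OF symbol_diag_Cmu[OF F(1)]]])
    then show "lifts R (symbol_diag j \<phi>) \<longleftrightarrow> lifts R (symbol_diag j F)" by (simp add: lifts_def diag_toeplitz_def cong: if_cong)
    obtain H where "is_merom_ext (symbol_diag j F i) H" using symbol_diag_Cmu[OF F(1)] by (auto simp: Cmu_def)
    then have "is_merom_ext (symbol_diag j \<phi> i) H" using eq by (auto simp: is_merom_ext_def)
    then show "symbol_diag j \<phi> i \<in> Cmu" by (auto simp: Cmu_def)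
  qed
  have sym2: "has_symbol_matrix R (diag3 \<phi> (\<lambda>z. inverse (\<phi> z)) (\<lambda>z. 1)) \<longleftrightarrow> lifts R (symbol_diag 2 F)" for R
    using lifts_iff_has_symbol_matrix[of "symbol_diag 2 \<phi>" R, OF dg(2)[OF F]] dg(1)[OF F] by (simp add: symbol_diag_def[of 2 \<phi>])
  have sym3: "has_symbol_matrix S (diag3 \<psi> (\<lambda>z. 1) (\<lambda>z. inverse (\<psi> z))) \<longleftrightarrow> lifts S (symbol_diag 3 G)" for S
    using lifts_iff_has_symbol_matrix[of "symbol_diag 3 \<psi>" S, OF dg(2)[OF G]] dg(1)[OF G] by (simp add: symbol_diag_def[of 3 \<psi>])
  have GL: "R \<in> GL3_Tmu" if "lift_pair j F R R'" "factorable F" for j F R R'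
  proof -
    have "R $ i $ k \<in> Tmu" for i k
      by (rule lifts_Tmu[of "symbol_diag j F"]) (use that in \<open>auto simp: lift_pair_def symbol_diag_Cmu\<close>)
    moreover have "R' $ i $ k \<in> Tmu" for i k
      by (rule lifts_Tmu[of "symbol_diag j (\<lambda>z. inverse (F z))"]) (use that in \<open>auto simp: lift_pair_def symbol_diag_Cmu factorable.inv\<close>)
    ultimately show ?thesis
      using that(1) by (auto simp: GL3_Tmu_def lift_pair_def inv_pair_def)
  qed
  obtain R0 R0' where R0: "lift_pair 2 F R0 R0'" using lift_pair_exists[OF F(1)] by blast
  obtain S0 S0' where S0: "lift_pair 3 G S0 S0'" using lift_pair_exists[OF G(1)] by blast
  have i0: "inv_pair R0 R0'" "inv_pair S0 S0'" using R0 S0 by (simp_all add: lift_pair_def)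
  have d0: "mdet (R0 ** S0 ** R0' ** S0') = tame_prod F G"
    using det_eq_tame_factorable[OF F(1) G(1)] R0 S0 by (simp add: det_eq_tame_def)
  show ?thesis
    unfolding delta_def
  proof (rule the_equality)
    show "\<exists>R\<in>GL3_Tmu. \<exists>S\<in>GL3_Tmu.
        has_symbol_matrix R (diag3 \<phi> (\<lambda>z. inverse (\<phi> z)) (\<lambda>z. 1)) \<and>
        has_symbol_matrix S (diag3 \<psi> (\<lambda>z. 1) (\<lambda>z. inverse (\<psi> z))) \<and>
        tame_prod F G = fredholm_det (matrix_apply (R ** S ** matrix_inv R ** matrix_inv S))"
      using R0 S0 GL[OF R0 F(1)] GL[OF S0 G(1)] d0
      by (intro bexI[of _ R0] bexI[of _ S0]) (auto simp: sym2 sym3 lift_pair_def matrix_inv_eq[OF i0(1)] matrix_inv_eq[OF i0(2)] mdet_def)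
  next
    fix d
    assume "\<exists>R\<in>GL3_Tmu. \<exists>S\<in>GL3_Tmu.
        has_symbol_matrix R (diag3 \<phi> (\<lambda>z. inverse (\<phi> z)) (\<lambda>z. 1)) \<and>
        has_symbol_matrix S (diag3 \<psi> (\<lambda>z. 1) (\<lambda>z. inverse (\<psi> z))) \<and>
        d = fredholm_det (matrix_apply (R ** S ** matrix_inv R ** matrix_inv S))"
    then obtain R S where R: "R \<in> GL3_Tmu" "lifts R (symbol_diag 2 F)" and S: "S \<in> GL3_Tmu" "lifts S (symbol_diag 3 G)"
      and d: "d = mdet (R ** S ** matrix_inv R ** matrix_inv S)"
      by (auto simp: sym2 sym3 mdet_def)
    obtain R' S' where i: "inv_pair R R'" "inv_pair S S'"
      using R(1) S(1) unfolding GL3_Tmu_def inv_pair_def by blast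
    have c: "trace_class_mat (R0 ** S0 - S0 ** R0)" by (rule lift_pair_commute[OF F(1) G(1) R0 S0])
    have dR: "trace_class_mat (R - R0)" "trace_class_mat (S - S0)"
      using R0 S0 R S lifts_diff by (auto simp: lift_pair_def)
    have c2: "trace_class_mat (R ** S0 - S0 ** R)"
      by (rule lifts_commute[OF R(2), of _ "symbol_diag 3 G"]) (use S0 in \<open>auto simp: lift_pair_def intro: symbol_diag_Cmu F G\<close>)
    have "mdet (R ** S ** R' ** S') = mdet (R ** S0 ** R' ** S0')"
      by (rule mdet_commutator_perturb_right[OF i(1,2) i0(2) c2 dR(2)])
    also have "\<dots> = mdet (R0 ** S0 ** R0' ** S0')"
      by (rule mdet_commutator_perturb_left[OF i0(1) i(1) i0(2) c dR(1)])
    finally show "d = tame_prod F G"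
      using d d0 by (simp add: matrix_inv_eq[OF i(1)] matrix_inv_eq[OF i(2)])
  qed
qed

theorem theorem10:
  fixes \<phi> \<psi> :: "complex \<Rightarrow> complex"
  assumes "\<phi> \<in> Cmu_units" and "\<psi> \<in> Cmu_units"
  shows "delta \<phi> \<psi> = tame_pi \<phi> \<psi>"
proof -
  obtain F where F: "factorable F" "\<And>z. z \<in> circle \<Longrightarrow> F z = \<phi> z"
    by (rule Cmu_unit_factorable[OF assms(1)]) blast
  obtain G where G: "factorable G" "\<And>z. z \<in> circle \<Longrightarrow> G z = \<psi> z"
    by (rule Cmu_unit_factorable[OF assms(2)]) blast
  show ?thesis
    by (simp only: delta_eq_tame_prod[OF F G] tame_pi_eq_tame_prod[OF F G])
qed

end
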